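(* Let $K$ be a field and let $G$ be a finite group acting faithfully via $\beta$ on a $K$-algebra $S$ by $K$-algebra automorphisms, with invariant ring $R=S^G$. Let $\rho$ be a $K$-linear representation of $G$ on the finite-dimensional $K$-vector space $V$, let $G$ act naturally on $N=S\otimes_K V$, and let $M=N^\rho$ be the corresponding invariant $R$-module. Then there is a canonical $\mathbb N$-graded $R$-algebra homomorphism $$\operatorname{Sym}_R(M)\longrightarrow (S\otimes_K K[V])^{\beta\times\rho}.$$ It is an isomorphism in degrees $0$ and $1$.
   Context: The group acts on rings and modules from the right. The natural action of $G$ on $N=S\otimes_K V$ is $s\otimes v\mapsto sg\otimes vg$ for $g\in G$ (on both tensor factors), and $M=N^\rho=\{w\in N: wg=w \text{ for all } g\in G\}$, which is an $R$-module (the module of covariants, or invariant module). $V$ is regarded as a space of linear forms, $K[V]=\operatorname{Sym}_K V$ is the polynomial algebra on $V$, graded with $V$ in degree $1$; $G$ acts on $S\otimes_K K[V]$ on both factors (via $\beta$ on $S$ and via the action on $K[V]$ induced by $\rho$), and $(S\otimes_K K[V])^{\beta\times\rho}$ is the ring of invariants, graded by the degree in $K[V]$ (elements of $S$ having degree $0$). The canonical homomorphism is the one induced, by the universal property of the symmetric algebra, from the $R$-module homomorphism $M=(S\otimes_K V)^\rho\to (S\otimes_K K[V])^{\beta\times\rho}$ coming from the inclusion $S\otimes_K V\subseteq S\otimes_K K[V]$. *)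

theory Defs
  imports "HOL-Algebra.Algebra" "Jordan_Normal_Form.Missing_VectorSpace"
begin

section \<open>Group actions from the right\<close>

definition right_action :: "('g, 'x) monoid_scheme \<Rightarrow> 'a set \<Rightarrow> ('g \<Rightarrow> 'a \<Rightarrow> 'a) \<Rightarrow> bool"
  where "right_action G E \<phi> \<longleftrightarrow>
    (\<forall>g\<in>carrier G. \<phi> g \<in> E \<rightarrow> E) \<and>
    (\<forall>x\<in>E. \<phi> \<one>\<^bsub>G\<^esub> x = x) \<and>
    (\<forall>g\<in>carrier G. \<forall>h\<in>carrier G. \<forall>x\<in>E. \<phi> (g \<otimes>\<^bsub>G\<^esub> h) x = \<phi> h (\<phi> g x))"

definition faithful_on :: "('g, 'x) monoid_scheme \<Rightarrow> 'a set \<Rightarrow> ('g \<Rightarrow> 'a \<Rightarrow> 'a) \<Rightarrow> bool"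
  where "faithful_on G E \<phi> \<longleftrightarrow>
    (\<forall>g\<in>carrier G. (\<forall>x\<in>E. \<phi> g x = x) \<longrightarrow> g = \<one>\<^bsub>G\<^esub>)"

definition fixed_set :: "('g, 'x) monoid_scheme \<Rightarrow> 'a set \<Rightarrow> ('g \<Rightarrow> 'a \<Rightarrow> 'a) \<Rightarrow> 'a set"
  where "fixed_set G E \<phi> = {x \<in> E. \<forall>g\<in>carrier G. \<phi> g x = x}"

definition fixed_part ::
  "('g, 'x) monoid_scheme \<Rightarrow> ('k, 'a, 'y) module_scheme \<Rightarrow> ('g \<Rightarrow> 'a \<Rightarrow> 'a) \<Rightarrow> ('k, 'a, 'y) module_scheme"
  where "fixed_part G A \<phi> = A\<lparr>carrier := fixed_set G (carrier A) \<phi>\<rparr>"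


section \<open>Algebras and gradings\<close>

definition algebra_hom ::
  "('r, 'x) ring_scheme \<Rightarrow> ('r, 'a, 'y) module_scheme \<Rightarrow> ('r, 'b, 'z) module_scheme \<Rightarrow> ('a \<Rightarrow> 'b) set"
  where "algebra_hom R A B = ring_hom A B \<inter> LinearCombinations.module_hom R A B"

definition graded_algebra ::
  "('r, 'x) ring_scheme \<Rightarrow> ('r, 'a, 'y) module_scheme \<Rightarrow> (nat \<Rightarrow> 'a set) \<Rightarrow> bool"
  where "graded_algebra R A gr \<longleftrightarrow>
    algebra R A \<and>
    (\<forall>d. Module.submodule (gr d) R A) \<and>
    (\<forall>x\<in>carrier A. \<exists>!c. (\<forall>d. c d \<in> gr d) \<and> finite {d. c d \<noteq> \<zero>\<^bsub>A\<^esub>} \<and>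
        x = (\<Oplus>\<^bsub>A\<^esub>d\<in>{d. c d \<noteq> \<zero>\<^bsub>A\<^esub>}. c d)) \<and>
    \<one>\<^bsub>A\<^esub> \<in> gr 0 \<and>
    (\<forall>d e. \<forall>x\<in>gr d. \<forall>y\<in>gr e. x \<otimes>\<^bsub>A\<^esub> y \<in> gr (d + e))"


section \<open>The symmetric algebra of a module\<close>

text \<open>The library supplies the set of polynomials in variables indexed by \<open>I\<close>, as functions from
  monomials (multisets over \<open>I\<close>) to coefficients, but no product of two polynomials.\<close>

definition indexed_poly_ring :: "('r, 'x) ring_scheme \<Rightarrow> 'i set \<Rightarrow> ('i multiset \<Rightarrow> 'r) ring"
  where "indexed_poly_ring R I =
    \<lparr>carrier = ring.indexed_pset R I (carrier R),
     monoid.mult = (\<lambda>P Q m. \<Oplus>\<^bsub>R\<^esub>a\<in>{a. a \<subseteq># m}. P a \<otimes>\<^bsub>R\<^esub> Q (m - a)),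
     one = ring.indexed_const R \<one>\<^bsub>R\<^esub>,
     ring.zero = ring.indexed_const R \<zero>\<^bsub>R\<^esub>,
     ring.add = ring.indexed_padd R\<rparr>"

text \<open>The symmetric algebra of \<open>M\<close> over \<open>R\<close> is the polynomial ring with one variable \<open>X m\<close> for each
  \<open>m\<close> in \<open>M\<close>, modulo the ideal that makes \<open>m \<mapsto> X m\<close> an \<open>R\<close>-linear map.\<close>

definition sym_relations ::
  "('r, 'x) ring_scheme \<Rightarrow> ('r, 'm, 'y) module_scheme \<Rightarrow> ('m multiset \<Rightarrow> 'r) set"
  where "sym_relations R M =
    (let P = indexed_poly_ring R (carrier M); var = ring.indexed_var R in
      {var (m \<oplus>\<^bsub>M\<^esub> n) \<ominus>\<^bsub>P\<^esub> (var m \<oplus>\<^bsub>P\<^esub> var n) | m n. m \<in> carrier M \<and> n \<in> carrier M} \<union>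
      {var (r \<odot>\<^bsub>M\<^esub> m) \<ominus>\<^bsub>P\<^esub> (ring.indexed_const R r \<otimes>\<^bsub>P\<^esub> var m) | r m. r \<in> carrier R \<and> m \<in> carrier M})"

definition sym_ideal ::
  "('r, 'x) ring_scheme \<Rightarrow> ('r, 'm, 'y) module_scheme \<Rightarrow> ('m multiset \<Rightarrow> 'r) set"
  where "sym_ideal R M = Idl\<^bsub>indexed_poly_ring R (carrier M)\<^esub> (sym_relations R M)"

definition sym_class ::
  "('r, 'x) ring_scheme \<Rightarrow> ('r, 'm, 'y) module_scheme \<Rightarrow> ('m multiset \<Rightarrow> 'r) \<Rightarrow> ('m multiset \<Rightarrow> 'r) set"
  where "sym_class R M p = sym_ideal R M +>\<^bsub>indexed_poly_ring R (carrier M)\<^esub> p"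

definition Sym ::
  "('r, 'x) ring_scheme \<Rightarrow> ('r, 'm, 'y) module_scheme \<Rightarrow> ('r, ('m multiset \<Rightarrow> 'r) set) module"
  where "Sym R M =
    (let Q = indexed_poly_ring R (carrier M) Quot sym_ideal R M in
      \<lparr>carrier = carrier Q, monoid.mult = monoid.mult Q, one = one Q,
       ring.zero = ring.zero Q, ring.add = ring.add Q,
       smult = (\<lambda>r w. sym_class R M (ring.indexed_const R r) \<otimes>\<^bsub>Q\<^esub> w)\<rparr>)"

definition sym_incl ::
  "('r, 'x) ring_scheme \<Rightarrow> ('r, 'm, 'y) module_scheme \<Rightarrow> 'm \<Rightarrow> ('m multiset \<Rightarrow> 'r) set"
  where "sym_incl R M m = sym_class R M (ring.indexed_var R m)"

definition sym_grade ::
  "('r, 'x) ring_scheme \<Rightarrow> ('r, 'm, 'y) module_scheme \<Rightarrow> nat \<Rightarrow> ('m multiset \<Rightarrow> 'r) set set"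
  where "sym_grade R M d =
    {sym_class R M p | p. p \<in> carrier (indexed_poly_ring R (carrier M)) \<and>
                          (\<forall>m. p m \<noteq> \<zero>\<^bsub>R\<^esub> \<longrightarrow> size m = d)}"

text \<open>Functoriality: a linear map \<open>h\<close> from \<open>M\<close> to \<open>M'\<close> acts on representatives by the substitution
  of \<open>X (h m)\<close> for \<open>X m\<close>; all representatives of a class give the same class.\<close>

definition indexed_poly_rename ::
  "('r, 'x) ring_scheme \<Rightarrow> ('i \<Rightarrow> 'j) \<Rightarrow> ('i multiset \<Rightarrow> 'r) \<Rightarrow> ('j multiset \<Rightarrow> 'r)"
  where "indexed_poly_rename R h p =
    (\<lambda>m. \<Oplus>\<^bsub>R\<^esub>n\<in>{n. p n \<noteq> \<zero>\<^bsub>R\<^esub> \<and> image_mset h n = m}. p n)"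

definition sym_map ::
  "('r, 'x) ring_scheme \<Rightarrow> ('r, 'm, 'y) module_scheme \<Rightarrow> ('r, 'n, 'z) module_scheme \<Rightarrow>
    ('m \<Rightarrow> 'n) \<Rightarrow> ('m multiset \<Rightarrow> 'r) set \<Rightarrow> ('n multiset \<Rightarrow> 'r) set"
  where "sym_map R M M' h w = (\<Union>p\<in>w. sym_class R M' (indexed_poly_rename R h p))"


section \<open>The tensor product of an algebra and a module\<close>

text \<open>The tensor product over \<open>K\<close> is the free abelian group on pairs modulo biadditivity and
  \<open>K\<close>-balancedness.\<close>

definition tensor_relations ::
  "('k, 'x) ring_scheme \<Rightarrow> ('k, 'a, 'y) module_scheme \<Rightarrow> ('k, 'b, 'z) module_scheme \<Rightarrow> ('a \<times> 'b \<Rightarrow>\<^sub>0 int) set"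
  where "tensor_relations K A B =
    {frag_of (a \<oplus>\<^bsub>A\<^esub> a', b) - (frag_of (a, b) + frag_of (a', b)) | a a' b.
        a \<in> carrier A \<and> a' \<in> carrier A \<and> b \<in> carrier B} \<union>
    {frag_of (a, b \<oplus>\<^bsub>B\<^esub> b') - (frag_of (a, b) + frag_of (a, b')) | a b b'.
        a \<in> carrier A \<and> b \<in> carrier B \<and> b' \<in> carrier B} \<union>
    {frag_of (k \<odot>\<^bsub>A\<^esub> a, b) - frag_of (a, k \<odot>\<^bsub>B\<^esub> b) | k a b.
        k \<in> carrier K \<and> a \<in> carrier A \<and> b \<in> carrier B}"

definition tensor_kernel ::
  "('k, 'x) ring_scheme \<Rightarrow> ('k, 'a, 'y) module_scheme \<Rightarrow> ('k, 'b, 'z) module_scheme \<Rightarrow> ('a \<times> 'b \<Rightarrow>\<^sub>0 int) set"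
  where "tensor_kernel K A B =
    generate (free_Abelian_group (carrier A \<times> carrier B)) (tensor_relations K A B)"

definition tensor_class ::
  "('k, 'x) ring_scheme \<Rightarrow> ('k, 'a, 'y) module_scheme \<Rightarrow> ('k, 'b, 'z) module_scheme \<Rightarrow>
    ('a \<times> 'b \<Rightarrow>\<^sub>0 int) \<Rightarrow> ('a \<times> 'b \<Rightarrow>\<^sub>0 int) set"
  where "tensor_class K A B f =
    tensor_kernel K A B #>\<^bsub>free_Abelian_group (carrier A \<times> carrier B)\<^esub> f"

text \<open>For a \<open>K\<close>-algebra \<open>S\<close> the tensor product carries scalars from \<open>S\<close>, acting on the left factor.
  The product \<open>(s \<otimes> b) (s' \<otimes> b') = s s' \<otimes> b b'\<close> and the unit are meaningful only if \<open>B\<close> is a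
  \<open>K\<close>-algebra too; for a mere module \<open>B\<close> these two fields are junk.\<close>

definition tensor ::
  "('k, 'x) ring_scheme \<Rightarrow> ('k, 's, 'y) module_scheme \<Rightarrow> ('k, 'b, 'z) module_scheme \<Rightarrow>
    ('s, ('s \<times> 'b \<Rightarrow>\<^sub>0 int) set) module"
  where "tensor K S B =
    (let Q = free_Abelian_group (carrier S \<times> carrier B) Mod tensor_kernel K S B in
      \<lparr>carrier = carrier Q,
       monoid.mult = (\<lambda>w w'. \<Union>f\<in>w. \<Union>f'\<in>w'. tensor_class K S B
          (frag_extend (\<lambda>(s, b). frag_extend (\<lambda>(s', b'). frag_of (s \<otimes>\<^bsub>S\<^esub> s', b \<otimes>\<^bsub>B\<^esub> b')) f') f)),
       one = tensor_class K S B (frag_of (\<one>\<^bsub>S\<^esub>, \<one>\<^bsub>B\<^esub>)),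
       ring.zero = one Q,
       ring.add = monoid.mult Q,
       smult = (\<lambda>t w. \<Union>f\<in>w. tensor_class K S B
          (frag_extend (\<lambda>(s, b). frag_of (t \<otimes>\<^bsub>S\<^esub> s, b)) f))\<rparr>)"

text \<open>The map \<open>s \<otimes> b \<mapsto> h s \<otimes> k b\<close>.\<close>

definition tensor_map ::
  "('k, 'x) ring_scheme \<Rightarrow> ('k, 's, 'y) module_scheme \<Rightarrow> ('k, 'b, 'z) module_scheme \<Rightarrow>
    ('k, 'c, 'w) module_scheme \<Rightarrow> ('s \<Rightarrow> 's) \<Rightarrow> ('b \<Rightarrow> 'c) \<Rightarrow>
    ('s \<times> 'b \<Rightarrow>\<^sub>0 int) set \<Rightarrow> ('s \<times> 'c \<Rightarrow>\<^sub>0 int) set"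
  where "tensor_map K S B C h k w =
    (\<Union>f\<in>w. tensor_class K S C (frag_extend (\<lambda>(s, b). frag_of (h s, k b)) f))"

text \<open>The image in \<open>S \<otimes> B\<close> of \<open>S \<otimes> gr d\<close>.\<close>

definition tensor_grade ::
  "('k, 'x) ring_scheme \<Rightarrow> ('k, 's, 'y) module_scheme \<Rightarrow> ('k, 'b, 'z) module_scheme \<Rightarrow>
    (nat \<Rightarrow> 'b set) \<Rightarrow> nat \<Rightarrow> ('s \<times> 'b \<Rightarrow>\<^sub>0 int) set set"
  where "tensor_grade K S B gr d =
    {tensor_class K S B f | f. f \<in> carrier (free_Abelian_group (carrier S \<times> gr d))}"


section \<open>Covariants and invariants\<close>

text \<open>The scalars of the next two records are the elements of \<open>S\<close>, so both can be read over the
  invariant ring \<open>fixed_part G S \<beta>\<close>.\<close>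

definition covariants ::
  "('k, 'x) ring_scheme \<Rightarrow> ('g, 'w) monoid_scheme \<Rightarrow> ('k, 's, 'y) module_scheme \<Rightarrow> ('g \<Rightarrow> 's \<Rightarrow> 's) \<Rightarrow>
    ('k, 'v, 'z) module_scheme \<Rightarrow> ('g \<Rightarrow> 'v \<Rightarrow> 'v) \<Rightarrow> ('s, ('s \<times> 'v \<Rightarrow>\<^sub>0 int) set) module"
  where "covariants K G S \<beta> V \<rho> =
    fixed_part G (tensor K S V) (\<lambda>g. tensor_map K S V V (\<beta> g) (\<rho> g))"

definition poly_invariants ::
  "('k, 'x) ring_scheme \<Rightarrow> ('g, 'w) monoid_scheme \<Rightarrow> ('k, 's, 'y) module_scheme \<Rightarrow> ('g \<Rightarrow> 's \<Rightarrow> 's) \<Rightarrow>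
    ('k, 'v, 'z) module_scheme \<Rightarrow> ('g \<Rightarrow> 'v \<Rightarrow> 'v) \<Rightarrow>
    ('s, ('s \<times> ('v multiset \<Rightarrow> 'k) set \<Rightarrow>\<^sub>0 int) set) module"
  where "poly_invariants K G S \<beta> V \<rho> =
    fixed_part G (tensor K S (Sym K V))
      (\<lambda>g. tensor_map K S (Sym K V) (Sym K V) (\<beta> g) (sym_map K V V (\<rho> g)))"

definition poly_invariants_grade ::
  "('k, 'x) ring_scheme \<Rightarrow> ('g, 'w) monoid_scheme \<Rightarrow> ('k, 's, 'y) module_scheme \<Rightarrow> ('g \<Rightarrow> 's \<Rightarrow> 's) \<Rightarrow>
    ('k, 'v, 'z) module_scheme \<Rightarrow> ('g \<Rightarrow> 'v \<Rightarrow> 'v) \<Rightarrow>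
    nat \<Rightarrow> ('s \<times> ('v multiset \<Rightarrow> 'k) set \<Rightarrow>\<^sub>0 int) set set"
  where "poly_invariants_grade K G S \<beta> V \<rho> d =
    carrier (poly_invariants K G S \<beta> V \<rho>) \<inter> tensor_grade K S (Sym K V) (sym_grade K V) d"

end

theory Submission
  imports Defs
begin

text \<open>The canonical homomorphism exists, and is unique, by the universal property of the symmetric
  algebra (\<open>Sym_universal\<close>, \<open>Sym_hom_eqI\<close>). It respects degrees because \<open>M\<close> lands in degree 1.
  What has to be understood are the degrees 0 and 1.

  The relations that define \<open>Sym\<^sub>K V\<close> are linear forms. Hence the constant coefficient and the linear
  part of a polynomial depend only on its class (\<open>sym_ideal_low_degree\<close>), and they are \<open>K\<close>-linear
  retractions of \<open>K \<rightarrow> K[V]\<close> and of \<open>V \<rightarrow> K[V]\<close>. A retraction tensored with \<open>S\<close> is still a retraction.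
  So \<open>s \<mapsto> s \<otimes> 1\<close> and \<open>S \<otimes> V \<rightarrow> S \<otimes> K[V]\<close> are injective (\<open>pure_one_inject\<close>, \<open>retr_incl\<close>); their images
  are the parts of degree 0 and 1 (\<open>proj_0_range\<close>, \<open>proj_1_range\<close>), and both maps commute with \<open>G\<close>.
  An injective equivariant map reflects invariance. Therefore the invariants of degree 0 and 1 in
  \<open>S \<otimes> K[V]\<close> are exactly the images of \<open>R\<close> and of \<open>M\<close>. The parts of degree 0 and 1 of
  \<open>Sym\<^sub>R M\<close> are the images of \<open>R\<close> and \<open>M\<close> as well (\<open>sym_grade_0\<close>, \<open>sym_grade_1\<close>), and the
  canonical map matches the two sides.

  The rest is the construction of the structures involved. Polynomials are handled by induction over
  constants, sums and multiplication by one variable; tensors by induction over pure tensors and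
  sums. Both gradings are obtained from their projections (\<open>graded_algebraI\<close>): the ideal of relations
  is stable under taking homogeneous parts (\<open>sym_ideal_homogeneous\<close>), so these descend to the symmetric
  algebra; being \<open>K\<close>-linear on \<open>K[V]\<close> they can be tensored with \<open>S\<close>; and since substitutions preserve
  degrees the result commutes with \<open>G\<close> and restricts to the invariants (\<open>proj_actQ\<close>).\<close>

section \<open>Polynomial rings in indexed variables\<close>

lemma finite_submultisets: "finite {a. a \<subseteq># m}"
proof (induction m)
  case (add x m)
  have "{a. a \<subseteq># add_mset x m} \<subseteq> {a. a \<subseteq># m} \<union> add_mset x ` {a. a \<subseteq># m}"
  proof
    fix a assume a: "a \<in> {a. a \<subseteq># add_mset x m}"
    show "a \<in> {a. a \<subseteq># m} \<union> add_mset x ` {a. a \<subseteq># m}"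
    proof (cases "x \<in># a")
      case True
      then obtain b where "a = add_mset x b" by (metis insert_DiffM)
      with a show ?thesis by auto
    next
      case False
      with a show ?thesis by (auto simp: subseteq_mset_def count_eq_zero_iff split: if_split_asm)
        (metis count_eq_zero_iff le0)
    qed
  qed
  with add show ?case by (meson finite_Un finite_imageI finite_subset)
qed simp

context cring
begin

abbreviation polys :: "'i set \<Rightarrow> ('i multiset \<Rightarrow> 'a) ring"
  where "polys I \<equiv> indexed_poly_ring R I"

lemma polys_add: "P \<oplus>\<^bsub>polys I\<^esub> Q = (\<lambda>m. P m \<oplus> Q m)"
  by (simp add: indexed_poly_ring_def indexed_padd_def)

lemma polys_zero: "\<zero>\<^bsub>polys I\<^esub> = (\<lambda>m. \<zero>)"
  by (simp add: indexed_poly_ring_def indexed_const_def)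

lemma polys_one: "\<one>\<^bsub>polys I\<^esub> = indexed_const \<one>"
  by (simp add: indexed_poly_ring_def)

lemma polys_mult: "P \<otimes>\<^bsub>polys I\<^esub> Q = (\<lambda>m. \<Oplus>a\<in>{a. a \<subseteq># m}. P a \<otimes> Q (m - a))"
  by (simp add: indexed_poly_ring_def)

lemma polys_carrier: "carrier (polys I) = indexed_pset I (carrier R)"
  by (simp add: indexed_poly_ring_def)

text \<open>Nearly every fact about polynomials below is proved along this rule.\<close>

lemma polys_induct [consumes 1, case_names const add pmult]:
  assumes "P \<in> carrier (polys I)"
    and "\<And>k. k \<in> carrier R \<Longrightarrow> \<Phi> (indexed_const k)"
    and "\<And>P Q. \<lbrakk>P \<in> carrier (polys I); Q \<in> carrier (polys I); \<Phi> P; \<Phi> Q\<rbrakk> \<Longrightarrow> \<Phi> (P \<oplus>\<^bsub>polys I\<^esub> Q)"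
    and "\<And>P i. \<lbrakk>P \<in> carrier (polys I); i \<in> I; \<Phi> P\<rbrakk> \<Longrightarrow> \<Phi> (indexed_pmult P i)"
  shows "\<Phi> P"
  using assms(1) unfolding polys_carrier
proof (induction rule: indexed_pset.induct)
  case (indexed_padd P Q)
  with assms(3)[of P Q] show ?case by (simp add: indexed_poly_ring_def)
qed (use assms in \<open>simp_all add: polys_carrier\<close>)

lemma const_in_polys [intro, simp]: "k \<in> carrier R \<Longrightarrow> indexed_const k \<in> carrier (polys I)"
  by (simp add: polys_carrier indexed_pset.intros)

lemma pmult_in_polys [intro, simp]: "P \<in> carrier (polys I) \<Longrightarrow> i \<in> I \<Longrightarrow> indexed_pmult P i \<in> carrier (polys I)"
  by (simp add: polys_carrier indexed_pset.intros)

lemma var_in_polys [intro, simp]: "i \<in> I \<Longrightarrow> indexed_var i \<in> carrier (polys I)"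
  by (simp add: indexed_var_def)

lemma add_in_polys: "P \<in> carrier (polys I) \<Longrightarrow> Q \<in> carrier (polys I) \<Longrightarrow> P \<oplus>\<^bsub>polys I\<^esub> Q \<in> carrier (polys I)"
  using indexed_padd unfolding indexed_poly_ring_def by auto

lemma coeff_closed: "P \<in> carrier (polys I) \<Longrightarrow> P m \<in> carrier R"
  using indexed_pset_in_carrier[of "carrier R" P I] by (auto simp: polys_carrier carrier_coeff_def)

lemma finite_support: "P \<in> carrier (polys I) \<Longrightarrow> finite {m. P m \<noteq> \<zero>}"
proof (induction P rule: polys_induct)
  case (const k)
  then show ?case by (auto simp: indexed_const_def intro: finite_subset[of _ "{{#}}"])
next
  case (add P Q)
  then have "finite ({m. P m \<noteq> \<zero>} \<union> {m. Q m \<noteq> \<zero>})" by simp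
  then show ?case by (rule rev_finite_subset) (auto simp: polys_add)
next
  case (pmult P i)
  then have "finite (add_mset i ` {m. P m \<noteq> \<zero>})" by simp
  then show ?case
    by (rule rev_finite_subset) (force simp: indexed_pmult_def image_iff split: if_split_asm)
qed

lemma conv_closed:
  assumes "\<And>m. P m \<in> carrier R" "\<And>m. Q m \<in> carrier R"
  shows "(P \<otimes>\<^bsub>polys I\<^esub> Q) m \<in> carrier R"
  unfolding polys_mult using assms by auto

lemma conv_const_left:
  assumes "k \<in> carrier R" "\<And>m. Q m \<in> carrier R"
  shows "indexed_const k \<otimes>\<^bsub>polys I\<^esub> Q = (\<lambda>m. k \<otimes> Q m)"
proof
  fix m
  have "(\<Oplus>a\<in>{a. a \<subseteq># m}. indexed_const k a \<otimes> Q (m - a))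
      = (\<Oplus>a\<in>{a. a \<subseteq># m}. if {#} = a then k \<otimes> Q (m - a) else \<zero>)"
    using assms by (intro add.finprod_cong') (auto simp: indexed_const_def)
  also have "\<dots> = k \<otimes> Q m"
    using assms add.finprod_singleton[of "{#}" "{a. a \<subseteq># m}" "\<lambda>a. k \<otimes> Q (m - a)"]
    by (simp add: finite_submultisets)
  finally show "(indexed_const k \<otimes>\<^bsub>polys I\<^esub> Q) m = k \<otimes> Q m" by (simp add: polys_mult)
qed

lemma conv_commute:
  fixes P Q :: "'i multiset \<Rightarrow> 'a"
  assumes "\<And>m. P m \<in> carrier R" "\<And>m. Q m \<in> carrier R"
  shows "P \<otimes>\<^bsub>polys I\<^esub> Q = Q \<otimes>\<^bsub>polys I\<^esub> P"
proof
  fix m :: "'i multiset"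
  have im: "{a. a \<subseteq># m} = (\<lambda>a. m - a) ` {a. a \<subseteq># m}"
  proof -
    have "a \<in> (\<lambda>a. m - a) ` {a. a \<subseteq># m}" if "a \<subseteq># m" for a
      using that by (intro image_eqI[of _ _ "m - a"]) (auto simp: subset_mset.diff_diff_right)
    then show ?thesis by auto
  qed
  have inj: "inj_on (\<lambda>a. m - a) {a. a \<subseteq># m}"
    by (rule inj_onI) (metis mem_Collect_eq subset_mset.add_diff_inverse subset_mset.diff_add add_right_cancel)
  have "(\<Oplus>a\<in>(\<lambda>a. m - a) ` {a. a \<subseteq># m}. P a \<otimes> Q (m - a))
      = (\<Oplus>a\<in>{a. a \<subseteq># m}. P (m - a) \<otimes> Q (m - (m - a)))"
    using assms inj by (intro add.finprod_reindex) auto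
  also have "\<dots> = (\<Oplus>a\<in>{a. a \<subseteq># m}. Q a \<otimes> P (m - a))"
    using assms by (intro add.finprod_cong') (auto simp: m_comm subset_mset.diff_diff_right)
  finally show "(P \<otimes>\<^bsub>polys I\<^esub> Q) m = (Q \<otimes>\<^bsub>polys I\<^esub> P) m"
    by (simp add: polys_mult flip: im)
qed

lemma conv_add_left:
  assumes "\<And>m. P m \<in> carrier R" "\<And>m. Q m \<in> carrier R" "\<And>m. T m \<in> carrier R"
  shows "(P \<oplus>\<^bsub>polys I\<^esub> Q) \<otimes>\<^bsub>polys I\<^esub> T = (P \<otimes>\<^bsub>polys I\<^esub> T) \<oplus>\<^bsub>polys I\<^esub> (Q \<otimes>\<^bsub>polys I\<^esub> T)"
proof
  fix m
  have "(\<Oplus>a\<in>{a. a \<subseteq># m}. (P a \<oplus> Q a) \<otimes> T (m - a))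
      = (\<Oplus>a\<in>{a. a \<subseteq># m}. P a \<otimes> T (m - a) \<oplus> Q a \<otimes> T (m - a))"
    using assms by (intro add.finprod_cong') (auto simp: l_distr)
  also have "\<dots> = (\<Oplus>a\<in>{a. a \<subseteq># m}. P a \<otimes> T (m - a)) \<oplus> (\<Oplus>a\<in>{a. a \<subseteq># m}. Q a \<otimes> T (m - a))"
    using assms by (intro finsum_addf) auto
  finally show "((P \<oplus>\<^bsub>polys I\<^esub> Q) \<otimes>\<^bsub>polys I\<^esub> T) m = ((P \<otimes>\<^bsub>polys I\<^esub> T) \<oplus>\<^bsub>polys I\<^esub> (Q \<otimes>\<^bsub>polys I\<^esub> T)) m"
    by (simp add: polys_mult polys_add)
qed

text \<open>A factor \<open>X i\<close> can be pulled out of a product. Together with additivity and the case of a constant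
  factor this determines all products, so associativity and closure follow by induction on the left
  factor, without sums over chains of submultisets.\<close>

lemma conv_pmult_left:
  assumes "\<And>m. P m \<in> carrier R" "\<And>m. Q m \<in> carrier R"
  shows "indexed_pmult P i \<otimes>\<^bsub>polys I\<^esub> Q = indexed_pmult (P \<otimes>\<^bsub>polys I\<^esub> Q) i"
proof
  fix m
  show "(indexed_pmult P i \<otimes>\<^bsub>polys I\<^esub> Q) m = indexed_pmult (P \<otimes>\<^bsub>polys I\<^esub> Q) i m"
  proof (cases "i \<in># m")
    case True
    let ?m = "m - {#i#}"
    have m: "m = add_mset i ?m" using True by simp
    \<comment> \<open>Only the submultisets containing \<open>i\<close> contribute, and they are those of \<open>?m\<close> with one \<open>i\<close> added.\<close>
    have sub: "add_mset i ` {a. a \<subseteq># ?m} \<subseteq> {a. a \<subseteq># m}"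
      using m by (auto simp: insert_subset_eq_iff True)
    have img: "a \<in> add_mset i ` {a. a \<subseteq># ?m}" if "a \<subseteq># m" "i \<in># a" for a
    proof -
      obtain b where "a = add_mset i b" using \<open>i \<in># a\<close> by (metis insert_DiffM)
      with that show ?thesis by (auto simp: insert_subset_eq_iff)
    qed
    have "(\<Oplus>a\<in>{a. a \<subseteq># m}. indexed_pmult P i a \<otimes> Q (m - a))
        = (\<Oplus>a\<in>add_mset i ` {a. a \<subseteq># ?m}. indexed_pmult P i a \<otimes> Q (m - a))"
      using assms sub img
      by (intro add.finprod_mono_neutral_cong_right)
        (auto simp: finite_submultisets indexed_pmult_def)
    also have "\<dots> = (\<Oplus>a\<in>{a. a \<subseteq># ?m}. indexed_pmult P i (add_mset i a) \<otimes> Q (m - add_mset i a))"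
      using assms by (intro add.finprod_reindex) (auto simp: indexed_pmult_def inj_on_def)
    also have "\<dots> = (\<Oplus>a\<in>{a. a \<subseteq># ?m}. P a \<otimes> Q (?m - a))"
      using assms by (intro add.finprod_cong') (auto simp: indexed_pmult_def)
    finally show ?thesis using True by (simp add: polys_mult indexed_pmult_def)
  next
    case False
    then have "(\<Oplus>a\<in>{a. a \<subseteq># m}. indexed_pmult P i a \<otimes> Q (m - a)) = (\<Oplus>a\<in>{a. a \<subseteq># m}. \<zero>)"
      using assms by (intro add.finprod_cong') (auto simp: indexed_pmult_def dest: mset_subset_eqD)
    with False show ?thesis by (simp add: polys_mult indexed_pmult_def)
  qed
qed

lemma pmult_eq_mult:
  assumes "P \<in> carrier (polys I)" "i \<in> I"
  shows "indexed_pmult P i = indexed_var i \<otimes>\<^bsub>polys I\<^esub> P"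
proof -
  have "indexed_var i \<otimes>\<^bsub>polys I\<^esub> P = indexed_pmult (indexed_const \<one> \<otimes>\<^bsub>polys I\<^esub> P) i"
    unfolding indexed_var_def using assms
    by (intro conv_pmult_left) (auto simp: coeff_closed indexed_const_def)
  with assms show ?thesis by (simp add: conv_const_left coeff_closed)
qed

lemma scale_in_polys:
  fixes I :: "'i set"
  assumes "P \<in> carrier (polys I)" "k \<in> carrier R"
  shows "(\<lambda>m. k \<otimes> P m) \<in> carrier (polys I)"
  using assms(1)
proof (induction P rule: polys_induct)
  case (const l)
  have "(\<lambda>m::'i multiset. k \<otimes> indexed_const l m) = indexed_const (k \<otimes> l)"
    using assms(2) by (auto simp: indexed_const_def)
  with const assms(2) show ?case by (simp only: const_in_polys m_closed)
next
  case (add P Q)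
  have "(\<lambda>m. k \<otimes> (P \<oplus>\<^bsub>polys I\<^esub> Q) m) = (\<lambda>m. k \<otimes> P m) \<oplus>\<^bsub>polys I\<^esub> (\<lambda>m. k \<otimes> Q m)"
    using add assms(2) by (auto simp: polys_add r_distr coeff_closed)
  with add show ?case by (metis add_in_polys)
next
  case (pmult P i)
  have "(\<lambda>m. k \<otimes> indexed_pmult P i m) = indexed_pmult (\<lambda>m. k \<otimes> P m) i"
    using assms(2) by (auto simp: indexed_pmult_def)
  with pmult show ?case by simp
qed

lemma mult_in_polys:
  assumes "P \<in> carrier (polys I)" "Q \<in> carrier (polys I)"
  shows "P \<otimes>\<^bsub>polys I\<^esub> Q \<in> carrier (polys I)"
  using assms(1)
proof (induction P rule: polys_induct)
  case (const k)
  then show ?case using assms(2) by (simp add: conv_const_left coeff_closed scale_in_polys)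
next
  case (add P P')
  then show ?case using assms(2) by (simp add: conv_add_left coeff_closed add_in_polys)
next
  case (pmult P i)
  then show ?case using assms(2) by (simp add: conv_pmult_left coeff_closed)
qed

lemma conv_assoc:
  assumes "P \<in> carrier (polys I)" "Q \<in> carrier (polys I)" "T \<in> carrier (polys I)"
  shows "(P \<otimes>\<^bsub>polys I\<^esub> Q) \<otimes>\<^bsub>polys I\<^esub> T = P \<otimes>\<^bsub>polys I\<^esub> (Q \<otimes>\<^bsub>polys I\<^esub> T)"
  using assms(1)
proof (induction P rule: polys_induct)
  case (const k)
  have "(\<lambda>m. k \<otimes> Q m) \<otimes>\<^bsub>polys I\<^esub> T = (\<lambda>m. k \<otimes> (Q \<otimes>\<^bsub>polys I\<^esub> T) m)"
    using const assms
    by (auto simp: polys_mult finsum_rdistr coeff_closed finite_submultisets m_assoc intro!: ext add.finprod_cong')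
  moreover have "indexed_const k \<otimes>\<^bsub>polys I\<^esub> (Q \<otimes>\<^bsub>polys I\<^esub> T) = (\<lambda>m. k \<otimes> (Q \<otimes>\<^bsub>polys I\<^esub> T) m)"
    using const assms by (intro conv_const_left) (auto intro: coeff_closed mult_in_polys)
  ultimately show ?case
    using const assms by (simp add: conv_const_left coeff_closed)
next
  case (add P P')
  then show ?case using assms(2,3)
    by (simp add: conv_add_left coeff_closed mult_in_polys conv_closed)
next
  case (pmult P i)
  then show ?case using assms(2,3)
    by (simp add: conv_pmult_left coeff_closed mult_in_polys conv_closed)
qed

theorem polys_cring: "cring (polys I)"
proof (rule cringI)
  show "abelian_group (polys I)"
  proof (rule abelian_groupI)
    fix P assume P: "P \<in> carrier (polys I)"
    show "\<exists>Q\<in>carrier (polys I). Q \<oplus>\<^bsub>polys I\<^esub> P = \<zero>\<^bsub>polys I\<^esub>"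
      using P scale_in_polys[OF P, of "\<ominus> \<one>"]
      by (intro bexI[of _ "\<lambda>m. \<ominus> \<one> \<otimes> P m"])
        (auto simp: polys_add polys_zero coeff_closed l_minus l_neg)
  next
    show "\<zero>\<^bsub>polys I\<^esub> \<in> carrier (polys I)"
      using const_in_polys[of \<zero>] by (simp add: polys_zero indexed_const_def)
  next
    fix P Q T assume "P \<in> carrier (polys I)" "Q \<in> carrier (polys I)" "T \<in> carrier (polys I)"
    then show "P \<oplus>\<^bsub>polys I\<^esub> Q \<oplus>\<^bsub>polys I\<^esub> T = P \<oplus>\<^bsub>polys I\<^esub> (Q \<oplus>\<^bsub>polys I\<^esub> T)"
      by (simp add: polys_add a_assoc coeff_closed)
  next
    fix P Q assume "P \<in> carrier (polys I)" "Q \<in> carrier (polys I)"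
    then show "P \<oplus>\<^bsub>polys I\<^esub> Q = Q \<oplus>\<^bsub>polys I\<^esub> P"
      by (simp add: polys_add a_comm coeff_closed)
  next
    fix P assume "P \<in> carrier (polys I)"
    then show "\<zero>\<^bsub>polys I\<^esub> \<oplus>\<^bsub>polys I\<^esub> P = P"
      by (simp add: polys_add polys_zero coeff_closed)
  qed (rule add_in_polys)
next
  show "comm_monoid (polys I)"
  proof (rule comm_monoidI)
    fix P Q assume "P \<in> carrier (polys I)" "Q \<in> carrier (polys I)"
    then show "P \<otimes>\<^bsub>polys I\<^esub> Q = Q \<otimes>\<^bsub>polys I\<^esub> P" by (intro conv_commute) (auto simp: coeff_closed)
  qed (auto simp: mult_in_polys conv_assoc polys_one conv_const_left coeff_closed)
qed (auto simp: conv_add_left coeff_closed)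

lemma indexed_var_eq: "indexed_var i = (\<lambda>m. if m = {#i#} then \<one> else \<zero>)"
proof
  fix m
  show "indexed_var i m = (if m = {#i#} then \<one> else \<zero>)"
  proof (cases "i \<in># m")
    case True
    then obtain n where "m = add_mset i n" by (metis insert_DiffM)
    then show ?thesis by (auto simp: indexed_var_def indexed_pmult_def indexed_const_def)
  next
    case False
    then show ?thesis by (auto simp: indexed_var_def indexed_pmult_def)
  qed
qed

lemma polys_uminus:
  assumes "P \<in> carrier (polys I)"
  shows "\<ominus>\<^bsub>polys I\<^esub> P = (\<lambda>m. \<ominus> P m)"
proof -
  interpret P: cring "polys I" by (rule polys_cring)
  have "(\<lambda>m. \<ominus> P m) = (\<lambda>m. \<ominus> \<one> \<otimes> P m)"
    using assms by (simp add: l_minus coeff_closed)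
  moreover have "\<dots> \<in> carrier (polys I)" using assms by (intro scale_in_polys) auto
  moreover have "(\<lambda>m. \<ominus> P m) \<oplus>\<^bsub>polys I\<^esub> P = \<zero>\<^bsub>polys I\<^esub>"
    using assms by (simp add: polys_add polys_zero coeff_closed l_neg)
  ultimately show ?thesis using assms by (intro P.minus_equality) auto
qed

lemma polys_minus:
  assumes "P \<in> carrier (polys I)" "Q \<in> carrier (polys I)"
  shows "P \<ominus>\<^bsub>polys I\<^esub> Q = (\<lambda>m. P m \<ominus> Q m)"
  using assms by (simp add: a_minus_def polys_uminus polys_add)

text \<open>Constants and variables generate the ring, so it is enough to test an ideal against them.\<close>

lemma ideal_polysI:
  assumes "J \<subseteq> carrier (polys I)" "\<zero>\<^bsub>polys I\<^esub> \<in> J"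
    and add: "\<And>P Q. P \<in> J \<Longrightarrow> Q \<in> J \<Longrightarrow> P \<oplus>\<^bsub>polys I\<^esub> Q \<in> J"
    and scale: "\<And>k P. k \<in> carrier R \<Longrightarrow> P \<in> J \<Longrightarrow> (\<lambda>m. k \<otimes> P m) \<in> J"
    and pmult: "\<And>i P. i \<in> I \<Longrightarrow> P \<in> J \<Longrightarrow> indexed_pmult P i \<in> J"
  shows "ideal J (polys I)"
proof -
  interpret P: cring "polys I" by (rule polys_cring)
  have J: "P \<in> carrier (polys I)" if "P \<in> J" for P using that assms(1) by auto
  have uminus: "\<ominus>\<^bsub>polys I\<^esub> P \<in> J" if "P \<in> J" for P
  proof -
    have "\<ominus>\<^bsub>polys I\<^esub> P = (\<lambda>m. \<ominus> \<one> \<otimes> P m)"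
      using J[OF that] by (simp add: polys_uminus l_minus coeff_closed)
    with that scale[of "\<ominus> \<one>" P] show ?thesis by simp
  qed
  have mult: "Q \<otimes>\<^bsub>polys I\<^esub> P \<in> J" if P: "P \<in> J" and Q: "Q \<in> carrier (polys I)" for P Q
    using Q
  proof (induction Q rule: polys_induct)
    case (const k)
    have "indexed_const k \<otimes>\<^bsub>polys I\<^esub> P = (\<lambda>m. k \<otimes> P m)"
      using const J[OF P] by (intro conv_const_left) (auto intro: coeff_closed)
    with const P show ?case by (simp add: scale)
  next
    case (add Q Q')
    then have "(Q \<oplus>\<^bsub>polys I\<^esub> Q') \<otimes>\<^bsub>polys I\<^esub> P = Q \<otimes>\<^bsub>polys I\<^esub> P \<oplus>\<^bsub>polys I\<^esub> Q' \<otimes>\<^bsub>polys I\<^esub> P"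
      using J[OF P] by (intro P.l_distr) auto
    with add assms(3) show ?case by simp
  next
    case (pmult Q i)
    then have "indexed_pmult Q i \<otimes>\<^bsub>polys I\<^esub> P = indexed_pmult (Q \<otimes>\<^bsub>polys I\<^esub> P) i"
      using J[OF P] by (intro conv_pmult_left) (auto intro: coeff_closed)
    with pmult assms(5) show ?case by simp
  qed
  show ?thesis
  proof (rule idealI)
    show "subgroup J (add_monoid (polys I))"
      using assms(1-3) uminus by (intro subgroup.intro) (auto simp: a_inv_def)
    fix a x assume "a \<in> J" "x \<in> carrier (polys I)"
    then show "x \<otimes>\<^bsub>polys I\<^esub> a \<in> J" "a \<otimes>\<^bsub>polys I\<^esub> x \<in> J"
      using mult[of a x] J[of a] P.m_comm[of a x] by auto
  qed (rule P.ring_axioms)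
qed

text \<open>A map that follows the generation of polynomials by constants, sums and multiplication by
  variables is automatically multiplicative. Evaluation and renaming of variables are both recognised
  as homomorphisms in this way.\<close>

lemma ring_hom_polysI:
  fixes I :: "'i set"
  assumes "cring A" and c: "c \<in> ring_hom R A" and x: "\<And>i. i \<in> I \<Longrightarrow> x i \<in> carrier A"
    and const: "\<And>k. k \<in> carrier R \<Longrightarrow> F (indexed_const k) = c k"
    and add: "\<And>P Q. P \<in> carrier (polys I) \<Longrightarrow> Q \<in> carrier (polys I) \<Longrightarrow>
      F (P \<oplus>\<^bsub>polys I\<^esub> Q) = F P \<oplus>\<^bsub>A\<^esub> F Q"
    and pmult: "\<And>P i. P \<in> carrier (polys I) \<Longrightarrow> i \<in> I \<Longrightarrow> F (indexed_pmult P i) = x i \<otimes>\<^bsub>A\<^esub> F P"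
  shows "F \<in> ring_hom (polys I) A"
proof -
  interpret A: cring A by fact
  interpret P: cring "polys I" by (rule polys_cring)
  have closed: "F P \<in> carrier A" if "P \<in> carrier (polys I)" for P
    using that by (induction P rule: polys_induct)
      (use c in \<open>simp_all add: const add pmult x ring_hom_closed\<close>)
  have scale: "F (\<lambda>m. k \<otimes> Q m) = c k \<otimes>\<^bsub>A\<^esub> F Q" if k: "k \<in> carrier R" and Q: "Q \<in> carrier (polys I)" for k Q
    using Q
  proof (induction Q rule: polys_induct)
    case (const l)
    have "(\<lambda>m::'i multiset. k \<otimes> indexed_const l m) = indexed_const (k \<otimes> l)"
      using k by (auto simp: indexed_const_def)
    then have "F (\<lambda>m. k \<otimes> indexed_const l m) = F (indexed_const (k \<otimes> l))" by (rule arg_cong)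
    then show ?case using k const c by (simp add: assms(4) ring_hom_mult)
  next
    case (add Q Q')
    have "(\<lambda>m. k \<otimes> (Q \<oplus>\<^bsub>polys I\<^esub> Q') m) = (\<lambda>m. k \<otimes> Q m) \<oplus>\<^bsub>polys I\<^esub> (\<lambda>m. k \<otimes> Q' m)"
      using add k by (auto simp: polys_add r_distr coeff_closed)
    then show ?case
      using add k c by (simp add: assms(5) scale_in_polys A.r_distr closed ring_hom_closed)
  next
    case (pmult Q i)
    have "(\<lambda>m. k \<otimes> indexed_pmult Q i m) = indexed_pmult (\<lambda>m. k \<otimes> Q m) i"
      using k by (auto simp: indexed_pmult_def)
    then show ?case
      using pmult k c by (simp add: assms(6) scale_in_polys A.m_lcomm closed ring_hom_closed x)
  qed
  have mult: "F (P \<otimes>\<^bsub>polys I\<^esub> Q) = F P \<otimes>\<^bsub>A\<^esub> F Q"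
    if P: "P \<in> carrier (polys I)" and Q: "Q \<in> carrier (polys I)" for P Q
    using P
  proof (induction P rule: polys_induct)
    case (const k)
    have "indexed_const k \<otimes>\<^bsub>polys I\<^esub> Q = (\<lambda>m. k \<otimes> Q m)"
      using const Q by (intro conv_const_left) (auto intro: coeff_closed)
    with const Q show ?case by (simp add: scale assms(4))
  next
    case (add P P')
    then show ?case using Q by (simp add: P.l_distr assms(5) A.l_distr closed)
  next
    case (pmult P i)
    have "indexed_pmult P i \<otimes>\<^bsub>polys I\<^esub> Q = indexed_pmult (P \<otimes>\<^bsub>polys I\<^esub> Q) i"
      using pmult Q by (intro conv_pmult_left) (auto intro: coeff_closed)
    then show ?case using pmult Q by (simp add: assms(6) A.m_assoc closed x)
  qed
  show ?thesis
  proof (rule ring_hom_memI)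
    show "F \<one>\<^bsub>polys I\<^esub> = \<one>\<^bsub>A\<^esub>" using c by (simp add: polys_one const ring_hom_one)
  qed (simp_all add: closed mult add)
qed

lemma const_add: "k \<in> carrier R \<Longrightarrow> l \<in> carrier R \<Longrightarrow>
    indexed_const (k \<oplus> l) = indexed_const k \<oplus>\<^bsub>polys I\<^esub> indexed_const l"
  by (auto simp: polys_add indexed_const_def)

lemma const_mult: "k \<in> carrier R \<Longrightarrow> l \<in> carrier R \<Longrightarrow>
    indexed_const (k \<otimes> l) = indexed_const k \<otimes>\<^bsub>polys I\<^esub> indexed_const l"
  by (subst conv_const_left) (auto simp: indexed_const_def)

definition monomial_value :: "('e, 'f) ring_scheme \<Rightarrow> ('i \<Rightarrow> 'e) \<Rightarrow> 'i multiset \<Rightarrow> 'e"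
  where "monomial_value A x m = (\<Otimes>\<^bsub>A\<^esub>i\<in>set_mset m. x i [^]\<^bsub>A\<^esub> count m i)"

text \<open>The value of a polynomial at \<open>x\<close>, with coefficients acting as scalars on \<open>A\<close>. Evaluation is defined
  for an \<open>x\<close> with values in \<open>A\<close> at every index, inside and outside \<open>I\<close>, so that every monomial has a
  value.\<close>

definition poly_eval :: "('a, 'e, 'f) module_scheme \<Rightarrow> ('i \<Rightarrow> 'e) \<Rightarrow> ('i multiset \<Rightarrow> 'a) \<Rightarrow> 'e"
  where "poly_eval A x P = (\<Oplus>\<^bsub>A\<^esub>m\<in>{m. P m \<noteq> \<zero>}. P m \<odot>\<^bsub>A\<^esub> monomial_value A x m)"

lemma monomial_value_closed:
  assumes "cring A" "\<And>i. x i \<in> carrier A"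
  shows "monomial_value A x m \<in> carrier A"
proof -
  interpret A: cring A by fact
  show ?thesis unfolding monomial_value_def using assms(2) by (intro A.finprod_closed) auto
qed

lemma monomial_value_add_mset:
  assumes "cring A" and x: "\<And>i. x i \<in> carrier A"
  shows "monomial_value A x (add_mset i m) = x i \<otimes>\<^bsub>A\<^esub> monomial_value A x m"
proof -
  interpret A: cring A by fact
  define S where "S = set_mset m - {i}"
  define y where "y = (\<Otimes>\<^bsub>A\<^esub>j\<in>S. x j [^]\<^bsub>A\<^esub> count m j)"
  have y: "y \<in> carrier A" unfolding y_def using x by (intro A.finprod_closed) auto
  have S: "finite S" "i \<notin> S" by (auto simp: S_def)
  \<comment> \<open>Listing \<open>i\<close> separately also when it does not occur in \<open>m\<close> treats both cases at once: the exponent is then 0.\<close>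
  have "monomial_value A x m = (\<Otimes>\<^bsub>A\<^esub>j\<in>insert i S. x j [^]\<^bsub>A\<^esub> count m j)"
    unfolding monomial_value_def using x
    by (intro A.finprod_mono_neutral_cong_left) (auto simp: S_def not_in_iff)
  also have "\<dots> = x i [^]\<^bsub>A\<^esub> count m i \<otimes>\<^bsub>A\<^esub> y"
    unfolding y_def using S x by (intro A.finprod_insert) auto
  finally have m: "monomial_value A x m = x i [^]\<^bsub>A\<^esub> count m i \<otimes>\<^bsub>A\<^esub> y" .
  have "monomial_value A x (add_mset i m) = (\<Otimes>\<^bsub>A\<^esub>j\<in>insert i S. x j [^]\<^bsub>A\<^esub> count (add_mset i m) j)"
    unfolding monomial_value_def S_def by (simp add: insert_Diff_if)
  also have "\<dots> = x i [^]\<^bsub>A\<^esub> Suc (count m i) \<otimes>\<^bsub>A\<^esub> (\<Otimes>\<^bsub>A\<^esub>j\<in>S. x j [^]\<^bsub>A\<^esub> count (add_mset i m) j)"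
    using S x by (subst A.finprod_insert) auto
  also have "(\<Otimes>\<^bsub>A\<^esub>j\<in>S. x j [^]\<^bsub>A\<^esub> count (add_mset i m) j) = y"
    unfolding y_def using S x by (intro A.finprod_cong') auto
  finally show ?thesis using m x y by (simp add: A.m_ac)
qed

context
  fixes A :: "('a, 'e, 'f) module_scheme" and x :: "'i \<Rightarrow> 'e" and I :: "'i set"
  assumes A: "algebra R A" and x: "\<And>i. x i \<in> carrier A"
begin

interpretation A: algebra R A by (rule A)

private lemma mv [simp]: "monomial_value A x m \<in> carrier A"
  by (rule monomial_value_closed[OF A.M_cring x])

lemma poly_eval_superset:
  assumes "P \<in> carrier (polys I)" "finite Z" "{m. P m \<noteq> \<zero>} \<subseteq> Z"
  shows "poly_eval A x P = (\<Oplus>\<^bsub>A\<^esub>m\<in>Z. P m \<odot>\<^bsub>A\<^esub> monomial_value A x m)"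
  unfolding poly_eval_def using assms
  by (intro A.add.finprod_mono_neutral_cong_left) (auto simp: coeff_closed)

lemma poly_eval_const:
  assumes "k \<in> carrier R"
  shows "poly_eval A x (indexed_const k) = k \<odot>\<^bsub>A\<^esub> \<one>\<^bsub>A\<^esub>"
proof -
  have "poly_eval A x (indexed_const k) = (\<Oplus>\<^bsub>A\<^esub>m\<in>{{#}}. indexed_const k m \<odot>\<^bsub>A\<^esub> monomial_value A x m)"
    by (rule poly_eval_superset[OF const_in_polys[OF assms]]) (auto simp: indexed_const_def)
  with assms show ?thesis by (simp add: indexed_const_def monomial_value_def)
qed

lemma poly_eval_add:
  assumes P: "P \<in> carrier (polys I)" "Q \<in> carrier (polys I)"
  shows "poly_eval A x (P \<oplus>\<^bsub>polys I\<^esub> Q) = poly_eval A x P \<oplus>\<^bsub>A\<^esub> poly_eval A x Q"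
proof -
  let ?X = "{m. P m \<noteq> \<zero>} \<union> {m. Q m \<noteq> \<zero>}"
  have X: "finite ?X" using assms by (simp add: finite_support)
  have "poly_eval A x (P \<oplus>\<^bsub>polys I\<^esub> Q)
      = (\<Oplus>\<^bsub>A\<^esub>m\<in>?X. (P \<oplus>\<^bsub>polys I\<^esub> Q) m \<odot>\<^bsub>A\<^esub> monomial_value A x m)"
    by (rule poly_eval_superset[OF add_in_polys[OF P] X]) (auto simp: polys_add)
  also have "\<dots> = (\<Oplus>\<^bsub>A\<^esub>m\<in>?X. P m \<odot>\<^bsub>A\<^esub> monomial_value A x m \<oplus>\<^bsub>A\<^esub> Q m \<odot>\<^bsub>A\<^esub> monomial_value A x m)"
    using P by (intro A.add.finprod_cong') (auto simp: polys_add coeff_closed A.smult_l_distr)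
  also have "\<dots> = (\<Oplus>\<^bsub>A\<^esub>m\<in>?X. P m \<odot>\<^bsub>A\<^esub> monomial_value A x m) \<oplus>\<^bsub>A\<^esub> (\<Oplus>\<^bsub>A\<^esub>m\<in>?X. Q m \<odot>\<^bsub>A\<^esub> monomial_value A x m)"
    using P by (intro A.finsum_addf) (auto simp: coeff_closed)
  finally show ?thesis
    using poly_eval_superset[OF P(1) X] poly_eval_superset[OF P(2) X] by simp
qed

lemma poly_eval_pmult:
  assumes P: "P \<in> carrier (polys I)"
  shows "poly_eval A x (indexed_pmult P i) = x i \<otimes>\<^bsub>A\<^esub> poly_eval A x P"
proof -
  have supp: "{m. indexed_pmult P i m \<noteq> \<zero>} = add_mset i ` {m. P m \<noteq> \<zero>}"
    by (force simp: indexed_pmult_def image_iff split: if_split_asm)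
  have "poly_eval A x (indexed_pmult P i)
      = (\<Oplus>\<^bsub>A\<^esub>m\<in>{m. P m \<noteq> \<zero>}. indexed_pmult P i (add_mset i m) \<odot>\<^bsub>A\<^esub> monomial_value A x (add_mset i m))"
    unfolding poly_eval_def supp using P
    by (intro A.add.finprod_reindex) (auto simp: indexed_pmult_def coeff_closed inj_on_def)
  also have "\<dots> = (\<Oplus>\<^bsub>A\<^esub>m\<in>{m. P m \<noteq> \<zero>}. x i \<otimes>\<^bsub>A\<^esub> (P m \<odot>\<^bsub>A\<^esub> monomial_value A x m))"
  proof (intro A.add.finprod_cong' refl)
    fix m
    have "P m \<odot>\<^bsub>A\<^esub> (x i \<otimes>\<^bsub>A\<^esub> monomial_value A x m) = x i \<otimes>\<^bsub>A\<^esub> (P m \<odot>\<^bsub>A\<^esub> monomial_value A x m)"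
      using P x by (metis A.m_comm A.smult_assoc2 A.smult_closed coeff_closed mv)
    then show "indexed_pmult P i (add_mset i m) \<odot>\<^bsub>A\<^esub> monomial_value A x (add_mset i m)
        = x i \<otimes>\<^bsub>A\<^esub> (P m \<odot>\<^bsub>A\<^esub> monomial_value A x m)"
      by (simp add: indexed_pmult_def monomial_value_add_mset[OF A.M_cring x])
  qed (use P x in \<open>auto simp: coeff_closed\<close>)
  also have "\<dots> = x i \<otimes>\<^bsub>A\<^esub> (\<Oplus>\<^bsub>A\<^esub>m\<in>{m. P m \<noteq> \<zero>}. P m \<odot>\<^bsub>A\<^esub> monomial_value A x m)"
    using P x by (intro A.finsum_rdistr[symmetric]) (auto simp: coeff_closed finite_support)
  finally show ?thesis by (simp add: poly_eval_def)
qed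

lemma scalar_ring_hom: "(\<lambda>k. k \<odot>\<^bsub>A\<^esub> \<one>\<^bsub>A\<^esub>) \<in> ring_hom R A"
proof (rule ring_hom_memI)
  fix k l assume kl: "k \<in> carrier R" "l \<in> carrier R"
  show "(k \<oplus> l) \<odot>\<^bsub>A\<^esub> \<one>\<^bsub>A\<^esub> = k \<odot>\<^bsub>A\<^esub> \<one>\<^bsub>A\<^esub> \<oplus>\<^bsub>A\<^esub> l \<odot>\<^bsub>A\<^esub> \<one>\<^bsub>A\<^esub>"
    using kl by (simp add: A.smult_l_distr)
  show "(k \<otimes> l) \<odot>\<^bsub>A\<^esub> \<one>\<^bsub>A\<^esub> = k \<odot>\<^bsub>A\<^esub> \<one>\<^bsub>A\<^esub> \<otimes>\<^bsub>A\<^esub> (l \<odot>\<^bsub>A\<^esub> \<one>\<^bsub>A\<^esub>)"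
    using kl by (simp add: A.smult_assoc1 A.smult_assoc2)
qed auto

lemma poly_eval_ring_hom: "poly_eval A x \<in> ring_hom (polys I) A"
  by (rule ring_hom_polysI[OF A.M_cring scalar_ring_hom, where x = x])
    (simp_all add: poly_eval_const poly_eval_add poly_eval_pmult x)

end

lemma rename_superset:
  assumes "P \<in> carrier (polys I)" "finite Z" "{n. P n \<noteq> \<zero>} \<subseteq> Z"
  shows "indexed_poly_rename R h P m = (\<Oplus>n\<in>{n \<in> Z. image_mset h n = m}. P n)"
  unfolding indexed_poly_rename_def using assms
  by (intro add.finprod_mono_neutral_cong_left) (auto simp: coeff_closed)

lemma rename_const:
  assumes "k \<in> carrier R"
  shows "indexed_poly_rename R h (indexed_const k) = indexed_const k"
proof
  fix m
  have "indexed_poly_rename R h (indexed_const k) m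
      = (\<Oplus>n\<in>{n \<in> {{#}}. image_mset h n = m}. indexed_const k n)"
    by (rule rename_superset[OF const_in_polys[OF assms, of UNIV]]) (auto simp: indexed_const_def)
  also have "\<dots> = indexed_const k m"
  proof (cases "m = {#}")
    case True
    then have "{n \<in> {{#}}. image_mset h n = m} = {{#}}" by auto
    with True assms show ?thesis by (simp add: indexed_const_def)
  next
    case False
    then have "{n \<in> {{#}}. image_mset h n = m} = {}" by auto
    with False show ?thesis by (simp only: finsum_empty) (simp add: indexed_const_def)
  qed
  finally show "indexed_poly_rename R h (indexed_const k) m = indexed_const k m" .
qed

lemma rename_add:
  assumes P: "P \<in> carrier (polys I)" "Q \<in> carrier (polys I)"
  shows "indexed_poly_rename R h (P \<oplus>\<^bsub>polys I\<^esub> Q)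
    = indexed_poly_rename R h P \<oplus>\<^bsub>polys J\<^esub> indexed_poly_rename R h Q"
proof
  fix m
  let ?X = "{m. P m \<noteq> \<zero>} \<union> {m. Q m \<noteq> \<zero>}"
  have X: "finite ?X" using assms by (simp add: finite_support)
  have "indexed_poly_rename R h (P \<oplus>\<^bsub>polys I\<^esub> Q) m
      = (\<Oplus>n\<in>{n \<in> ?X. image_mset h n = m}. (P \<oplus>\<^bsub>polys I\<^esub> Q) n)"
    by (rule rename_superset[OF add_in_polys[OF P] X]) (auto simp: polys_add)
  also have "\<dots> = (\<Oplus>n\<in>{n \<in> ?X. image_mset h n = m}. P n) \<oplus> (\<Oplus>n\<in>{n \<in> ?X. image_mset h n = m}. Q n)"
    unfolding polys_add using P by (intro finsum_addf) (auto simp: coeff_closed)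
  also have "\<dots> = indexed_poly_rename R h P m \<oplus> indexed_poly_rename R h Q m"
    by (simp only: rename_superset[OF P(1) X Un_upper1] rename_superset[OF P(2) X Un_upper2])
  finally show "indexed_poly_rename R h (P \<oplus>\<^bsub>polys I\<^esub> Q) m
      = (indexed_poly_rename R h P \<oplus>\<^bsub>polys J\<^esub> indexed_poly_rename R h Q) m"
    by (simp only: polys_add)
qed

lemma rename_pmult:
  assumes P: "P \<in> carrier (polys I)"
  shows "indexed_poly_rename R h (indexed_pmult P i) = indexed_pmult (indexed_poly_rename R h P) (h i)"
proof
  fix m
  let ?X = "{n. indexed_pmult P i n \<noteq> \<zero> \<and> image_mset h n = m}"
  show "indexed_poly_rename R h (indexed_pmult P i) m = indexed_pmult (indexed_poly_rename R h P) (h i) m"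
  proof (cases "h i \<in># m")
    case True
    have X: "?X = add_mset i ` {n. P n \<noteq> \<zero> \<and> image_mset h n = m - {#h i#}}"
    proof (intro equalityI subsetI)
      fix n assume "n \<in> ?X"
      then have n: "i \<in># n" "P (n - {#i#}) \<noteq> \<zero>" "image_mset h n = m"
        by (auto simp: indexed_pmult_def split: if_split_asm)
      then have "n = add_mset i (n - {#i#})" "image_mset h (n - {#i#}) = m - {#h i#}"
        by (auto simp: image_mset_Diff)
      with n show "n \<in> add_mset i ` {n. P n \<noteq> \<zero> \<and> image_mset h n = m - {#h i#}}" by blast
    qed (use True in \<open>auto simp: indexed_pmult_def\<close>)
    have "(\<Oplus>n\<in>?X. indexed_pmult P i n)
        = (\<Oplus>n\<in>{n. P n \<noteq> \<zero> \<and> image_mset h n = m - {#h i#}}. indexed_pmult P i (add_mset i n))"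
      unfolding X using P
      by (intro add.finprod_reindex) (auto simp: indexed_pmult_def coeff_closed inj_on_def)
    with True show ?thesis by (simp add: indexed_poly_rename_def indexed_pmult_def)
  next
    case False
    then have X: "?X = {}" by (auto simp: indexed_pmult_def)
    show ?thesis using False unfolding indexed_poly_rename_def X by (simp add: indexed_pmult_def)
  qed
qed

lemma rename_in_polys:
  assumes "P \<in> carrier (polys I)" "\<And>i. i \<in> I \<Longrightarrow> h i \<in> J"
  shows "indexed_poly_rename R h P \<in> carrier (polys J)"
  using assms(1)
  by (induction P rule: polys_induct)
    (simp_all add: rename_const rename_add[where J = J] add_in_polys rename_pmult assms(2))

end

section \<open>The symmetric algebra and its universal property\<close>

text \<open>Used to carry the ring structure of a quotient over to the record \<open>Sym\<close>, which adds scalars to it.\<close>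

lemma cring_cong:
  assumes "cring A" "carrier B = carrier A" "\<one>\<^bsub>B\<^esub> = \<one>\<^bsub>A\<^esub>" "\<zero>\<^bsub>B\<^esub> = \<zero>\<^bsub>A\<^esub>"
    "\<And>x y. x \<otimes>\<^bsub>B\<^esub> y = x \<otimes>\<^bsub>A\<^esub> y" "\<And>x y. x \<oplus>\<^bsub>B\<^esub> y = x \<oplus>\<^bsub>A\<^esub> y"
  shows "cring B"
proof -
  interpret A: cring A by fact
  show ?thesis
  proof (intro cringI abelian_groupI comm_monoidI)
    fix x assume "x \<in> carrier B"
    then show "\<exists>y\<in>carrier B. y \<oplus>\<^bsub>B\<^esub> x = \<zero>\<^bsub>B\<^esub>"
      using assms A.l_neg by (intro bexI[of _ "\<ominus>\<^bsub>A\<^esub> x"]) auto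
  qed (simp_all add: assms A.a_assoc A.m_assoc A.l_distr, simp_all add: A.a_comm A.m_comm)
qed

context module
begin

abbreviation "PM \<equiv> indexed_poly_ring R (carrier M)"
abbreviation "cls \<equiv> sym_class R M"
abbreviation "SymM \<equiv> Sym R M"

lemma sym_relations_carrier: "sym_relations R M \<subseteq> carrier PM"
proof -
  interpret P: cring PM by (rule polys_cring)
  show ?thesis unfolding sym_relations_def Let_def by auto
qed

lemma sym_ideal_ideal: "ideal (sym_ideal R M) PM"
proof -
  interpret P: cring PM by (rule polys_cring)
  show ?thesis unfolding sym_ideal_def by (intro P.genideal_ideal sym_relations_carrier)
qed

lemma sym_relation_add:
  "m \<in> carrier M \<Longrightarrow> n \<in> carrier M \<Longrightarrow>
   indexed_var (m \<oplus>\<^bsub>M\<^esub> n) \<ominus>\<^bsub>PM\<^esub> (indexed_var m \<oplus>\<^bsub>PM\<^esub> indexed_var n) \<in> sym_relations R M"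
  unfolding sym_relations_def Let_def by blast

lemma sym_relation_smult:
  "r \<in> carrier R \<Longrightarrow> m \<in> carrier M \<Longrightarrow>
   indexed_var (r \<odot>\<^bsub>M\<^esub> m) \<ominus>\<^bsub>PM\<^esub> (indexed_const r \<otimes>\<^bsub>PM\<^esub> indexed_var m) \<in> sym_relations R M"
  unfolding sym_relations_def Let_def by blast

lemma sym_relations_cases:
  assumes "p \<in> sym_relations R M"
  obtains (add) m n where "m \<in> carrier M" "n \<in> carrier M"
      "p = indexed_var (m \<oplus>\<^bsub>M\<^esub> n) \<ominus>\<^bsub>PM\<^esub> (indexed_var m \<oplus>\<^bsub>PM\<^esub> indexed_var n)"
    | (smult) r m where "r \<in> carrier R" "m \<in> carrier M"
      "p = indexed_var (r \<odot>\<^bsub>M\<^esub> m) \<ominus>\<^bsub>PM\<^esub> (indexed_const r \<otimes>\<^bsub>PM\<^esub> indexed_var m)"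
  using assms unfolding sym_relations_def Let_def by blast

lemma sym_relations_subset: "sym_relations R M \<subseteq> sym_ideal R M"
proof -
  interpret P: cring PM by (rule polys_cring)
  show ?thesis unfolding sym_ideal_def by (intro P.genideal_self sym_relations_carrier)
qed

lemma sym_ideal_minimal:
  assumes "ideal J PM" "sym_relations R M \<subseteq> J"
  shows "sym_ideal R M \<subseteq> J"
proof -
  interpret P: cring PM by (rule polys_cring)
  show ?thesis unfolding sym_ideal_def using assms by (rule P.genideal_minimal)
qed

lemma Sym_cring: "cring SymM"
  using ideal.quotient_is_cring[OF sym_ideal_ideal polys_cring]
  by (rule cring_cong) (simp_all add: Sym_def Let_def)

lemma cls_ring_hom: "cls \<in> ring_hom PM SymM"
proof -
  have "cls = (\<lambda>p. sym_ideal R M +>\<^bsub>PM\<^esub> p)" by (rule ext) (simp add: sym_class_def)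
  with ideal.rcos_ring_hom[OF sym_ideal_ideal]
  show ?thesis by (simp add: ring_hom_def Sym_def Let_def)
qed

lemma
  shows cls_closed [intro, simp]: "p \<in> carrier PM \<Longrightarrow> cls p \<in> carrier SymM"
    and cls_add: "p \<in> carrier PM \<Longrightarrow> q \<in> carrier PM \<Longrightarrow> cls (p \<oplus>\<^bsub>PM\<^esub> q) = cls p \<oplus>\<^bsub>SymM\<^esub> cls q"
    and cls_mult: "p \<in> carrier PM \<Longrightarrow> q \<in> carrier PM \<Longrightarrow> cls (p \<otimes>\<^bsub>PM\<^esub> q) = cls p \<otimes>\<^bsub>SymM\<^esub> cls q"
    and cls_one: "cls (indexed_const \<one>) = \<one>\<^bsub>SymM\<^esub>"
  using cls_ring_hom by (auto simp: ring_hom_def polys_one)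

lemma Sym_cases:
  assumes "w \<in> carrier SymM"
  obtains p where "p \<in> carrier PM" "w = cls p"
  using assms unfolding Sym_def Let_def FactRing_def sym_class_def
  by (auto simp: A_RCOSETS_def RCOSETS_def a_r_coset_def)

lemma cls_eq_iff:
  assumes "p \<in> carrier PM" "q \<in> carrier PM"
  shows "cls p = cls q \<longleftrightarrow> p \<ominus>\<^bsub>PM\<^esub> q \<in> sym_ideal R M"
proof -
  interpret P: cring PM by (rule polys_cring)
  show ?thesis unfolding sym_class_def
    using P.quotient_eq_iff_same_a_r_cos[OF sym_ideal_ideal assms] by simp
qed

lemma cls_mem_iff:
  assumes p: "p \<in> carrier PM"
  shows "q \<in> cls p \<longleftrightarrow> q \<in> carrier PM \<and> cls q = cls p"
proof -
  interpret P: cring PM by (rule polys_cring)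
  interpret I: ideal "sym_ideal R M" PM by (rule sym_ideal_ideal)
  have self: "x \<in> cls x" if "x \<in> carrier PM" for x
    unfolding sym_class_def using that by (rule I.a_rcos_self)
  have "q \<in> carrier PM" if "q \<in> cls p"
    using that p P.a_r_coset_subset_G[OF I.a_subset] unfolding sym_class_def by auto
  moreover have "cls q = cls p" if "q \<in> cls p"
    using that p P.a_repr_independence[OF _ _ I.a_subgroup, of q p] unfolding sym_class_def by simp
  ultimately show ?thesis using self by auto
qed

lemma cls_zero: "cls (\<lambda>m. \<zero>) = \<zero>\<^bsub>SymM\<^esub>"
  using ring_hom_zero[OF cls_ring_hom cring.axioms(1)[OF polys_cring] cring.axioms(1)[OF Sym_cring]]
  by (simp add: polys_zero)

lemma Sym_smult: "r \<odot>\<^bsub>SymM\<^esub> w = cls (indexed_const r) \<otimes>\<^bsub>SymM\<^esub> w"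
  by (simp add: Sym_def Let_def)

lemma const_ring_hom: "(\<lambda>k. cls (indexed_const k)) \<in> ring_hom R SymM"
  by (rule ring_hom_memI)
    (simp_all add: cls_one const_add[where I = "carrier M"] const_mult[where I = "carrier M"] cls_add cls_mult)

lemma Sym_algebra: "algebra R SymM"
proof -
  interpret A: cring SymM by (rule Sym_cring)
  note c = ring_hom_closed[OF const_ring_hom]
  show ?thesis
    by (rule algebraI)
      (simp_all add: Sym_smult c A.l_distr A.r_distr A.m_assoc cls_one is_cring Sym_cring
        ring_hom_add[OF const_ring_hom] ring_hom_mult[OF const_ring_hom])
qed

lemma sym_incl_closed [intro, simp]: "m \<in> carrier M \<Longrightarrow> sym_incl R M m \<in> carrier SymM"
  by (simp add: sym_incl_def)

lemma sym_incl_hom: "sym_incl R M \<in> LinearCombinations.module_hom R M SymM"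
proof -
  interpret P: cring PM by (rule polys_cring)
  have "cls (indexed_var (m \<oplus>\<^bsub>M\<^esub> n)) = cls (indexed_var m) \<oplus>\<^bsub>SymM\<^esub> cls (indexed_var n)"
    if "m \<in> carrier M" "n \<in> carrier M" for m n
  proof -
    have "cls (indexed_var (m \<oplus>\<^bsub>M\<^esub> n)) = cls (indexed_var m \<oplus>\<^bsub>PM\<^esub> indexed_var n)"
      using that sym_relation_add[OF that] sym_relations_subset
      by (intro cls_eq_iff[THEN iffD2]) auto
    with that show ?thesis by (simp add: cls_add)
  qed
  moreover have "cls (indexed_var (r \<odot>\<^bsub>M\<^esub> m)) = r \<odot>\<^bsub>SymM\<^esub> cls (indexed_var m)"
    if "r \<in> carrier R" "m \<in> carrier M" for r m
  proof -
    have "cls (indexed_var (r \<odot>\<^bsub>M\<^esub> m)) = cls (indexed_const r \<otimes>\<^bsub>PM\<^esub> indexed_var m)"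
      using that sym_relation_smult[OF that] sym_relations_subset
      by (intro cls_eq_iff[THEN iffD2]) auto
    with that show ?thesis by (simp add: cls_mult Sym_smult)
  qed
  ultimately show ?thesis unfolding LinearCombinations.module_hom_def sym_incl_def by simp
qed

lemma cls_pmult:
  "p \<in> carrier PM \<Longrightarrow> m \<in> carrier M \<Longrightarrow> cls (indexed_pmult p m) = sym_incl R M m \<otimes>\<^bsub>SymM\<^esub> cls p"
  using pmult_eq_mult[of p "carrier M" m] cls_mult[of "indexed_var m" p]
  by (simp only: sym_incl_def var_in_polys)

text \<open>The two conditions on variables say that \<open>F\<close> vanishes on the relations. The kernel of \<open>F\<close> is an
  ideal, hence it contains the ideal that they generate.\<close>

lemma hom_kills_sym_ideal:
  assumes "cring A" and F: "F \<in> ring_hom PM A"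
    and add: "\<And>m n. m \<in> carrier M \<Longrightarrow> n \<in> carrier M \<Longrightarrow>
      F (indexed_var (m \<oplus>\<^bsub>M\<^esub> n)) = F (indexed_var m) \<oplus>\<^bsub>A\<^esub> F (indexed_var n)"
    and smult: "\<And>r m. r \<in> carrier R \<Longrightarrow> m \<in> carrier M \<Longrightarrow>
      F (indexed_var (r \<odot>\<^bsub>M\<^esub> m)) = F (indexed_const r) \<otimes>\<^bsub>A\<^esub> F (indexed_var m)"
    and p: "p \<in> carrier PM" and q: "q \<in> carrier PM" and eq: "cls p = cls q"
  shows "F p = F q"
proof -
  interpret A: cring A by fact
  interpret P: cring PM by (rule polys_cring)
  interpret F: ring_hom_ring PM A F
    using F by (intro ring_hom_ringI2 P.ring_axioms A.ring_axioms)
  have "sym_relations R M \<subseteq> a_kernel PM A F"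
  proof
    fix p assume "p \<in> sym_relations R M"
    then show "p \<in> a_kernel PM A F"
    proof (cases rule: sym_relations_cases)
      case (add m n)
      then show ?thesis
        using assms(3)[of m n] unfolding a_kernel_def' by (simp add: a_minus_def A.r_neg)
    next
      case (smult r m)
      then show ?thesis
        using assms(4)[of r m] unfolding a_kernel_def' by (simp add: a_minus_def A.r_neg)
    qed
  qed
  then have "sym_ideal R M \<subseteq> a_kernel PM A F"
    by (intro sym_ideal_minimal F.kernel_is_ideal)
  then have "p \<ominus>\<^bsub>PM\<^esub> q \<in> a_kernel PM A F"
    using cls_eq_iff[OF p q] eq by blast
  then have "F (p \<ominus>\<^bsub>PM\<^esub> q) = \<zero>\<^bsub>A\<^esub>" unfolding a_kernel_def' by blast
  moreover have "F (p \<ominus>\<^bsub>PM\<^esub> q) = F p \<ominus>\<^bsub>A\<^esub> F q"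
    using p q unfolding a_minus_def by (simp only: F.hom_add F.hom_a_inv P.a_inv_closed)
  ultimately show ?thesis using F.hom_closed[OF p] F.hom_closed[OF q] A.r_right_minus_eq by metis
qed

text \<open>A map on classes, given on representatives. The choice of a representative is harmless for the
  maps to which the next lemma applies.\<close>

definition on_classes :: "(('c multiset \<Rightarrow> 'a) \<Rightarrow> 'res) \<Rightarrow> ('c multiset \<Rightarrow> 'a) set \<Rightarrow> 'res"
  where "on_classes F w = F (SOME p. p \<in> carrier PM \<and> cls p = w)"

lemma on_classes:
  assumes "\<And>p q. p \<in> carrier PM \<Longrightarrow> q \<in> carrier PM \<Longrightarrow> cls p = cls q \<Longrightarrow> F p = F q"
    and "p \<in> carrier PM"
  shows "on_classes F (cls p) = F p"
proof -
  have "(SOME q. q \<in> carrier PM \<and> cls q = cls p) \<in> carrier PM \<and>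
      cls (SOME q. q \<in> carrier PM \<and> cls q = cls p) = cls p"
    by (rule someI[of _ p]) (simp add: assms(2))
  then show ?thesis unfolding on_classes_def using assms(2) by (intro assms(1)) simp_all
qed

lemma algebra_hom_SymI:
  assumes "algebra R A" and \<phi>: "\<phi> \<in> ring_hom SymM A"
    and const: "\<And>k. k \<in> carrier R \<Longrightarrow> \<phi> (cls (indexed_const k)) = k \<odot>\<^bsub>A\<^esub> \<one>\<^bsub>A\<^esub>"
  shows "\<phi> \<in> algebra_hom R SymM A"
proof -
  interpret A: algebra R A by fact
  interpret S: algebra R SymM by (rule Sym_algebra)
  have "\<phi> (r \<odot>\<^bsub>SymM\<^esub> w) = r \<odot>\<^bsub>A\<^esub> \<phi> w" if "r \<in> carrier R" "w \<in> carrier SymM" for r w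
    using that \<phi> const[OF that(1)] A.smult_assoc2[OF that(1) A.one_closed, of "\<phi> w"]
    by (simp add: Sym_smult ring_hom_mult[OF \<phi>] ring_hom_closed[OF \<phi>])
  then show ?thesis
    using \<phi> ring_hom_closed[OF \<phi>] ring_hom_add[OF \<phi>]
    unfolding algebra_hom_def LinearCombinations.module_hom_def by auto
qed

lemma algebra_hom_const:
  assumes "algebra R A" "\<phi> \<in> algebra_hom R SymM A" "k \<in> carrier R"
  shows "\<phi> (cls (indexed_const k)) = k \<odot>\<^bsub>A\<^esub> \<one>\<^bsub>A\<^esub>"
proof -
  interpret S: algebra R SymM by (rule Sym_algebra)
  have "cls (indexed_const k) = k \<odot>\<^bsub>SymM\<^esub> \<one>\<^bsub>SymM\<^esub>"
    using assms(3) by (simp add: Sym_smult)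
  moreover have "\<phi> (k \<odot>\<^bsub>SymM\<^esub> \<one>\<^bsub>SymM\<^esub>) = k \<odot>\<^bsub>A\<^esub> \<phi> \<one>\<^bsub>SymM\<^esub>" "\<phi> \<one>\<^bsub>SymM\<^esub> = \<one>\<^bsub>A\<^esub>"
    using assms S.one_closed
    unfolding algebra_hom_def LinearCombinations.module_hom_def ring_hom_def by auto
  ultimately show ?thesis by simp
qed

text \<open>The scalars and the image of \<open>M\<close> generate the symmetric algebra.\<close>

lemma Sym_hom_eqI:
  assumes A: "algebra R A" and \<phi>: "\<phi> \<in> algebra_hom R SymM A" and \<psi>: "\<psi> \<in> algebra_hom R SymM A"
    and eq: "\<And>m. m \<in> carrier M \<Longrightarrow> \<psi> (sym_incl R M m) = \<phi> (sym_incl R M m)"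
    and w: "w \<in> carrier SymM"
  shows "\<psi> w = \<phi> w"
proof -
  have hom: "\<phi> \<in> ring_hom SymM A" "\<psi> \<in> ring_hom SymM A" using \<phi> \<psi> by (auto simp: algebra_hom_def)
  obtain p where p: "p \<in> carrier PM" "w = cls p" using w by (rule Sym_cases)
  have "\<psi> (cls p) = \<phi> (cls p)"
    using p(1)
  proof (induction p rule: polys_induct)
    case (const k)
    then show ?case by (simp add: algebra_hom_const[OF A \<phi>] algebra_hom_const[OF A \<psi>])
  next
    case (add p q)
    then show ?case by (simp add: cls_add ring_hom_add[OF hom(1)] ring_hom_add[OF hom(2)])
  next
    case (pmult p m)
    then show ?case
      by (simp add: cls_pmult ring_hom_mult[OF hom(1)] ring_hom_mult[OF hom(2)] eq)
  qed
  with p show ?thesis by simp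
qed

text \<open>The homomorphism is evaluation at \<open>X m = f m\<close>; it respects the relations because \<open>f\<close> is linear.\<close>

theorem Sym_universal:
  assumes "algebra R A" and f: "f \<in> LinearCombinations.module_hom R M A"
  obtains \<phi> where "\<phi> \<in> algebra_hom R SymM A" "\<And>m. m \<in> carrier M \<Longrightarrow> \<phi> (sym_incl R M m) = f m"
proof
  interpret A: algebra R A by fact
  \<comment> \<open>Outside \<open>M\<close> any value in \<open>A\<close> would do.\<close>
  define x where "x m = (if m \<in> carrier M then f m else \<zero>\<^bsub>A\<^esub>)" for m
  have xA: "x m \<in> carrier A" for m
    using f by (auto simp: x_def LinearCombinations.module_hom_def)
  let ?ev = "poly_eval A x"
  note ev_hom = poly_eval_ring_hom[OF assms(1) xA, where I = "carrier M"]
  have var: "?ev (indexed_var m) = f m" if "m \<in> carrier M" for m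
    using that xA[of m]
    by (simp add: indexed_var_def poly_eval_pmult[OF assms(1) xA, where I = "carrier M"]
      poly_eval_const[OF assms(1) xA]) (simp add: x_def)
  have const: "?ev (indexed_const k) = k \<odot>\<^bsub>A\<^esub> \<one>\<^bsub>A\<^esub>" if "k \<in> carrier R" for k
    using that by (rule poly_eval_const[OF assms(1) xA])
  have f_add: "f (m \<oplus>\<^bsub>M\<^esub> n) = f m \<oplus>\<^bsub>A\<^esub> f n" if "m \<in> carrier M" "n \<in> carrier M" for m n
    using f that by (rule module_hom_add)
  have f_smult: "f (r \<odot>\<^bsub>M\<^esub> m) = r \<odot>\<^bsub>A\<^esub> \<one>\<^bsub>A\<^esub> \<otimes>\<^bsub>A\<^esub> f m" if "r \<in> carrier R" "m \<in> carrier M" for r m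
    using module_hom_smult[OF f that] that xA[of m] A.smult_assoc2[OF that(1) A.one_closed, of "f m"]
    by (simp add: x_def)
  have desc: "on_classes ?ev (cls p) = ?ev p" if p: "p \<in> carrier PM" for p
  proof (rule on_classes[OF _ p])
    fix p q assume "p \<in> carrier PM" "q \<in> carrier PM" "cls p = cls q"
    then show "?ev p = ?ev q"
      by (rule hom_kills_sym_ideal[OF A.M_cring ev_hom, rotated 2])
        (simp_all add: var f_add const f_smult)
  qed
  show "on_classes ?ev \<in> algebra_hom R SymM A"
  proof (rule algebra_hom_SymI[OF assms(1)])
    show "on_classes ?ev \<in> ring_hom SymM A"
    proof (rule ring_hom_memI)
      fix v assume "v \<in> carrier SymM"
      then obtain p where p: "p \<in> carrier PM" "v = cls p" by (rule Sym_cases)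
      then show "on_classes ?ev v \<in> carrier A" by (simp add: desc ring_hom_closed[OF ev_hom])
      fix w assume "w \<in> carrier SymM"
      then obtain q where q: "q \<in> carrier PM" "w = cls q" by (rule Sym_cases)
      interpret P: cring PM by (rule polys_cring)
      show "on_classes ?ev (v \<otimes>\<^bsub>SymM\<^esub> w) = on_classes ?ev v \<otimes>\<^bsub>A\<^esub> on_classes ?ev w"
        using p q desc[OF P.m_closed[OF p(1) q(1)]]
        by (simp add: desc cls_mult ring_hom_mult[OF ev_hom])
      show "on_classes ?ev (v \<oplus>\<^bsub>SymM\<^esub> w) = on_classes ?ev v \<oplus>\<^bsub>A\<^esub> on_classes ?ev w"
        using p q desc[OF P.a_closed[OF p(1) q(1)]]
        by (simp add: desc cls_add ring_hom_add[OF ev_hom])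
    next
      show "on_classes ?ev \<one>\<^bsub>SymM\<^esub> = \<one>\<^bsub>A\<^esub>"
        using desc[of "indexed_const \<one>"] by (simp add: cls_one const)
    qed
  qed (simp add: desc const)
  show "on_classes ?ev (sym_incl R M m) = f m" if "m \<in> carrier M" for m
    using that by (simp add: sym_incl_def desc var)
qed

text \<open>Renaming variables and then passing to classes is a ring homomorphism that respects the relations,
  so it is constant on each class of polynomials, and the union defining \<open>sym_map\<close> is taken over equal sets.\<close>

lemma
  assumes M': "module R M'" and h: "h \<in> LinearCombinations.module_hom R M M'"
  shows sym_map_cls: "p \<in> carrier PM \<Longrightarrow> sym_map R M M' h (cls p) = sym_class R M' (indexed_poly_rename R h p)"
    and sym_map_ring_hom: "sym_map R M M' h \<in> ring_hom SymM (Sym R M')"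
    and sym_map_incl: "m \<in> carrier M \<Longrightarrow> sym_map R M M' h (sym_incl R M m) = sym_incl R M' (h m)"
    and sym_map_smult: "k \<in> carrier R \<Longrightarrow> w \<in> carrier SymM \<Longrightarrow>
      sym_map R M M' h (k \<odot>\<^bsub>SymM\<^esub> w) = k \<odot>\<^bsub>Sym R M'\<^esub> sym_map R M M' h w"
proof -
  interpret M': module R M' by fact
  define F where "F p = M'.cls (indexed_poly_rename R h p)" for p
  interpret S': cring M'.SymM by (rule M'.Sym_cring)
  interpret P: cring PM by (rule polys_cring)
  have hM: "h m \<in> carrier M'" if "m \<in> carrier M" for m
    using h that by (auto simp: LinearCombinations.module_hom_def)
  note ren = rename_in_polys[where J = "carrier M'", OF _ hM]
  have F_const: "F (indexed_const k) = M'.cls (indexed_const k)" if "k \<in> carrier R" for k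
    using that by (simp add: F_def rename_const)
  have F_hom: "F \<in> ring_hom PM M'.SymM"
  proof (rule ring_hom_polysI[OF M'.Sym_cring M'.const_ring_hom, where x = "\<lambda>m. sym_incl R M' (h m)"])
    fix p q assume "p \<in> carrier PM" "q \<in> carrier PM"
    then show "F (p \<oplus>\<^bsub>PM\<^esub> q) = F p \<oplus>\<^bsub>M'.SymM\<^esub> F q"
      by (simp add: F_def rename_add[where J = "carrier M'"] M'.cls_add ren)
  next
    fix p m assume "p \<in> carrier PM" "m \<in> carrier M"
    then show "F (indexed_pmult p m) = sym_incl R M' (h m) \<otimes>\<^bsub>M'.SymM\<^esub> F p"
      by (simp add: F_def rename_pmult[where I = "carrier M"] M'.cls_pmult ren hM)
  qed (simp_all add: F_const hM)
  have F_var: "F (indexed_var m) = sym_incl R M' (h m)" if "m \<in> carrier M" for m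
    using that by (simp add: F_def indexed_var_def rename_pmult[where I = "carrier M"] rename_const sym_incl_def)
  have wd: "F p = F q" if "p \<in> carrier PM" "q \<in> carrier PM" "cls p = cls q" for p q
    using that
  proof (rule hom_kills_sym_ideal[OF M'.Sym_cring F_hom, rotated 2])
    fix m n assume mn: "m \<in> carrier M" "n \<in> carrier M"
    then show "F (indexed_var (m \<oplus>\<^bsub>M\<^esub> n)) = F (indexed_var m) \<oplus>\<^bsub>M'.SymM\<^esub> F (indexed_var n)"
      by (simp add: F_var module_hom_add[OF h mn] module_hom_add[OF M'.sym_incl_hom] hM)
  next
    fix r m assume rm: "r \<in> carrier R" "m \<in> carrier M"
    then show "F (indexed_var (r \<odot>\<^bsub>M\<^esub> m)) = F (indexed_const r) \<otimes>\<^bsub>M'.SymM\<^esub> F (indexed_var m)"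
      by (simp add: F_var F_const module_hom_smult[OF h rm] module_hom_smult[OF M'.sym_incl_hom] hM
          M'.Sym_smult)
  qed
  have cls: "sym_map R M M' h (cls p) = F p" if p: "p \<in> carrier PM" for p
  proof -
    have "(\<Union>q\<in>cls p. F q) = (\<Union>q\<in>cls p. F p)"
    proof (rule SUP_cong[OF refl])
      fix q assume "q \<in> cls p"
      then show "F q = F p" using wd[of q p] p by (simp add: cls_mem_iff)
    qed
    moreover have "cls p \<noteq> {}" using cls_mem_iff[OF p, of p] p by auto
    ultimately show ?thesis by (simp add: sym_map_def F_def)
  qed
  then show "p \<in> carrier PM \<Longrightarrow> sym_map R M M' h (cls p) = M'.cls (indexed_poly_rename R h p)"
    by (simp add: F_def)
  show hom: "sym_map R M M' h \<in> ring_hom SymM M'.SymM"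
  proof (rule ring_hom_memI)
    fix v assume "v \<in> carrier SymM"
    then obtain p where p: "p \<in> carrier PM" "v = cls p" by (rule Sym_cases)
    then show "sym_map R M M' h v \<in> carrier M'.SymM" by (simp add: cls ring_hom_closed[OF F_hom])
    fix w assume "w \<in> carrier SymM"
    then obtain q where q: "q \<in> carrier PM" "w = cls q" by (rule Sym_cases)
    show "sym_map R M M' h (v \<otimes>\<^bsub>SymM\<^esub> w) = sym_map R M M' h v \<otimes>\<^bsub>M'.SymM\<^esub> sym_map R M M' h w"
      using p q cls[OF P.m_closed[OF p(1) q(1)]] by (simp add: cls cls_mult ring_hom_mult[OF F_hom])
    show "sym_map R M M' h (v \<oplus>\<^bsub>SymM\<^esub> w) = sym_map R M M' h v \<oplus>\<^bsub>M'.SymM\<^esub> sym_map R M M' h w"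
      using p q cls[OF P.a_closed[OF p(1) q(1)]] by (simp add: cls cls_add ring_hom_add[OF F_hom])
  next
    show "sym_map R M M' h \<one>\<^bsub>SymM\<^esub> = \<one>\<^bsub>M'.SymM\<^esub>"
      using cls[of "indexed_const \<one>"] by (simp add: cls_one F_const M'.cls_one)
  qed
  have const: "sym_map R M M' h (cls (indexed_const k)) = M'.cls (indexed_const k)" if "k \<in> carrier R" for k
    using that by (simp add: cls F_const)
  show "sym_map R M M' h (sym_incl R M m) = sym_incl R M' (h m)" if "m \<in> carrier M"
    using that cls[of "indexed_var m"] F_var[OF that] by (simp add: sym_incl_def)
  show "sym_map R M M' h (k \<odot>\<^bsub>SymM\<^esub> w) = k \<odot>\<^bsub>M'.SymM\<^esub> sym_map R M M' h w"
    if "k \<in> carrier R" "w \<in> carrier SymM"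
    using that by (simp add: Sym_smult M'.Sym_smult ring_hom_mult[OF hom] const)
qed

end

section \<open>The grading of the symmetric algebra\<close>

text \<open>The carrier is part of the definition of a finite sum, so sums in a substructure have to be compared
  with sums in the whole.\<close>

lemma finsum_carrier_update:
  assumes A: "abelian_monoid A" and B: "abelian_monoid (A\<lparr>carrier := H\<rparr>)"
    and H: "H \<subseteq> carrier A" and I: "finite I" "c \<in> I \<rightarrow> H"
  shows "finsum (A\<lparr>carrier := H\<rparr>) c I = finsum A c I"
proof -
  interpret A: abelian_monoid A by fact
  interpret B: abelian_monoid "A\<lparr>carrier := H\<rparr>" by fact
  show ?thesis using I
  proof (induction I rule: finite_induct)
    case (insert i I)
    have 1: "c \<in> I \<rightarrow> H" "c i \<in> H" using insert by auto
    then have 2: "c \<in> I \<rightarrow> carrier A" "c i \<in> carrier A" using H by auto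
    have "finsum (A\<lparr>carrier := H\<rparr>) c (insert i I) = c i \<oplus>\<^bsub>A\<^esub> finsum (A\<lparr>carrier := H\<rparr>) c I"
      using insert(1,2) 1 B.finsum_insert[of I i c] by simp
    with insert 1 2 show ?case by simp
  qed simp
qed

text \<open>If the homogeneous components can be read off by additive projections, a decomposition into
  components is unique: the projection to degree \<open>e\<close> of a sum of homogeneous elements is the summand
  of degree \<open>e\<close>. Existence is asked for in the form of all sufficiently long initial sums, a condition
  that passes to sums of two elements and to tensor products; it forces almost all projections of an
  element to be zero.\<close>

lemma graded_algebraI:
  assumes "algebra R A" and sub: "\<And>d. Module.submodule (gr d) R A"
    and closed: "\<And>d x. x \<in> carrier A \<Longrightarrow> \<pi> d x \<in> gr d"
    and add: "\<And>d x y. x \<in> carrier A \<Longrightarrow> y \<in> carrier A \<Longrightarrow> \<pi> d (x \<oplus>\<^bsub>A\<^esub> y) = \<pi> d x \<oplus>\<^bsub>A\<^esub> \<pi> d y"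
    and own: "\<And>d e x. x \<in> gr d \<Longrightarrow> \<pi> e x = (if e = d then x else \<zero>\<^bsub>A\<^esub>)"
    and sum: "\<And>x. x \<in> carrier A \<Longrightarrow> \<exists>n. \<forall>N\<ge>n. x = (\<Oplus>\<^bsub>A\<^esub>d\<in>{..<N}. \<pi> d x)"
    and one: "\<one>\<^bsub>A\<^esub> \<in> gr 0"
    and mult: "\<And>d e x y. x \<in> gr d \<Longrightarrow> y \<in> gr e \<Longrightarrow> x \<otimes>\<^bsub>A\<^esub> y \<in> gr (d + e)"
  shows "graded_algebra R A gr"
proof -
  interpret A: algebra R A by fact
  have grA: "x \<in> carrier A" if "x \<in> gr d" for x d
    using A.submoduleE(1)[OF sub[of d]] that by auto
  have zero: "\<zero>\<^bsub>A\<^esub> \<in> gr d" for d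
    using subgroup.one_closed[OF submodule.axioms(1)[OF sub[of d]]] by simp
  have \<pi>A: "\<pi> d x \<in> carrier A" if "x \<in> carrier A" for d x
    using closed[OF that] grA by blast
  have \<pi>_sum: "\<pi> e (\<Oplus>\<^bsub>A\<^esub>d\<in>F. c d) = (if e \<in> F then c e else \<zero>\<^bsub>A\<^esub>)"
    if "finite F" "\<And>d. c d \<in> gr d" for F e c
    using that(1)
  proof (induction F rule: finite_induct)
    case empty
    then show ?case using own[OF zero[of e], of e] by simp
  next
    case (insert d F)
    have "c \<in> F \<rightarrow> carrier A" "c d \<in> carrier A" using that(2) grA by blast+
    then show ?case using insert own[OF that(2)[of d], of e] grA[OF that(2)[of e]] by (simp add: add)
  qed
  have ex: "\<exists>!c. (\<forall>d. c d \<in> gr d) \<and> finite {d. c d \<noteq> \<zero>\<^bsub>A\<^esub>} \<and>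
        x = (\<Oplus>\<^bsub>A\<^esub>d\<in>{d. c d \<noteq> \<zero>\<^bsub>A\<^esub>}. c d)" if x: "x \<in> carrier A" for x
  proof (rule ex1I)
    obtain n where n: "x = (\<Oplus>\<^bsub>A\<^esub>d\<in>{..<N}. \<pi> d x)" if "N \<ge> n" for N
      using sum[OF x] by blast
    have vanish: "\<pi> N x = \<zero>\<^bsub>A\<^esub>" if "N \<ge> n" for N
    proof -
      \<comment> \<open>Two consecutive initial sums are both equal to \<open>x\<close>.\<close>
      have "x = \<pi> N x \<oplus>\<^bsub>A\<^esub> x"
        using n[of "Suc N"] n[OF that] that \<pi>A[OF x] by (simp add: lessThan_Suc)
      then show ?thesis using x \<pi>A[OF x] by simp
    qed
    then have sub: "{d. \<pi> d x \<noteq> \<zero>\<^bsub>A\<^esub>} \<subseteq> {..<n}" by (auto simp: not_less[symmetric])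
    have "(\<Oplus>\<^bsub>A\<^esub>d\<in>{d. \<pi> d x \<noteq> \<zero>\<^bsub>A\<^esub>}. \<pi> d x) = (\<Oplus>\<^bsub>A\<^esub>d\<in>{..<n}. \<pi> d x)"
      using sub \<pi>A[OF x] by (intro A.add.finprod_mono_neutral_cong_left) auto
    then show "(\<forall>d. \<pi> d x \<in> gr d) \<and> finite {d. \<pi> d x \<noteq> \<zero>\<^bsub>A\<^esub>} \<and>
        x = (\<Oplus>\<^bsub>A\<^esub>d\<in>{d. \<pi> d x \<noteq> \<zero>\<^bsub>A\<^esub>}. \<pi> d x)"
      using closed[OF x] n[of n] finite_subset[OF sub] by simp
  next
    fix c assume c: "(\<forall>d. c d \<in> gr d) \<and> finite {d. c d \<noteq> \<zero>\<^bsub>A\<^esub>} \<and>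
        x = (\<Oplus>\<^bsub>A\<^esub>d\<in>{d. c d \<noteq> \<zero>\<^bsub>A\<^esub>}. c d)"
    show "c = (\<lambda>d. \<pi> d x)"
    proof
      fix e
      have "\<pi> e x = \<pi> e (\<Oplus>\<^bsub>A\<^esub>d\<in>{d. c d \<noteq> \<zero>\<^bsub>A\<^esub>}. c d)" using c by simp
      also have "\<dots> = c e" using c by (subst \<pi>_sum) auto
      finally show "c e = \<pi> e x" by simp
    qed
  qed
  show ?thesis unfolding graded_algebra_def
    using assms(1) sub one mult ex by blast
qed

context cring
begin

definition hom_part :: "nat \<Rightarrow> ('i multiset \<Rightarrow> 'a) \<Rightarrow> 'i multiset \<Rightarrow> 'a"
  where "hom_part d P = (\<lambda>m. if size m = d then P m else \<zero>)"

definition truncate :: "nat \<Rightarrow> ('i multiset \<Rightarrow> 'a) \<Rightarrow> 'i multiset \<Rightarrow> 'a"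
  where "truncate N P = (\<lambda>m. if size m < N then P m else \<zero>)"

lemma hom_part_const: "hom_part d (indexed_const k) = (if d = 0 then indexed_const k else indexed_const \<zero>)"
  by (auto simp: hom_part_def indexed_const_def)

lemma hom_part_add: "hom_part d (P \<oplus>\<^bsub>polys I\<^esub> Q) = hom_part d P \<oplus>\<^bsub>polys I\<^esub> hom_part d Q"
  by (auto simp: hom_part_def polys_add)

lemma hom_part_scale: "k \<in> carrier R \<Longrightarrow> hom_part d (\<lambda>m. k \<otimes> P m) = (\<lambda>m. k \<otimes> hom_part d P m)"
  by (auto simp: hom_part_def)

lemma hom_part_pmult_0: "hom_part 0 (indexed_pmult P i) = indexed_const \<zero>"
  by (auto simp: hom_part_def indexed_pmult_def indexed_const_def)

lemma hom_part_pmult_Suc: "hom_part (Suc d) (indexed_pmult P i) = indexed_pmult (hom_part d P) i"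
  by (auto simp: hom_part_def indexed_pmult_def size_Diff_singleton_if fun_eq_iff
      dest: multi_member_split)

lemma hom_part_hom_part: "hom_part d (hom_part e P) = (if d = e then hom_part e P else indexed_const \<zero>)"
  by (auto simp: hom_part_def indexed_const_def)

lemma hom_part_in_polys:
  assumes "P \<in> carrier (polys I)"
  shows "hom_part d P \<in> carrier (polys I)"
  using assms
proof (induction P arbitrary: d rule: polys_induct)
  case (pmult P i)
  then show ?case by (cases d) (simp_all add: hom_part_pmult_0 hom_part_pmult_Suc)
qed (simp_all add: hom_part_const hom_part_add add_in_polys)

lemma truncate_0: "truncate 0 P = indexed_const \<zero>"
  by (auto simp: truncate_def indexed_const_def)

lemma truncate_Suc:
  assumes "P \<in> carrier (polys I)"
  shows "truncate (Suc N) P = hom_part N P \<oplus>\<^bsub>polys I\<^esub> truncate N P"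
  using assms by (auto simp: truncate_def hom_part_def polys_add coeff_closed less_Suc_eq)

lemma truncate_in_polys: "P \<in> carrier (polys I) \<Longrightarrow> truncate N P \<in> carrier (polys I)"
  by (induction N) (simp_all add: truncate_0 truncate_Suc[where I = I] hom_part_in_polys add_in_polys)

lemma truncate_eventually:
  assumes "P \<in> carrier (polys I)"
  obtains n where "\<And>N. N \<ge> n \<Longrightarrow> truncate N P = P"
proof
  fix N assume N: "N \<ge> Suc (Max (insert 0 (size ` {m. P m \<noteq> \<zero>})))"
  show "truncate N P = P"
  proof
    fix m
    have "size m < N" if "P m \<noteq> \<zero>"
    proof -
      have "size m \<le> Max (insert 0 (size ` {m. P m \<noteq> \<zero>}))"
        using that finite_support[OF assms] by (intro Max_ge) auto
      with N show ?thesis by linarith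
    qed
    then show "truncate N P m = P m" by (cases "P m = \<zero>") (simp_all add: truncate_def)
  qed
qed

text \<open>Renaming variables does not change the degree of a monomial.\<close>

lemma rename_hom_part:
  assumes "P \<in> carrier (polys I)"
  shows "indexed_poly_rename R h (hom_part d P) = hom_part d (indexed_poly_rename R h P)"
  using assms
proof (induction P arbitrary: d rule: polys_induct)
  case (add P Q)
  then show ?case
    by (simp add: hom_part_add rename_add[where J = UNIV] hom_part_in_polys)
next
  case (pmult P i)
  then show ?case
    by (cases d) (simp_all add: rename_pmult[where I = I] hom_part_in_polys hom_part_pmult_0
      hom_part_pmult_Suc rename_const)
qed (simp add: hom_part_const rename_const)

end

context module
begin

lemma cls_scale:
  assumes "k \<in> carrier R" "p \<in> carrier PM"
  shows "k \<odot>\<^bsub>SymM\<^esub> cls p = cls (\<lambda>m. k \<otimes> p m)"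
proof -
  have "indexed_const k \<otimes>\<^bsub>PM\<^esub> p = (\<lambda>m. k \<otimes> p m)"
    using assms by (intro conv_const_left) (auto intro: coeff_closed)
  with assms show ?thesis by (simp add: Sym_smult flip: cls_mult)
qed

text \<open>Both kinds of relations are homogeneous of degree 1.\<close>

lemma sym_relation_add_hom_part:
  assumes "m \<in> carrier M" "n \<in> carrier M"
  defines "p \<equiv> indexed_var (m \<oplus>\<^bsub>M\<^esub> n) \<ominus>\<^bsub>PM\<^esub> (indexed_var m \<oplus>\<^bsub>PM\<^esub> indexed_var n)"
  shows "hom_part d p = (if d = 1 then p else indexed_const \<zero>)"
proof -
  have "p = (\<lambda>x. indexed_var (m \<oplus>\<^bsub>M\<^esub> n) x \<ominus> (indexed_var m x \<oplus> indexed_var n x))"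
    unfolding p_def using assms(1,2)
    by (subst polys_minus[OF var_in_polys add_in_polys]) (simp_all add: polys_add)
  then show ?thesis by (auto simp: hom_part_def indexed_var_eq indexed_const_def a_minus_def)
qed

lemma sym_relation_smult_hom_part:
  assumes "r \<in> carrier R" "m \<in> carrier M"
  defines "p \<equiv> indexed_var (r \<odot>\<^bsub>M\<^esub> m) \<ominus>\<^bsub>PM\<^esub> (indexed_const r \<otimes>\<^bsub>PM\<^esub> indexed_var m)"
  shows "hom_part d p = (if d = 1 then p else indexed_const \<zero>)"
proof -
  have "p = (\<lambda>x. indexed_var (r \<odot>\<^bsub>M\<^esub> m) x \<ominus> (r \<otimes> indexed_var m x))"
  proof -
    have "indexed_const r \<otimes>\<^bsub>PM\<^esub> indexed_var m = (\<lambda>x. r \<otimes> indexed_var m x)"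
      using assms(1) by (intro conv_const_left) (simp_all add: indexed_var_eq)
    with polys_minus[OF var_in_polys[OF smult_closed[OF assms(1,2)]]
        mult_in_polys[OF const_in_polys[OF assms(1)] var_in_polys[OF assms(2)]]]
    show ?thesis unfolding p_def by simp
  qed
  with assms(1) show ?thesis by (auto simp: hom_part_def indexed_var_eq indexed_const_def a_minus_def)
qed

lemma zero_in_sym_ideal: "indexed_const \<zero> \<in> sym_ideal R M"
proof -
  interpret I: ideal "sym_ideal R M" PM by (rule sym_ideal_ideal)
  have "\<zero>\<^bsub>PM\<^esub> \<in> sym_ideal R M" by (rule additive_subgroup.zero_closed[OF I.additive_subgroup_axioms])
  then show ?thesis by (simp add: polys_zero indexed_zero_def)
qed

text \<open>The elements of the ideal whose homogeneous parts all stay in the ideal form an ideal themselves,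
  since multiplication by a variable only shifts the parts. It contains the relations, which are
  homogeneous.\<close>

lemma sym_ideal_homogeneous:
  assumes "p \<in> sym_ideal R M"
  shows "hom_part d p \<in> sym_ideal R M"
proof -
  interpret P: cring PM by (rule polys_cring)
  interpret I: ideal "sym_ideal R M" PM by (rule sym_ideal_ideal)
  have scale: "(\<lambda>m. k \<otimes> p m) \<in> sym_ideal R M" if "k \<in> carrier R" "p \<in> sym_ideal R M" for k p
  proof -
    have "indexed_const k \<otimes>\<^bsub>PM\<^esub> p = (\<lambda>m. k \<otimes> p m)"
      using that(1) coeff_closed[OF I.Icarr[OF that(2)]] by (rule conv_const_left)
    with that I.I_l_closed[of p "indexed_const k"] show ?thesis by simp
  qed
  have pmult: "indexed_pmult p m \<in> sym_ideal R M" if "m \<in> carrier M" "p \<in> sym_ideal R M" for m p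
    using pmult_eq_mult[of p "carrier M" m] I.I_l_closed[of p "indexed_var m"] I.Icarr that
    by (metis var_in_polys)
  let ?J = "{p \<in> sym_ideal R M. \<forall>d. hom_part d p \<in> sym_ideal R M}"
  have "ideal ?J PM"
  proof (rule ideal_polysI)
    show "?J \<subseteq> carrier PM" using I.Icarr by auto
    show "\<zero>\<^bsub>PM\<^esub> \<in> ?J"
    proof -
      have "hom_part d (\<lambda>m::'c multiset. \<zero>) = (\<lambda>m. \<zero>)" for d by (simp add: hom_part_def)
      then show ?thesis using zero_in_sym_ideal by (simp add: polys_zero indexed_zero_def)
    qed
  next
    fix p q assume "p \<in> ?J" "q \<in> ?J"
    then show "p \<oplus>\<^bsub>PM\<^esub> q \<in> ?J" by (simp add: hom_part_add)
  next
    fix k p assume "k \<in> carrier R" "p \<in> ?J"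
    then show "(\<lambda>m. k \<otimes> p m) \<in> ?J" by (simp add: hom_part_scale scale)
  next
    fix m p assume mp: "m \<in> carrier M" "p \<in> ?J"
    have "hom_part d (indexed_pmult p m) \<in> sym_ideal R M" for d
      using mp zero_in_sym_ideal by (cases d) (simp_all add: hom_part_pmult_0 hom_part_pmult_Suc pmult)
    with mp show "indexed_pmult p m \<in> ?J" by (simp add: pmult)
  qed
  moreover have "sym_relations R M \<subseteq> ?J"
  proof
    fix p assume p: "p \<in> sym_relations R M"
    then have "hom_part d p = (if d = 1 then p else indexed_const \<zero>)" for d
      by (cases rule: sym_relations_cases)
        (simp_all only: sym_relation_add_hom_part sym_relation_smult_hom_part)
    with p sym_relations_subset zero_in_sym_ideal show "p \<in> ?J" by auto
  qed
  ultimately show ?thesis using sym_ideal_minimal assms by blast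
qed

definition sym_part :: "nat \<Rightarrow> ('c multiset \<Rightarrow> 'a) set \<Rightarrow> ('c multiset \<Rightarrow> 'a) set"
  where "sym_part d = on_classes (\<lambda>p. cls (hom_part d p))"

lemma sym_part_cls:
  assumes "p \<in> carrier PM"
  shows "sym_part d (cls p) = cls (hom_part d p)"
  unfolding sym_part_def
proof (rule on_classes[OF _ assms])
  fix p q assume pq: "p \<in> carrier PM" "q \<in> carrier PM" "cls p = cls q"
  then have "hom_part d (p \<ominus>\<^bsub>PM\<^esub> q) \<in> sym_ideal R M"
    using cls_eq_iff[OF pq(1,2)] by (intro sym_ideal_homogeneous) simp
  moreover have "hom_part d (p \<ominus>\<^bsub>PM\<^esub> q) = hom_part d p \<ominus>\<^bsub>PM\<^esub> hom_part d q"
    unfolding polys_minus[OF pq(1,2)] polys_minus[OF hom_part_in_polys[OF pq(1)] hom_part_in_polys[OF pq(2)]]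
    by (rule ext) (simp add: hom_part_def a_minus_def)
  ultimately show "cls (hom_part d p) = cls (hom_part d q)"
    using cls_eq_iff[OF hom_part_in_polys[OF pq(1)] hom_part_in_polys[OF pq(2)]] by simp
qed

lemma sym_grade_eq: "sym_grade R M d = {cls (hom_part d p) | p. p \<in> carrier PM}"
proof (intro equalityI subsetI)
  fix w assume "w \<in> sym_grade R M d"
  then obtain p where p: "p \<in> carrier PM" "\<forall>m. p m \<noteq> \<zero> \<longrightarrow> size m = d" "w = cls p"
    unfolding sym_grade_def by blast
  have "hom_part d p = p"
  proof
    fix m show "hom_part d p m = p m" using p(2)[rule_format, of m] by (cases "p m = \<zero>") (simp_all add: hom_part_def)
  qed
  with p show "w \<in> {cls (hom_part d p) | p. p \<in> carrier PM}" by (intro CollectI exI[of _ p]) simp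
next
  fix w assume "w \<in> {cls (hom_part d p) | p. p \<in> carrier PM}"
  then obtain p where p: "p \<in> carrier PM" "w = cls (hom_part d p)" by blast
  moreover have "\<forall>m. hom_part d p m \<noteq> \<zero> \<longrightarrow> size m = d" by (simp add: hom_part_def)
  ultimately show "w \<in> sym_grade R M d" unfolding sym_grade_def
    using hom_part_in_polys[OF p(1), of d] by blast
qed

lemma sym_part_grade:
  assumes "w \<in> carrier SymM"
  shows "sym_part d w \<in> sym_grade R M d"
proof -
  obtain p where p: "p \<in> carrier PM" "w = cls p" using assms by (rule Sym_cases)
  show ?thesis unfolding sym_grade_eq p(2) sym_part_cls[OF p(1)]
    by (intro CollectI exI[of _ p] conjI refl p(1))
qed

lemma sym_grade_cases:
  assumes "w \<in> sym_grade R M d"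
  obtains p where "p \<in> carrier PM" "w = cls (hom_part d p)"
  using assms unfolding sym_grade_eq by blast

lemma sym_grade_closed:
  assumes "w \<in> sym_grade R M d"
  shows "w \<in> carrier SymM"
  using assms by (rule sym_grade_cases) (simp add: hom_part_in_polys)

lemma sym_part_own:
  assumes "w \<in> sym_grade R M d"
  shows "sym_part e w = (if e = d then w else \<zero>\<^bsub>SymM\<^esub>)"
  using assms
  by (rule sym_grade_cases)
    (simp add: sym_part_cls hom_part_in_polys hom_part_hom_part cls_zero indexed_zero_def)

lemma sym_part_hom: "sym_part d \<in> LinearCombinations.module_hom R SymM SymM"
proof -
  interpret P: cring PM by (rule polys_cring)
  have "sym_part d (v \<oplus>\<^bsub>SymM\<^esub> w) = sym_part d v \<oplus>\<^bsub>SymM\<^esub> sym_part d w"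
    if v: "v \<in> carrier SymM" and w: "w \<in> carrier SymM" for v w
  proof -
    obtain p q where pq: "p \<in> carrier PM" "v = cls p" "q \<in> carrier PM" "w = cls q"
      using Sym_cases[OF v] Sym_cases[OF w] by metis
    have "sym_part d (cls (p \<oplus>\<^bsub>PM\<^esub> q)) = cls (hom_part d p \<oplus>\<^bsub>PM\<^esub> hom_part d q)"
      using pq by (simp only: sym_part_cls P.a_closed hom_part_add)
    with pq show ?thesis by (simp add: cls_add sym_part_cls hom_part_in_polys)
  qed
  moreover have "sym_part d (k \<odot>\<^bsub>SymM\<^esub> w) = k \<odot>\<^bsub>SymM\<^esub> sym_part d w"
    if k: "k \<in> carrier R" and w: "w \<in> carrier SymM" for k w
  proof -
    obtain p where p: "p \<in> carrier PM" "w = cls p" using w by (rule Sym_cases)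
    have "sym_part d (cls (\<lambda>m. k \<otimes> p m)) = cls (\<lambda>m. k \<otimes> hom_part d p m)"
      using p k by (simp only: sym_part_cls scale_in_polys hom_part_scale)
    with p k show ?thesis by (simp add: cls_scale sym_part_cls hom_part_in_polys)
  qed
  ultimately show ?thesis unfolding LinearCombinations.module_hom_def
    by (simp add: Pi_iff sym_grade_closed[OF sym_part_grade])
qed

lemma sym_part_closed [simp]: "w \<in> carrier SymM \<Longrightarrow> sym_part d w \<in> carrier SymM"
  by (rule sym_grade_closed[OF sym_part_grade])

lemma sym_part_sum:
  assumes "w \<in> carrier SymM"
  shows "\<exists>n. \<forall>N\<ge>n. w = (\<Oplus>\<^bsub>SymM\<^esub>d\<in>{..<N}. sym_part d w)"
proof -
  interpret S: cring SymM by (rule Sym_cring)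
  obtain p where p: "p \<in> carrier PM" "w = cls p" using assms by (rule Sym_cases)
  have *: "(\<Oplus>\<^bsub>SymM\<^esub>d\<in>{..<N}. sym_part d w) = cls (truncate N p)" for N
  proof (induction N)
    case (Suc N)
    have "cls (truncate (Suc N) p) = sym_part N w \<oplus>\<^bsub>SymM\<^esub> cls (truncate N p)"
      using p by (simp add: truncate_Suc[where I = "carrier M"] cls_add hom_part_in_polys truncate_in_polys sym_part_cls)
    with Suc assms show ?case by (simp add: lessThan_Suc)
  qed (simp add: truncate_0 indexed_zero_def cls_zero)
  obtain n where "\<And>N. N \<ge> n \<Longrightarrow> truncate N p = p" using truncate_eventually[OF p(1)] by blast
  with p * have "\<forall>N\<ge>n. w = (\<Oplus>\<^bsub>SymM\<^esub>d\<in>{..<N}. sym_part d w)" by simp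
  then show ?thesis by blast
qed

lemma sym_grade_submodule: "Module.submodule (sym_grade R M d) R SymM"
proof -
  interpret S: algebra R SymM by (rule Sym_algebra)
  have grade: "w \<in> sym_grade R M d \<longleftrightarrow> w \<in> carrier SymM \<and> sym_part d w = w" for w
    using sym_part_own[of w d d] sym_part_grade[of w d] sym_grade_closed by auto
  have 0: "sym_part d \<zero>\<^bsub>SymM\<^esub> = \<zero>\<^bsub>SymM\<^esub>"
    using module_hom_smult[OF sym_part_hom, of \<zero> "\<zero>\<^bsub>SymM\<^esub>" d] by simp
  show ?thesis
  proof (rule S.submoduleI)
    fix w assume w: "w \<in> sym_grade R M d"
    have "\<ominus>\<^bsub>SymM\<^esub> w = (\<ominus> \<one>) \<odot>\<^bsub>SymM\<^esub> w" using w grade by (simp add: S.smult_l_minus)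
    then show "\<ominus>\<^bsub>SymM\<^esub> w \<in> sym_grade R M d"
      using w module_hom_smult[OF sym_part_hom, of "\<ominus> \<one>" w d] by (simp add: grade)
  qed (auto simp: grade 0 module_hom_add[OF sym_part_hom] module_hom_smult[OF sym_part_hom])
qed

lemma sym_grade_mult:
  assumes "v \<in> sym_grade R M d" "w \<in> sym_grade R M e"
  shows "v \<otimes>\<^bsub>SymM\<^esub> w \<in> sym_grade R M (d + e)"
proof -
  obtain p q where p: "p \<in> carrier PM" "\<forall>m. p m \<noteq> \<zero> \<longrightarrow> size m = d" "v = cls p"
    and q: "q \<in> carrier PM" "\<forall>m. q m \<noteq> \<zero> \<longrightarrow> size m = e" "w = cls q"
    using assms unfolding sym_grade_def by blast
  interpret P: cring PM by (rule polys_cring)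
  have "size m = d + e" if "(p \<otimes>\<^bsub>PM\<^esub> q) m \<noteq> \<zero>" for m
  proof (rule ccontr)
    assume m: "size m \<noteq> d + e"
    have "(\<Oplus>a\<in>{a. a \<subseteq># m}. p a \<otimes> q (m - a)) = (\<Oplus>a\<in>{a. a \<subseteq># m}. \<zero>)"
    proof (intro R.add.finprod_cong')
      fix a assume "a \<in> {a. a \<subseteq># m}"
      then have "size m = size a + size (m - a)" by (simp add: size_Diff_submset size_mset_mono)
      with m p(2) q(2) have "p a = \<zero> \<or> q (m - a) = \<zero>" by metis
      then show "p a \<otimes> q (m - a) = \<zero>" using coeff_closed[OF p(1)] coeff_closed[OF q(1)] by auto
    qed auto
    with that show False by (simp add: polys_mult)
  qed
  moreover have "v \<otimes>\<^bsub>SymM\<^esub> w = cls (p \<otimes>\<^bsub>PM\<^esub> q)" using p q by (simp add: cls_mult)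
  moreover have "p \<otimes>\<^bsub>PM\<^esub> q \<in> carrier PM" using p q by simp
  ultimately show ?thesis unfolding sym_grade_def by blast
qed

lemma sym_one_grade: "\<one>\<^bsub>SymM\<^esub> \<in> sym_grade R M 0"
  unfolding sym_grade_eq
  by (auto intro!: exI[of _ "indexed_const \<one>"] simp: cls_one hom_part_const)

theorem Sym_graded: "graded_algebra R SymM (sym_grade R M)"
  by (rule graded_algebraI[where \<pi> = sym_part])
    (fact Sym_algebra sym_grade_submodule sym_part_grade module_hom_add[OF sym_part_hom]
      sym_part_own sym_part_sum sym_one_grade sym_grade_mult)+

lemma sym_map_part:
  assumes M': "module R M'" and h: "h \<in> LinearCombinations.module_hom R M M'" and w: "w \<in> carrier SymM"
  shows "sym_map R M M' h (sym_part d w) = module.sym_part R M' d (sym_map R M M' h w)"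
proof -
  interpret M': module R M' by fact
  obtain p where p: "p \<in> carrier PM" "w = cls p" using w by (rule Sym_cases)
  have "indexed_poly_rename R h p \<in> carrier M'.PM"
    using p(1) h by (intro rename_in_polys) (auto simp: LinearCombinations.module_hom_def)
  with p show ?thesis
    by (simp add: sym_part_cls sym_map_cls[OF M' h] hom_part_in_polys M'.sym_part_cls
        rename_hom_part[where I = "carrier M"])
qed

end

section \<open>Constant coefficient and linear part\<close>

context module
begin

text \<open>The part of degree 1, read in \<open>M\<close> by sending the variable \<open>X v\<close> to \<open>v\<close>.\<close>

definition linear_part :: "('c multiset \<Rightarrow> 'a) \<Rightarrow> 'c"
  where "linear_part p = (\<Oplus>\<^bsub>M\<^esub>v\<in>{v \<in> carrier M. p {#v#} \<noteq> \<zero>}. p {#v#} \<odot>\<^bsub>M\<^esub> v)"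

lemma linear_part_superset:
  assumes "p \<in> carrier PM" "finite Z" "Z \<subseteq> carrier M" "{v \<in> carrier M. p {#v#} \<noteq> \<zero>} \<subseteq> Z"
  shows "linear_part p = (\<Oplus>\<^bsub>M\<^esub>v\<in>Z. p {#v#} \<odot>\<^bsub>M\<^esub> v)"
  unfolding linear_part_def
proof (rule M.add.finprod_mono_neutral_cong_left)
  fix v assume "v \<in> Z - {v \<in> carrier M. p {#v#} \<noteq> \<zero>}"
  then show "p {#v#} \<odot>\<^bsub>M\<^esub> v = \<zero>\<^bsub>M\<^esub>" using assms(3) by auto
qed (use assms in \<open>auto simp: coeff_closed[OF assms(1)]\<close>)

lemma finite_linear_support: "p \<in> carrier PM \<Longrightarrow> finite {v \<in> carrier M. p {#v#} \<noteq> \<zero>}"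
  by (rule finite_subset[OF _ finite_vimageI[OF finite_support[of p "carrier M"], of "\<lambda>v. {#v#}"]])
    (auto simp: inj_on_def)

lemma linear_part_closed:
  "p \<in> carrier PM \<Longrightarrow> linear_part p \<in> carrier M"
  unfolding linear_part_def by (intro M.finsum_closed) (auto simp: coeff_closed[of p "carrier M"])

lemma linear_part_const: "linear_part (indexed_const k) = \<zero>\<^bsub>M\<^esub>"
  by (simp add: linear_part_def indexed_const_def)

lemma linear_part_add:
  assumes pq: "p \<in> carrier PM" "q \<in> carrier PM"
  shows "linear_part (p \<oplus>\<^bsub>PM\<^esub> q) = linear_part p \<oplus>\<^bsub>M\<^esub> linear_part q"
proof -
  let ?Z = "{v \<in> carrier M. p {#v#} \<noteq> \<zero>} \<union> {v \<in> carrier M. q {#v#} \<noteq> \<zero>}"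
  have Z: "finite ?Z" "?Z \<subseteq> carrier M" using pq by (auto simp: finite_linear_support)
  have "linear_part (p \<oplus>\<^bsub>PM\<^esub> q) = (\<Oplus>\<^bsub>M\<^esub>v\<in>?Z. (p \<oplus>\<^bsub>PM\<^esub> q) {#v#} \<odot>\<^bsub>M\<^esub> v)"
    by (rule linear_part_superset[OF add_in_polys[OF pq] Z]) (auto simp: polys_add)
  also have "\<dots> = (\<Oplus>\<^bsub>M\<^esub>v\<in>?Z. p {#v#} \<odot>\<^bsub>M\<^esub> v \<oplus>\<^bsub>M\<^esub> q {#v#} \<odot>\<^bsub>M\<^esub> v)"
    using coeff_closed[OF pq(1)] coeff_closed[OF pq(2)]
    by (intro M.add.finprod_cong') (auto simp: polys_add smult_l_distr)
  also have "\<dots> = (\<Oplus>\<^bsub>M\<^esub>v\<in>?Z. p {#v#} \<odot>\<^bsub>M\<^esub> v) \<oplus>\<^bsub>M\<^esub> (\<Oplus>\<^bsub>M\<^esub>v\<in>?Z. q {#v#} \<odot>\<^bsub>M\<^esub> v)"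
    using coeff_closed[OF pq(1)] coeff_closed[OF pq(2)] by (intro M.finsum_addf) auto
  finally show ?thesis
    by (simp only: linear_part_superset[OF pq(1) Z Un_upper1] linear_part_superset[OF pq(2) Z Un_upper2])
qed

lemma linear_part_pmult:
  assumes p: "p \<in> carrier PM" and m: "m \<in> carrier M"
  shows "linear_part (indexed_pmult p m) = p {#} \<odot>\<^bsub>M\<^esub> m"
proof -
  have "linear_part (indexed_pmult p m) = (\<Oplus>\<^bsub>M\<^esub>v\<in>{m}. indexed_pmult p m {#v#} \<odot>\<^bsub>M\<^esub> v)"
    using m by (intro linear_part_superset pmult_in_polys p) (auto simp: indexed_pmult_def)
  also have "\<dots> = p {#} \<odot>\<^bsub>M\<^esub> m"
    using m coeff_closed[OF p, of "{#}"] by (simp add: indexed_pmult_def)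
  finally show ?thesis .
qed

lemma indexed_const_empty: "indexed_const k {#} = k"
  by (simp add: indexed_const_def)

lemma linear_part_var: "m \<in> carrier M \<Longrightarrow> linear_part (indexed_var m) = m"
  by (simp add: indexed_var_def linear_part_pmult indexed_const_empty)

lemma linear_part_scale:
  assumes p: "p \<in> carrier PM" and k: "k \<in> carrier R"
  shows "linear_part (\<lambda>m. k \<otimes> p m) = k \<odot>\<^bsub>M\<^esub> linear_part p"
proof -
  have "linear_part (\<lambda>m. k \<otimes> p m) = (\<Oplus>\<^bsub>M\<^esub>v\<in>{v \<in> carrier M. p {#v#} \<noteq> \<zero>}. (k \<otimes> p {#v#}) \<odot>\<^bsub>M\<^esub> v)"
    using k by (intro linear_part_superset scale_in_polys p finite_linear_support) auto
  also have "\<dots> = (\<Oplus>\<^bsub>M\<^esub>v\<in>{v \<in> carrier M. p {#v#} \<noteq> \<zero>}. k \<odot>\<^bsub>M\<^esub> (p {#v#} \<odot>\<^bsub>M\<^esub> v))"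
    using k coeff_closed[OF p] by (intro M.add.finprod_cong') (auto simp: smult_assoc1)
  also have "\<dots> = k \<odot>\<^bsub>M\<^esub> linear_part p"
    unfolding linear_part_def using k coeff_closed[OF p]
    by (intro finsum_smult_ldistr[symmetric] finite_linear_support p) auto
  finally show ?thesis .
qed

text \<open>The linear part of \<open>X m \<cdot> p\<close> is \<open>p\<^sub>0 m\<close>, with \<open>p\<^sub>0\<close> the constant coefficient of \<open>p\<close>. Hence the
  polynomials for which both the constant coefficient and the linear part vanish form an ideal; for
  the linear part alone this would fail. The relations belong to it. This makes \<open>R\<close> and \<open>M\<close> direct
  summands of the symmetric algebra.\<close>

lemma sym_ideal_low_degree:
  assumes "p \<in> sym_ideal R M"
  shows "p {#} = \<zero>" "linear_part p = \<zero>\<^bsub>M\<^esub>"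
proof -
  interpret P: cring PM by (rule polys_cring)
  let ?J = "{p \<in> carrier PM. p {#} = \<zero> \<and> linear_part p = \<zero>\<^bsub>M\<^esub>}"
  have "ideal ?J PM"
  proof (rule ideal_polysI)
    show "\<zero>\<^bsub>PM\<^esub> \<in> ?J" using P.zero_closed by (simp add: polys_zero linear_part_def)
  next
    fix p q assume "p \<in> ?J" "q \<in> ?J"
    then show "p \<oplus>\<^bsub>PM\<^esub> q \<in> ?J" using P.a_closed[of p q] linear_part_add[of p q] by (simp add: polys_add)
  next
    fix k p assume "k \<in> carrier R" "p \<in> ?J"
    then show "(\<lambda>m. k \<otimes> p m) \<in> ?J" by (simp add: scale_in_polys linear_part_scale)
  next
    fix m p assume "m \<in> carrier M" "p \<in> ?J"
    then show "indexed_pmult p m \<in> ?J" by (simp add: linear_part_pmult) (simp add: indexed_pmult_def)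
  qed auto
  moreover have "sym_relations R M \<subseteq> ?J"
  proof
    note var = linear_part_var
    have minus: "linear_part (p \<ominus>\<^bsub>PM\<^esub> q) = linear_part p \<ominus>\<^bsub>M\<^esub> linear_part q"
      if "p \<in> carrier PM" "q \<in> carrier PM" for p q
    proof -
      have "linear_part p = linear_part (p \<ominus>\<^bsub>PM\<^esub> q) \<oplus>\<^bsub>M\<^esub> linear_part q"
        using that by (subst linear_part_add[symmetric]) (simp_all add: a_minus_def P.a_assoc P.l_neg)
      then show ?thesis
        using that linear_part_closed by (simp add: a_minus_def M.a_assoc M.r_neg)
    qed
    fix p assume p: "p \<in> sym_relations R M"
    then have pP: "p \<in> carrier PM" using sym_relations_carrier by auto
    from p show "p \<in> ?J"
    proof (cases rule: sym_relations_cases)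
      case (add m n)
      then have "linear_part p = (m \<oplus>\<^bsub>M\<^esub> n) \<ominus>\<^bsub>M\<^esub> (m \<oplus>\<^bsub>M\<^esub> n)"
        by (simp add: minus linear_part_add var)
      with add(1,2) have "linear_part p = \<zero>\<^bsub>M\<^esub>" by (simp add: a_minus_def M.r_neg)
      moreover have "p {#} = \<zero>"
        using add(1,2) unfolding add(3)
        by (subst polys_minus[OF var_in_polys add_in_polys]) (simp_all, simp add: polys_add indexed_var_eq)
      ultimately show ?thesis using pP by simp
    next
      case (smult r m)
      have scale: "indexed_const r \<otimes>\<^bsub>PM\<^esub> indexed_var m = (\<lambda>x. r \<otimes> indexed_var m x)"
        using smult(1) by (intro conv_const_left) (simp_all add: indexed_var_eq)
      have "linear_part (indexed_const r \<otimes>\<^bsub>PM\<^esub> indexed_var m) = r \<odot>\<^bsub>M\<^esub> m"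
        unfolding scale using smult(1,2) by (simp add: linear_part_scale var)
      then have "linear_part p = (r \<odot>\<^bsub>M\<^esub> m) \<ominus>\<^bsub>M\<^esub> (r \<odot>\<^bsub>M\<^esub> m)"
        using smult by (simp add: minus var)
      with smult(1,2) have "linear_part p = \<zero>\<^bsub>M\<^esub>" by (simp add: a_minus_def M.r_neg)
      moreover have "p {#} = \<zero>"
        using smult(1,2) polys_minus[OF var_in_polys[OF smult_closed[OF smult(1,2)]]
          mult_in_polys[OF const_in_polys[OF smult(1)] var_in_polys[OF smult(2)]]]
        unfolding smult(3) scale by (simp add: indexed_var_eq a_minus_def)
      ultimately show ?thesis using pP by simp
    qed
  qed
  ultimately have "sym_ideal R M \<subseteq> ?J" by (rule sym_ideal_minimal)
  with assms show "p {#} = \<zero>" "linear_part p = \<zero>\<^bsub>M\<^esub>" by auto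
qed

definition sym_coeff0 :: "('c multiset \<Rightarrow> 'a) set \<Rightarrow> 'a"
  where "sym_coeff0 = on_classes (\<lambda>p. p {#})"

definition sym_linear :: "('c multiset \<Rightarrow> 'a) set \<Rightarrow> 'c"
  where "sym_linear = on_classes linear_part"

lemma sym_coeff0_cls:
  assumes "p \<in> carrier PM"
  shows "sym_coeff0 (cls p) = p {#}"
  unfolding sym_coeff0_def
proof (rule on_classes[OF _ assms])
  fix p q assume pq: "p \<in> carrier PM" "q \<in> carrier PM" "cls p = cls q"
  then have "(p \<ominus>\<^bsub>PM\<^esub> q) {#} = \<zero>"
    using cls_eq_iff[OF pq(1,2)] by (intro sym_ideal_low_degree(1)) simp
  then show "p {#} = q {#}"
    using coeff_closed[OF pq(1)] coeff_closed[OF pq(2)] by (simp add: polys_minus[OF pq(1,2)])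
qed

lemma sym_linear_cls:
  assumes "p \<in> carrier PM"
  shows "sym_linear (cls p) = linear_part p"
  unfolding sym_linear_def
proof (rule on_classes[OF _ assms])
  interpret P: cring PM by (rule polys_cring)
  fix p q assume pq: "p \<in> carrier PM" "q \<in> carrier PM" "cls p = cls q"
  then have 0: "linear_part (p \<ominus>\<^bsub>PM\<^esub> q) = \<zero>\<^bsub>M\<^esub>"
    using cls_eq_iff[OF pq(1,2)] by (intro sym_ideal_low_degree(2)) simp
  have "p = (p \<ominus>\<^bsub>PM\<^esub> q) \<oplus>\<^bsub>PM\<^esub> q"
    using pq(1,2) by (simp add: a_minus_def P.a_assoc P.l_neg)
  then have "linear_part p = linear_part ((p \<ominus>\<^bsub>PM\<^esub> q) \<oplus>\<^bsub>PM\<^esub> q)" by (rule arg_cong)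
  also have "\<dots> = linear_part (p \<ominus>\<^bsub>PM\<^esub> q) \<oplus>\<^bsub>M\<^esub> linear_part q"
    by (rule linear_part_add[OF P.minus_closed[OF pq(1,2)] pq(2)])
  finally show "linear_part p = linear_part q"
    using linear_part_closed[OF pq(2)] by (simp add: 0)
qed

lemma sym_coeff0_closed: "w \<in> carrier SymM \<Longrightarrow> sym_coeff0 w \<in> carrier R"
  by (erule Sym_cases) (simp add: sym_coeff0_cls coeff_closed[where I = "carrier M"])

lemma sym_coeff0_add:
  assumes "v \<in> carrier SymM" "w \<in> carrier SymM"
  shows "sym_coeff0 (v \<oplus>\<^bsub>SymM\<^esub> w) = sym_coeff0 v \<oplus> sym_coeff0 w"
proof -
  obtain p q where pq: "p \<in> carrier PM" "v = cls p" "q \<in> carrier PM" "w = cls q"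
    using Sym_cases[OF assms(1)] Sym_cases[OF assms(2)] by metis
  then have "sym_coeff0 (cls (p \<oplus>\<^bsub>PM\<^esub> q)) = p {#} \<oplus> q {#}"
    by (subst sym_coeff0_cls[OF add_in_polys]) (simp_all add: polys_add)
  with pq show ?thesis by (simp add: sym_coeff0_cls cls_add)
qed

lemma sym_coeff0_smult:
  assumes "k \<in> carrier R" "w \<in> carrier SymM"
  shows "sym_coeff0 (k \<odot>\<^bsub>SymM\<^esub> w) = k \<otimes> sym_coeff0 w"
proof -
  obtain p where p: "p \<in> carrier PM" "w = cls p" using assms(2) by (rule Sym_cases)
  with assms(1) show ?thesis by (simp add: cls_scale sym_coeff0_cls scale_in_polys)
qed

lemma sym_coeff0_one: "sym_coeff0 \<one>\<^bsub>SymM\<^esub> = \<one>"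
  using sym_coeff0_cls[of "indexed_const \<one>"] by (simp add: cls_one indexed_const_empty)

lemma sym_linear_hom: "sym_linear \<in> LinearCombinations.module_hom R SymM M"
proof -
  have add: "sym_linear (v \<oplus>\<^bsub>SymM\<^esub> w) = sym_linear v \<oplus>\<^bsub>M\<^esub> sym_linear w"
    if v: "v \<in> carrier SymM" and w: "w \<in> carrier SymM" for v w
  proof -
    obtain p q where pq: "p \<in> carrier PM" "v = cls p" "q \<in> carrier PM" "w = cls q"
      using Sym_cases[OF v] Sym_cases[OF w] by metis
    then have "sym_linear (cls (p \<oplus>\<^bsub>PM\<^esub> q)) = linear_part p \<oplus>\<^bsub>M\<^esub> linear_part q"
      by (subst sym_linear_cls[OF add_in_polys]) (simp_all add: linear_part_add)
    with pq show ?thesis by (simp add: sym_linear_cls cls_add)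
  qed
  have smult: "sym_linear (k \<odot>\<^bsub>SymM\<^esub> w) = k \<odot>\<^bsub>M\<^esub> sym_linear w"
    if k: "k \<in> carrier R" and w: "w \<in> carrier SymM" for k w
  proof -
    obtain p where p: "p \<in> carrier PM" "w = cls p" using w by (rule Sym_cases)
    with k show ?thesis by (simp add: cls_scale sym_linear_cls scale_in_polys linear_part_scale)
  qed
  have "sym_linear w \<in> carrier M" if w: "w \<in> carrier SymM" for w
    using w by (rule Sym_cases) (simp add: sym_linear_cls linear_part_closed)
  then show ?thesis unfolding LinearCombinations.module_hom_def by (simp add: Pi_iff add smult)
qed

lemma sym_linear_incl:
  assumes "m \<in> carrier M"
  shows "sym_linear (sym_incl R M m) = m"
  using assms by (simp add: sym_incl_def sym_linear_cls linear_part_var)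

lemma cls_hom_part_0:
  assumes "p \<in> carrier PM"
  shows "cls (hom_part 0 p) = cls (indexed_const (p {#}))"
proof -
  have "hom_part 0 p = indexed_const (p {#})" by (auto simp: hom_part_def indexed_const_def)
  then show ?thesis by simp
qed

text \<open>Modulo the relations, a linear form \<open>\<Sum> r\<^sub>v X v\<close> is the single variable \<open>X (\<Sum> r\<^sub>v v)\<close>.\<close>

lemma cls_hom_part_1:
  assumes "p \<in> carrier PM"
  shows "cls (hom_part 1 p) = sym_incl R M (linear_part p)"
proof -
  interpret S: algebra R SymM by (rule Sym_algebra)
  have incl_zero: "sym_incl R M \<zero>\<^bsub>M\<^esub> = \<zero>\<^bsub>SymM\<^esub>"
    using module_hom_smult[OF sym_incl_hom, of \<zero> "\<zero>\<^bsub>M\<^esub>"] by simp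
  from assms show ?thesis
  proof (induction p rule: polys_induct)
    case (const k)
    then show ?case
      by (simp add: hom_part_const linear_part_const incl_zero cls_zero indexed_zero_def)
  next
    case (add p q)
    then show ?case
      by (simp add: hom_part_add cls_add hom_part_in_polys linear_part_add linear_part_closed
        module_hom_add[OF sym_incl_hom])
  next
    case (pmult p m)
    have c: "p {#} \<in> carrier R" using pmult(1) by (rule coeff_closed)
    have "hom_part 0 p = indexed_const (p {#})" by (auto simp: hom_part_def indexed_const_def)
    then have "hom_part 1 (indexed_pmult p m) = indexed_pmult (indexed_const (p {#})) m"
      by (simp add: hom_part_pmult_Suc)
    then have "cls (hom_part 1 (indexed_pmult p m)) = p {#} \<odot>\<^bsub>SymM\<^esub> sym_incl R M m"
      using pmult c by (simp add: cls_pmult Sym_smult S.m_comm)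
    with pmult c show ?case by (simp add: linear_part_pmult module_hom_smult[OF sym_incl_hom])
  qed
qed

lemma sym_grade_0: "sym_grade R M 0 = {k \<odot>\<^bsub>SymM\<^esub> \<one>\<^bsub>SymM\<^esub> | k. k \<in> carrier R}"
proof -
  interpret S: algebra R SymM by (rule Sym_algebra)
  have k: "k \<odot>\<^bsub>SymM\<^esub> \<one>\<^bsub>SymM\<^esub> = cls (indexed_const k)" if "k \<in> carrier R" for k
    using that by (simp add: Sym_smult)
  show ?thesis
  proof (intro equalityI subsetI)
    fix w assume "w \<in> sym_grade R M 0"
    then obtain p where p: "p \<in> carrier PM" "w = cls (hom_part 0 p)" by (rule sym_grade_cases)
    have c: "p {#} \<in> carrier R" using p(1) by (rule coeff_closed)
    have "w = p {#} \<odot>\<^bsub>SymM\<^esub> \<one>\<^bsub>SymM\<^esub>" unfolding p(2) cls_hom_part_0[OF p(1)] k[OF c] by simp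
    with c show "w \<in> {k \<odot>\<^bsub>SymM\<^esub> \<one>\<^bsub>SymM\<^esub> | k. k \<in> carrier R}" by blast
  next
    fix w assume "w \<in> {k \<odot>\<^bsub>SymM\<^esub> \<one>\<^bsub>SymM\<^esub> | k. k \<in> carrier R}"
    then show "w \<in> sym_grade R M 0"
      using S.submoduleE(4)[OF sym_grade_submodule _ sym_one_grade] by auto
  qed
qed

lemma sym_grade_1: "sym_grade R M 1 = sym_incl R M ` carrier M"
proof (intro equalityI subsetI)
  fix w assume "w \<in> sym_grade R M 1"
  then obtain p where p: "p \<in> carrier PM" "w = cls (hom_part 1 p)" by (rule sym_grade_cases)
  show "w \<in> sym_incl R M ` carrier M"
    unfolding p(2) cls_hom_part_1[OF p(1)] using linear_part_closed[OF p(1)] by (rule imageI)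
next
  fix w assume "w \<in> sym_incl R M ` carrier M"
  then obtain m where m: "m \<in> carrier M" "w = cls (indexed_var m)" by (auto simp: sym_incl_def)
  have "hom_part 1 (indexed_var m) = indexed_var m" by (auto simp: hom_part_def indexed_var_eq)
  with m show "w \<in> sym_grade R M 1"
    unfolding sym_grade_eq by (intro CollectI exI[of _ "indexed_var m"]) simp
qed

end

section \<open>The tensor product as an abelian group\<close>

locale tensor_modules =
  fixes K :: "('k, 'x) ring_scheme" and S :: "('k, 's, 'y) module_scheme"
    and B :: "('k, 'b, 'z) module_scheme"
  assumes S_algebra: "algebra K S" and B_module: "module K B"

sublocale tensor_modules \<subseteq> S: algebra K S by (rule S_algebra)
sublocale tensor_modules \<subseteq> B: module K B by (rule B_module)

context tensor_modules
begin

abbreviation "FSB \<equiv> free_Abelian_group (carrier S \<times> carrier B)"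
abbreviation "NSB \<equiv> tensor_kernel K S B"
abbreviation "tc \<equiv> tensor_class K S B"
abbreviation "T \<equiv> tensor K S B"
abbreviation "pure s b \<equiv> tc (frag_of (s, b))"

definition supported :: "('s \<times> 'b \<Rightarrow>\<^sub>0 int) \<Rightarrow> bool"
  where "supported f \<longleftrightarrow> Poly_Mapping.keys f \<subseteq> carrier S \<times> carrier B"

lemma supported_carrier: "f \<in> carrier FSB \<longleftrightarrow> supported f"
  by (simp add: supported_def)

lemma supported_simps [simp]:
  "supported 0" "supported (frag_of (s, b)) \<longleftrightarrow> s \<in> carrier S \<and> b \<in> carrier B"
  "supported (- f) \<longleftrightarrow> supported f"
  by (auto simp: supported_def)

lemma supported_add [simp]: "supported f \<Longrightarrow> supported g \<Longrightarrow> supported (f + g)"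
  unfolding supported_def using keys_add[of f g] by blast

lemma supported_diff [simp]: "supported f \<Longrightarrow> supported g \<Longrightarrow> supported (f - g)"
  unfolding supported_def using keys_diff[of f g] by blast

lemma supported_extend:
  assumes "supported f"
    and "\<And>s b. s \<in> carrier S \<Longrightarrow> b \<in> carrier B \<Longrightarrow> Poly_Mapping.keys (g (s, b)) \<subseteq> Z"
  shows "Poly_Mapping.keys (frag_extend g f) \<subseteq> Z"
  using keys_frag_extend[of g f] assms unfolding supported_def by blast

lemma relations_supported: "r \<in> tensor_relations K S B \<Longrightarrow> supported r"
  unfolding tensor_relations_def by auto

lemma kernel_subgroup: "subgroup NSB FSB"
  unfolding tensor_kernel_def
  by (rule group.generate_is_subgroup) (use relations_supported supported_carrier in auto)

lemma kernel_normal: "normal NSB FSB"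
  using kernel_subgroup abelian_free_Abelian_group comm_group.subgroup_imp_normal by blast

lemma kernel_supported: "f \<in> NSB \<Longrightarrow> supported f"
  using subgroup.subset[OF kernel_subgroup] supported_carrier by blast

lemma kernel_diff: "f \<in> NSB \<Longrightarrow> g \<in> NSB \<Longrightarrow> f - g \<in> NSB"
  using subgroup.m_closed[OF kernel_subgroup, of f "- g"] subgroup.m_inv_closed[OF kernel_subgroup, of g]
    kernel_supported[of g] by (simp add: supported_def)

lemma tc_mem_iff:
  "f \<in> tc g \<longleftrightarrow> f - g \<in> NSB"
  unfolding tensor_class_def r_coset_def by (auto simp: algebra_simps intro!: bexI[of _ "f - g"])

lemma zero_kernel: "0 \<in> NSB"
  using subgroup.one_closed[OF kernel_subgroup] by simp

lemma tc_eq_iff: "tc f = tc g \<longleftrightarrow> f - g \<in> NSB"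
proof
  assume "tc f = tc g"
  then show "f - g \<in> NSB" using tc_mem_iff[of f f] tc_mem_iff[of f g] zero_kernel by simp
next
  assume fg: "f - g \<in> NSB"
  show "tc f = tc g"
  proof (rule Set.set_eqI)
    fix x
    have "x - g \<in> NSB" if "x - f \<in> NSB"
      using kernel_diff[OF that kernel_diff[OF zero_kernel fg]] by simp
    moreover have "x - f \<in> NSB" if "x - g \<in> NSB"
      using kernel_diff[OF that fg] by simp
    ultimately show "x \<in> tc f \<longleftrightarrow> x \<in> tc g" by (auto simp: tc_mem_iff)
  qed
qed

lemma tc_mem: "f \<in> tc g \<longleftrightarrow> tc f = tc g"
  by (simp add: tc_eq_iff tc_mem_iff)

lemma tc_mem_supported: "f \<in> tc g \<Longrightarrow> supported g \<Longrightarrow> supported f"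
  using supported_add[OF kernel_supported[of "f - g"], of g] by (simp add: tc_mem_iff)

lemma T_carrier: "carrier T = {tc f | f. supported f}"
  by (auto simp: tensor_def Let_def carrier_FactGroup tensor_class_def supported_def)

lemma T_cases:
  assumes "w \<in> carrier T"
  obtains f where "supported f" "w = tc f"
  using assms by (auto simp: T_carrier)

lemma tc_closed [simp, intro]: "supported f \<Longrightarrow> tc f \<in> carrier T"
  by (auto simp: T_carrier)

lemma T_zero: "\<zero>\<^bsub>T\<^esub> = tc 0"
proof -
  interpret G: group FSB by simp
  have "NSB #>\<^bsub>FSB\<^esub> \<one>\<^bsub>FSB\<^esub> = NSB"
    using kernel_subgroup by (intro G.coset_mult_one subgroup.subset)
  then show ?thesis by (simp add: tensor_def Let_def tensor_class_def FactGroup_def)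
qed

lemma tc_add: "supported f \<Longrightarrow> supported g \<Longrightarrow> tc (f + g) = tc f \<oplus>\<^bsub>T\<^esub> tc g"
  using normal.rcos_sum[OF kernel_normal, of f g]
  by (simp add: tensor_def Let_def tensor_class_def FactGroup_def supported_carrier supported_def)

lemma T_abelian: "abelian_group T"
proof (rule abelian_groupI)
  fix v w assume "v \<in> carrier T" "w \<in> carrier T"
  then obtain f g where fg: "supported f" "v = tc f" "supported g" "w = tc g" by (metis T_cases)
  show "v \<oplus>\<^bsub>T\<^esub> w \<in> carrier T" using fg by (simp flip: tc_add)
  show "v \<oplus>\<^bsub>T\<^esub> w = w \<oplus>\<^bsub>T\<^esub> v" using fg by (simp add: add.commute flip: tc_add)
  fix u assume "u \<in> carrier T"
  then obtain h where h: "supported h" "u = tc h" by (rule T_cases)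
  show "v \<oplus>\<^bsub>T\<^esub> w \<oplus>\<^bsub>T\<^esub> u = v \<oplus>\<^bsub>T\<^esub> (w \<oplus>\<^bsub>T\<^esub> u)"
    using fg h by (simp add: add.assoc flip: tc_add)
next
  fix v assume "v \<in> carrier T"
  then obtain f where f: "supported f" "v = tc f" by (rule T_cases)
  show "\<zero>\<^bsub>T\<^esub> \<oplus>\<^bsub>T\<^esub> v = v" using f by (simp add: T_zero flip: tc_add)
  have "tc (- f) \<oplus>\<^bsub>T\<^esub> v = \<zero>\<^bsub>T\<^esub>" using f by (simp add: T_zero flip: tc_add)
  then show "\<exists>w\<in>carrier T. w \<oplus>\<^bsub>T\<^esub> v = \<zero>\<^bsub>T\<^esub>" using f by (intro bexI[of _ "tc (- f)"]) auto
qed (simp add: T_zero)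

sublocale T: abelian_group T by (rule T_abelian)

lemma tc_uminus:
  assumes "supported f"
  shows "tc (- f) = \<ominus>\<^bsub>T\<^esub> tc f"
proof -
  have "tc (- f) \<oplus>\<^bsub>T\<^esub> tc f = \<zero>\<^bsub>T\<^esub>" using assms by (simp add: T_zero flip: tc_add)
  then show ?thesis using assms T.minus_equality[of "tc (- f)" "tc f"] by simp
qed

lemma tc_diff: "supported f \<Longrightarrow> supported g \<Longrightarrow> tc (f - g) = tc f \<ominus>\<^bsub>T\<^esub> tc g"
  using tc_add[of f "- g"] by (simp add: tc_uminus a_minus_def)

lemma relation_kernel: "r \<in> tensor_relations K S B \<Longrightarrow> r \<in> NSB"
  unfolding tensor_kernel_def by (rule generate.incl)

lemma pure_closed [simp, intro]: "s \<in> carrier S \<Longrightarrow> b \<in> carrier B \<Longrightarrow> pure s b \<in> carrier T"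
  by simp

lemma pure_add_left:
  assumes "s \<in> carrier S" "s' \<in> carrier S" "b \<in> carrier B"
  shows "pure (s \<oplus>\<^bsub>S\<^esub> s') b = pure s b \<oplus>\<^bsub>T\<^esub> pure s' b"
proof -
  have "frag_of (s \<oplus>\<^bsub>S\<^esub> s', b) - (frag_of (s, b) + frag_of (s', b)) \<in> tensor_relations K S B"
    unfolding tensor_relations_def using assms by blast
  then have "tc (frag_of (s \<oplus>\<^bsub>S\<^esub> s', b)) = tc (frag_of (s, b) + frag_of (s', b))"
    by (simp add: tc_eq_iff relation_kernel)
  with assms show ?thesis by (simp add: tc_add)
qed

lemma pure_add_right:
  assumes "s \<in> carrier S" "b \<in> carrier B" "b' \<in> carrier B"
  shows "pure s (b \<oplus>\<^bsub>B\<^esub> b') = pure s b \<oplus>\<^bsub>T\<^esub> pure s b'"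
proof -
  have "frag_of (s, b \<oplus>\<^bsub>B\<^esub> b') - (frag_of (s, b) + frag_of (s, b')) \<in> tensor_relations K S B"
    unfolding tensor_relations_def using assms by blast
  then have "tc (frag_of (s, b \<oplus>\<^bsub>B\<^esub> b')) = tc (frag_of (s, b) + frag_of (s, b'))"
    by (simp add: tc_eq_iff relation_kernel)
  with assms show ?thesis by (simp add: tc_add)
qed

lemma pure_balanced:
  assumes "k \<in> carrier K" "s \<in> carrier S" "b \<in> carrier B"
  shows "pure (k \<odot>\<^bsub>S\<^esub> s) b = pure s (k \<odot>\<^bsub>B\<^esub> b)"
proof -
  have "frag_of (k \<odot>\<^bsub>S\<^esub> s, b) - frag_of (s, k \<odot>\<^bsub>B\<^esub> b) \<in> tensor_relations K S B"
    unfolding tensor_relations_def using assms by blast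
  then show ?thesis by (simp add: tc_eq_iff relation_kernel)
qed

lemma pure_zero_right: "s \<in> carrier S \<Longrightarrow> pure s \<zero>\<^bsub>B\<^esub> = \<zero>\<^bsub>T\<^esub>"
  using pure_add_right[of s "\<zero>\<^bsub>B\<^esub>" "\<zero>\<^bsub>B\<^esub>"] by simp

lemma pure_uminus_left:
  assumes "s \<in> carrier S" "b \<in> carrier B"
  shows "pure (\<ominus>\<^bsub>S\<^esub> s) b = \<ominus>\<^bsub>T\<^esub> pure s b"
proof -
  have "pure \<zero>\<^bsub>S\<^esub> b = \<zero>\<^bsub>T\<^esub>"
    using pure_add_left[of "\<zero>\<^bsub>S\<^esub>" "\<zero>\<^bsub>S\<^esub>" b] assms by simp
  then have "pure (\<ominus>\<^bsub>S\<^esub> s) b \<oplus>\<^bsub>T\<^esub> pure s b = \<zero>\<^bsub>T\<^esub>"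
    using assms by (simp add: S.l_neg flip: pure_add_left)
  with assms show ?thesis using T.minus_equality[of "pure (\<ominus>\<^bsub>S\<^esub> s) b" "pure s b"] by simp
qed

text \<open>The free abelian group also has differences, which do not occur as a case here: the negative of
  \<open>s \<otimes> b\<close> is the pure tensor \<open>(- s) \<otimes> b\<close>. In the proof the property is therefore established for a
  tensor and its negative together.\<close>

lemma T_induct [consumes 1, case_names pure add]:
  assumes w: "w \<in> carrier T"
    and pure: "\<And>s b. s \<in> carrier S \<Longrightarrow> b \<in> carrier B \<Longrightarrow> P (pure s b)"
    and add: "\<And>v w. v \<in> carrier T \<Longrightarrow> w \<in> carrier T \<Longrightarrow> P v \<Longrightarrow> P w \<Longrightarrow> P (v \<oplus>\<^bsub>T\<^esub> w)"
  shows "P w"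
proof -
  obtain f where f: "supported f" "w = tc f" using w by (rule T_cases)
  from f(1) have "supported f \<and> P (tc f) \<and> P (\<ominus>\<^bsub>T\<^esub> tc f)"
    unfolding supported_def[of f]
  proof (induction f rule: frag_induction)
    case zero
    have "P (pure \<zero>\<^bsub>S\<^esub> \<zero>\<^bsub>B\<^esub>)" by (rule pure) auto
    then have "P \<zero>\<^bsub>T\<^esub>" by (simp add: pure_zero_right)
    then show ?case by (simp add: T_zero flip: tc_uminus)
  next
    case (one x)
    then obtain s b where x: "x = (s, b)" "s \<in> carrier S" "b \<in> carrier B" by auto
    then show ?case using pure[of s b] pure[of "\<ominus>\<^bsub>S\<^esub> s" b] by (simp add: pure_uminus_left)
  next
    case (diff f g)
    then have "supported f" "supported g" by (simp_all add: supported_def)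
    note diff = this diff
    have "\<ominus>\<^bsub>T\<^esub> tc (f - g) = \<ominus>\<^bsub>T\<^esub> tc f \<oplus>\<^bsub>T\<^esub> tc g"
      using diff by (simp add: tc_diff a_minus_def T.minus_add)
    moreover have "tc (f - g) = tc f \<oplus>\<^bsub>T\<^esub> \<ominus>\<^bsub>T\<^esub> tc g"
      using diff by (simp add: tc_diff a_minus_def)
    ultimately show ?case using diff add supported_diff[of f g, unfolded supported_def] by (simp add: supported_def)
  qed
  with f show ?thesis by simp
qed

text \<open>The three conditions on generators say that \<open>\<Phi>\<close> vanishes on the relations, hence on the subgroup
  that they generate.\<close>

lemma lift_respects:
  assumes H: "abelian_group H"
    and closed: "\<And>f. supported f \<Longrightarrow> \<Phi> f \<in> carrier H"
    and \<Phi>_add: "\<And>f g. supported f \<Longrightarrow> supported g \<Longrightarrow> \<Phi> (f + g) = \<Phi> f \<oplus>\<^bsub>H\<^esub> \<Phi> g"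
    and left: "\<And>s s' b. s \<in> carrier S \<Longrightarrow> s' \<in> carrier S \<Longrightarrow> b \<in> carrier B \<Longrightarrow>
      \<Phi> (frag_of (s \<oplus>\<^bsub>S\<^esub> s', b)) = \<Phi> (frag_of (s, b)) \<oplus>\<^bsub>H\<^esub> \<Phi> (frag_of (s', b))"
    and right: "\<And>s b b'. s \<in> carrier S \<Longrightarrow> b \<in> carrier B \<Longrightarrow> b' \<in> carrier B \<Longrightarrow>
      \<Phi> (frag_of (s, b \<oplus>\<^bsub>B\<^esub> b')) = \<Phi> (frag_of (s, b)) \<oplus>\<^bsub>H\<^esub> \<Phi> (frag_of (s, b'))"
    and balanced: "\<And>k s b. k \<in> carrier K \<Longrightarrow> s \<in> carrier S \<Longrightarrow> b \<in> carrier B \<Longrightarrow>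
      \<Phi> (frag_of (k \<odot>\<^bsub>S\<^esub> s, b)) = \<Phi> (frag_of (s, k \<odot>\<^bsub>B\<^esub> b))"
    and fg: "supported f" "supported g" "tc f = tc g"
  shows "\<Phi> f = \<Phi> g"
proof -
  interpret H: abelian_group H by fact
  have \<Phi>0: "\<Phi> 0 = \<zero>\<^bsub>H\<^esub>"
  proof -
    have "\<Phi> 0 \<oplus>\<^bsub>H\<^esub> \<Phi> 0 = \<Phi> 0" using \<Phi>_add[of 0 0] by simp
    then show ?thesis using closed[of 0] by simp
  qed
  have \<Phi>_uminus: "\<Phi> (- f) = \<ominus>\<^bsub>H\<^esub> \<Phi> f" if "supported f" for f
  proof -
    have "\<Phi> (- f) \<oplus>\<^bsub>H\<^esub> \<Phi> f = \<zero>\<^bsub>H\<^esub>" using \<Phi>_add[of "- f" f] that \<Phi>0 by simp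
    then show ?thesis using H.minus_equality[of "\<Phi> (- f)" "\<Phi> f"] closed that by simp
  qed
  have \<Phi>_diff: "\<Phi> (f - g) = \<Phi> f \<ominus>\<^bsub>H\<^esub> \<Phi> g" if "supported f" "supported g" for f g
    using \<Phi>_add[of f "- g"] that by (simp add: \<Phi>_uminus a_minus_def)
  have rel: "\<Phi> r = \<zero>\<^bsub>H\<^esub>" if "r \<in> tensor_relations K S B" for r
    using that unfolding tensor_relations_def
    by (auto simp: \<Phi>_diff \<Phi>_add left right balanced closed a_minus_def H.r_neg)
  have "\<Phi> n = \<zero>\<^bsub>H\<^esub>" if "n \<in> NSB" for n
    using that unfolding tensor_kernel_def
  proof (induction n rule: generate.induct)
    case (inv r)
    then show ?case
      using relations_supported[OF inv] rel[OF inv] \<Phi>_uminus[of r] by (simp add: supported_def)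
  next
    case (eng m n)
    then have "supported m" "supported n"
      using kernel_supported unfolding tensor_kernel_def by auto
    with eng show ?case by (simp add: \<Phi>_add)
  qed (simp_all add: \<Phi>0 rel)
  then have "\<Phi> (f - g) = \<zero>\<^bsub>H\<^esub>" using fg(3) by (simp add: tc_eq_iff)
  with fg closed show ?thesis by (simp add: \<Phi>_diff)
qed

text \<open>The operations on tensors are unions over all representatives; a union of equal sets is one of
  them.\<close>

lemma union_class:
  assumes "supported f" "\<And>g. supported g \<Longrightarrow> tc g = tc f \<Longrightarrow> \<Phi> g = \<Phi> f"
  shows "(\<Union>g\<in>tc f. \<Phi> g) = \<Phi> f"
proof -
  have "(\<Union>g\<in>tc f. \<Phi> g) = (\<Union>g\<in>tc f. \<Phi> f)"
    using assms(2) tc_mem_supported[OF _ assms(1)] tc_mem by (intro SUP_cong[OF refl]) blast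
  then show ?thesis using tc_mem[of f f] by auto
qed

lemma tensor_universal:
  assumes H: "abelian_group H"
    and closed: "\<And>s b. s \<in> carrier S \<Longrightarrow> b \<in> carrier B \<Longrightarrow> \<beta> s b \<in> carrier H"
    and left: "\<And>s s' b. s \<in> carrier S \<Longrightarrow> s' \<in> carrier S \<Longrightarrow> b \<in> carrier B \<Longrightarrow>
      \<beta> (s \<oplus>\<^bsub>S\<^esub> s') b = \<beta> s b \<oplus>\<^bsub>H\<^esub> \<beta> s' b"
    and right: "\<And>s b b'. s \<in> carrier S \<Longrightarrow> b \<in> carrier B \<Longrightarrow> b' \<in> carrier B \<Longrightarrow>
      \<beta> s (b \<oplus>\<^bsub>B\<^esub> b') = \<beta> s b \<oplus>\<^bsub>H\<^esub> \<beta> s b'"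
    and balanced: "\<And>k s b. k \<in> carrier K \<Longrightarrow> s \<in> carrier S \<Longrightarrow> b \<in> carrier B \<Longrightarrow>
      \<beta> (k \<odot>\<^bsub>S\<^esub> s) b = \<beta> s (k \<odot>\<^bsub>B\<^esub> b)"
  obtains h where "\<And>s b. s \<in> carrier S \<Longrightarrow> b \<in> carrier B \<Longrightarrow> h (pure s b) = \<beta> s b"
    "\<And>v w. v \<in> carrier T \<Longrightarrow> w \<in> carrier T \<Longrightarrow> h (v \<oplus>\<^bsub>T\<^esub> w) = h v \<oplus>\<^bsub>H\<^esub> h w"
proof -
  interpret H: abelian_group H by fact

  have "(\<lambda>(s, b). \<beta> s b) ` (carrier S \<times> carrier B) \<subseteq> carrier (add_monoid H)"
    using closed by auto
  then obtain \<Phi> where \<Phi>: "\<Phi> \<in> hom FSB (add_monoid H)"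
    and \<Phi>_of: "\<And>x. x \<in> carrier S \<times> carrier B \<Longrightarrow> \<Phi> (frag_of x) = (\<lambda>(s, b). \<beta> s b) x"
    using comm_group.free_Abelian_group_universal[OF H.a_comm_group] by blast
  have \<Phi>_closed: "\<Phi> f \<in> carrier H" if "supported f" for f
    using hom_in_carrier[OF \<Phi>, of f] that by (simp add: supported_def)
  have \<Phi>_add: "\<Phi> (f + g) = \<Phi> f \<oplus>\<^bsub>H\<^esub> \<Phi> g" if "supported f" "supported g" for f g
    using hom_mult[OF \<Phi>, of f g] that by (simp add: supported_def)
  have resp: "\<Phi> f = \<Phi> g" if "supported f" "supported g" "tc f = tc g" for f g
    by (rule lift_respects[OF H, where \<Phi> = \<Phi>])
      (simp_all add: that \<Phi>_closed \<Phi>_add \<Phi>_of left right balanced)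
  define h where "h w = \<Phi> (SOME f. supported f \<and> tc f = w)" for w
  have h: "h (tc f) = \<Phi> f" if f: "supported f" for f
  proof -
    have "supported (SOME g. supported g \<and> tc g = tc f) \<and> tc (SOME g. supported g \<and> tc g = tc f) = tc f"
      by (rule someI[of _ f]) (simp add: f)
    then show ?thesis unfolding h_def using f by (intro resp) simp_all
  qed
  show thesis
  proof (rule that)
    show "h (pure s b) = \<beta> s b" if "s \<in> carrier S" "b \<in> carrier B" for s b
      using that by (simp add: h \<Phi>_of)
    show "h (v \<oplus>\<^bsub>T\<^esub> w) = h v \<oplus>\<^bsub>H\<^esub> h w" if v: "v \<in> carrier T" and w: "w \<in> carrier T" for v w
    proof -
      obtain f g where fg: "supported f" "v = tc f" "supported g" "w = tc g"
        using T_cases[OF v] T_cases[OF w] by metis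
      then have "h (tc (f + g)) = \<Phi> f \<oplus>\<^bsub>H\<^esub> \<Phi> g" by (subst h) (simp_all add: \<Phi>_add)
      with fg show ?thesis by (simp add: h tc_add)
    qed
  qed
qed

end

section \<open>Tensor products of maps, modules and algebras\<close>

lemma frag_extend_plus: "frag_extend (\<lambda>x. g x + h x) f = frag_extend g f + frag_extend h f"
  by (simp add: frag_extend_def frag_cmul_distrib2 sum.distrib)

context tensor_modules
begin

lemma additive_agree:
  assumes H: "abelian_group H"
    and closed: "\<And>f. supported f \<Longrightarrow> \<Phi> f \<in> carrier H" "\<And>f. supported f \<Longrightarrow> \<Psi> f \<in> carrier H"
    and add: "\<And>f g. supported f \<Longrightarrow> supported g \<Longrightarrow> \<Phi> (f + g) = \<Phi> f \<oplus>\<^bsub>H\<^esub> \<Phi> g"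
      "\<And>f g. supported f \<Longrightarrow> supported g \<Longrightarrow> \<Psi> (f + g) = \<Psi> f \<oplus>\<^bsub>H\<^esub> \<Psi> g"
    and of: "\<And>s b. s \<in> carrier S \<Longrightarrow> b \<in> carrier B \<Longrightarrow> \<Phi> (frag_of (s, b)) = \<Psi> (frag_of (s, b))"
    and f: "supported f"
  shows "\<Phi> f = \<Psi> f"
proof -
  interpret H: abelian_group H by fact
  have zero: "\<Phi> 0 = \<zero>\<^bsub>H\<^esub>" "\<Psi> 0 = \<zero>\<^bsub>H\<^esub>"
    using add(1)[of 0 0] add(2)[of 0 0] closed(1)[of 0] closed(2)[of 0] by simp_all
  from f have "supported f \<and> \<Phi> f = \<Psi> f" unfolding supported_def[of f]
  proof (induction f rule: frag_induction)
    case (diff f g)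
    then have fg: "supported f" "supported g" "\<Phi> f = \<Psi> f" "\<Phi> g = \<Psi> g" by (auto simp: supported_def)
    have "\<Phi> (f - g) \<oplus>\<^bsub>H\<^esub> \<Phi> g = \<Phi> f" "\<Psi> (f - g) \<oplus>\<^bsub>H\<^esub> \<Psi> g = \<Psi> f"
      using add(1)[of "f - g" g] add(2)[of "f - g" g] fg by simp_all
    then have "\<Phi> (f - g) \<oplus>\<^bsub>H\<^esub> \<Psi> g = \<Psi> (f - g) \<oplus>\<^bsub>H\<^esub> \<Psi> g" using fg by simp
    then have "\<Phi> (f - g) = \<Psi> (f - g)" using fg closed by simp
    with supported_diff[OF fg(1,2)] show ?case by (simp add: supported_def)
  qed (use zero of in auto)
  then show ?thesis ..
qed

text \<open>The form in which tensor products of maps are shown to be well defined: \<open>g\<close> is the map on generators,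
  with values in the free group over \<open>S \<times> C\<close>.\<close>

lemma extend_class:
  assumes C: "module K C"
    and supp: "\<And>s b. s \<in> carrier S \<Longrightarrow> b \<in> carrier B \<Longrightarrow>
      tensor_modules.supported S C (g (s, b))"
    and left: "\<And>s s' b. s \<in> carrier S \<Longrightarrow> s' \<in> carrier S \<Longrightarrow> b \<in> carrier B \<Longrightarrow>
      tensor_class K S C (g (s \<oplus>\<^bsub>S\<^esub> s', b)) = tensor_class K S C (g (s, b)) \<oplus>\<^bsub>tensor K S C\<^esub> tensor_class K S C (g (s', b))"
    and right: "\<And>s b b'. s \<in> carrier S \<Longrightarrow> b \<in> carrier B \<Longrightarrow> b' \<in> carrier B \<Longrightarrow>
      tensor_class K S C (g (s, b \<oplus>\<^bsub>B\<^esub> b')) = tensor_class K S C (g (s, b)) \<oplus>\<^bsub>tensor K S C\<^esub> tensor_class K S C (g (s, b'))"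
    and balanced: "\<And>k s b. k \<in> carrier K \<Longrightarrow> s \<in> carrier S \<Longrightarrow> b \<in> carrier B \<Longrightarrow>
      tensor_class K S C (g (k \<odot>\<^bsub>S\<^esub> s, b)) = tensor_class K S C (g (s, k \<odot>\<^bsub>B\<^esub> b))"
    and f: "supported f"
  shows "(\<Union>f'\<in>tc f. tensor_class K S C (frag_extend g f')) = tensor_class K S C (frag_extend g f)"
proof -
  interpret C: tensor_modules K S C by (rule tensor_modules.intro[OF S_algebra C])
  have ext: "C.supported (frag_extend g f)" if "supported f" for f
    unfolding C.supported_def
    by (rule supported_extend[OF that]) (use supp in \<open>auto simp: C.supported_def\<close>)
  show ?thesis
  proof (rule union_class[OF f])
    fix f' assume f': "supported f'" "tc f' = tc f"
    show "C.tc (frag_extend g f') = C.tc (frag_extend g f)"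
      by (rule lift_respects[OF C.T_abelian, where \<Phi> = "\<lambda>f. C.tc (frag_extend g f)"])
        (simp_all add: f f' ext frag_extend_add C.tc_add left right balanced)
  qed
qed

lemma tensor_map_facts:
  assumes C: "module K C" and h: "h \<in> LinearCombinations.module_hom K S S"
    and k: "k \<in> LinearCombinations.module_hom K B C"
  shows tensor_map_closed: "w \<in> carrier T \<Longrightarrow> tensor_map K S B C h k w \<in> carrier (tensor K S C)"
    and tensor_map_add: "v \<in> carrier T \<Longrightarrow> w \<in> carrier T \<Longrightarrow>
      tensor_map K S B C h k (v \<oplus>\<^bsub>T\<^esub> w) = tensor_map K S B C h k v \<oplus>\<^bsub>tensor K S C\<^esub> tensor_map K S B C h k w"
    and tensor_map_pure: "s \<in> carrier S \<Longrightarrow> b \<in> carrier B \<Longrightarrow>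
      tensor_map K S B C h k (pure s b) = tensor_class K S C (frag_of (h s, k b))"
    and tensor_map_tc: "supported f \<Longrightarrow>
      tensor_map K S B C h k (tc f) = tensor_class K S C (frag_extend (\<lambda>(s, b). frag_of (h s, k b)) f)"
proof -
  interpret C: tensor_modules K S C by (rule tensor_modules.intro[OF S_algebra C])
  have hc: "h s \<in> carrier S" if "s \<in> carrier S" for s
    using module_hom_closed[OF h] that by auto
  have kc: "k b \<in> carrier C" if "b \<in> carrier B" for b
    using module_hom_closed[OF k] that by auto
  let ?g = "\<lambda>(s, b). frag_of (h s, k b)"
  have cls: "tensor_map K S B C h k (tc f) = C.tc (frag_extend ?g f)" if "supported f" for f
    unfolding tensor_map_def
    by (rule extend_class[OF C])
      (simp_all add: that hc kc module_hom_add[OF h] module_hom_add[OF k] module_hom_smult[OF h]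
        module_hom_smult[OF k] C.pure_add_left C.pure_add_right C.pure_balanced)
  have ext: "C.supported (frag_extend ?g f)" if "supported f" for f
    unfolding C.supported_def by (rule supported_extend[OF that]) (auto simp: hc kc)
  show "supported f \<Longrightarrow> tensor_map K S B C h k (tc f) = C.tc (frag_extend ?g f)" by (rule cls)
  show "tensor_map K S B C h k w \<in> carrier C.T" if "w \<in> carrier T"
    using that by (rule T_cases) (simp add: cls ext)
  show "tensor_map K S B C h k (v \<oplus>\<^bsub>T\<^esub> w) = tensor_map K S B C h k v \<oplus>\<^bsub>C.T\<^esub> tensor_map K S B C h k w"
    if v: "v \<in> carrier T" and w: "w \<in> carrier T"
  proof -
    obtain f g where fg: "supported f" "v = tc f" "supported g" "w = tc g"
      using T_cases[OF v] T_cases[OF w] by metis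
    then have "tensor_map K S B C h k (tc (f + g)) = C.tc (frag_extend ?g f) \<oplus>\<^bsub>C.T\<^esub> C.tc (frag_extend ?g g)"
      using cls[of "f + g"] by (simp add: frag_extend_add C.tc_add ext)
    with fg show ?thesis by (simp add: cls tc_add)
  qed
  show "tensor_map K S B C h k (pure s b) = C.pure (h s) (k b)" if "s \<in> carrier S" "b \<in> carrier B"
    using cls[of "frag_of (s, b)"] that by simp
qed

lemma smult_facts:
  assumes t: "t \<in> carrier S"
  shows T_smult_closed: "w \<in> carrier T \<Longrightarrow> t \<odot>\<^bsub>T\<^esub> w \<in> carrier T"
    and T_smult_add: "v \<in> carrier T \<Longrightarrow> w \<in> carrier T \<Longrightarrow>
      t \<odot>\<^bsub>T\<^esub> (v \<oplus>\<^bsub>T\<^esub> w) = t \<odot>\<^bsub>T\<^esub> v \<oplus>\<^bsub>T\<^esub> t \<odot>\<^bsub>T\<^esub> w"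
    and T_smult_pure: "s \<in> carrier S \<Longrightarrow> b \<in> carrier B \<Longrightarrow> t \<odot>\<^bsub>T\<^esub> pure s b = pure (t \<otimes>\<^bsub>S\<^esub> s) b"
proof -
  have S_smult: "t \<otimes>\<^bsub>S\<^esub> (k \<odot>\<^bsub>S\<^esub> s) = k \<odot>\<^bsub>S\<^esub> (t \<otimes>\<^bsub>S\<^esub> s)" if "k \<in> carrier K" "s \<in> carrier S" for k s
    using that t by (metis S.m_comm S.smult_assoc2 S.smult_closed)
  \<comment> \<open>Scaling by \<open>t\<close> is the tensor product of multiplication by \<open>t\<close> on \<open>S\<close> with the identity of \<open>B\<close>.\<close>
  have h: "(\<lambda>s. t \<otimes>\<^bsub>S\<^esub> s) \<in> LinearCombinations.module_hom K S S"
    unfolding LinearCombinations.module_hom_def using t S_smult by (simp add: Pi_iff S.r_distr)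
  have i: "(\<lambda>b. b) \<in> LinearCombinations.module_hom K B B"
    unfolding LinearCombinations.module_hom_def by simp
  have eq: "t \<odot>\<^bsub>T\<^esub> w = tensor_map K S B B (\<lambda>s. t \<otimes>\<^bsub>S\<^esub> s) (\<lambda>b. b) w" for w
    by (simp add: tensor_def tensor_map_def Let_def)
  note facts = tensor_map_facts[OF B_module h i]
  show "w \<in> carrier T \<Longrightarrow> t \<odot>\<^bsub>T\<^esub> w \<in> carrier T"
    unfolding eq by (rule facts)
  show "v \<in> carrier T \<Longrightarrow> w \<in> carrier T \<Longrightarrow>
      t \<odot>\<^bsub>T\<^esub> (v \<oplus>\<^bsub>T\<^esub> w) = t \<odot>\<^bsub>T\<^esub> v \<oplus>\<^bsub>T\<^esub> t \<odot>\<^bsub>T\<^esub> w"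
    unfolding eq by (rule facts)
  show "s \<in> carrier S \<Longrightarrow> b \<in> carrier B \<Longrightarrow> t \<odot>\<^bsub>T\<^esub> pure s b = pure (t \<otimes>\<^bsub>S\<^esub> s) b"
    unfolding eq by (rule facts)
qed

theorem tensor_module: "module S T"
proof (rule moduleI[OF S.M_cring T_abelian])
  fix a b w assume ab: "a \<in> carrier S" "b \<in> carrier S" and w: "w \<in> carrier T"
  show "(a \<oplus>\<^bsub>S\<^esub> b) \<odot>\<^bsub>T\<^esub> w = a \<odot>\<^bsub>T\<^esub> w \<oplus>\<^bsub>T\<^esub> b \<odot>\<^bsub>T\<^esub> w"
    using w ab
  proof (induction w rule: T_induct)
    case (add v w)
    then show ?case using ab by (simp add: T_smult_add T_smult_closed T.a_ac)
  qed (simp add: T_smult_pure S.l_distr pure_add_left)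
  show "(a \<otimes>\<^bsub>S\<^esub> b) \<odot>\<^bsub>T\<^esub> w = a \<odot>\<^bsub>T\<^esub> (b \<odot>\<^bsub>T\<^esub> w)"
    using w ab
    by (induction w rule: T_induct) (simp_all add: T_smult_pure S.m_assoc T_smult_add T_smult_closed)
next
  fix w assume "w \<in> carrier T"
  then show "\<one>\<^bsub>S\<^esub> \<odot>\<^bsub>T\<^esub> w = w"
    by (induction w rule: T_induct) (simp_all add: T_smult_pure T_smult_add)
qed (simp_all add: T_smult_closed T_smult_add)

lemma tensor_map_semilinear:
  assumes C: "module K C" and h: "h \<in> LinearCombinations.module_hom K S S"
    and k: "k \<in> LinearCombinations.module_hom K B C"
    and hm: "\<And>s t. s \<in> carrier S \<Longrightarrow> t \<in> carrier S \<Longrightarrow> h (t \<otimes>\<^bsub>S\<^esub> s) = h' t \<otimes>\<^bsub>S\<^esub> h s"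
      "h' t \<in> carrier S" and t: "t \<in> carrier S" and w: "w \<in> carrier T"
  shows "tensor_map K S B C h k (t \<odot>\<^bsub>T\<^esub> w) = h' t \<odot>\<^bsub>tensor K S C\<^esub> tensor_map K S B C h k w"
proof -
  interpret C: tensor_modules K S C by (rule tensor_modules.intro[OF S_algebra C])
  have hc: "h s \<in> carrier S" if "s \<in> carrier S" for s
    using module_hom_closed[OF h] that by auto
  have kc: "k b \<in> carrier C" if "b \<in> carrier B" for b
    using module_hom_closed[OF k] that by auto
  note facts = tensor_map_facts[OF C h k]
  show ?thesis using w
    by (induction w rule: T_induct)
      (simp_all add: t hm hc kc facts T_smult_pure T_smult_add T_smult_closed C.T_smult_pure C.T_smult_add)
qed

end

locale tensor_algebras = tensor_modules +
  assumes B_algebra: "algebra K B"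

sublocale tensor_algebras \<subseteq> B: algebra K B by (rule B_algebra)

context tensor_algebras
begin

definition prod_frag
  where "prod_frag f f' = frag_extend (\<lambda>(s, b). frag_extend (\<lambda>(s', b'). frag_of (s \<otimes>\<^bsub>S\<^esub> s', b \<otimes>\<^bsub>B\<^esub> b')) f') f"

lemma prod_frag_add_left: "prod_frag (f + g) h = prod_frag f h + prod_frag g h"
  by (simp add: prod_frag_def frag_extend_add)

lemma prod_frag_add_right: "prod_frag h (f + g) = prod_frag h f + prod_frag h g"
  by (simp add: prod_frag_def frag_extend_add case_prod_unfold frag_extend_plus)

lemma prod_frag_of: "prod_frag (frag_of (s, b)) (frag_of (s', b')) = frag_of (s \<otimes>\<^bsub>S\<^esub> s', b \<otimes>\<^bsub>B\<^esub> b')"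
  by (simp add: prod_frag_def)

lemma prod_frag_supported [simp]:
  assumes "supported f" "supported g"
  shows "supported (prod_frag f g)"
proof -
  have "Poly_Mapping.keys (frag_extend (\<lambda>(s', b'). frag_of (s \<otimes>\<^bsub>S\<^esub> s', b \<otimes>\<^bsub>B\<^esub> b')) g) \<subseteq> carrier S \<times> carrier B"
    if "s \<in> carrier S" "b \<in> carrier B" for s b
    by (rule supported_extend[OF assms(2)]) (use that in auto)
  then have "Poly_Mapping.keys (prod_frag f g) \<subseteq> carrier S \<times> carrier B"
    unfolding prod_frag_def by (intro supported_extend[OF assms(1)]) simp
  then show ?thesis by (simp add: supported_def)
qed

text \<open>Commutativity is shown first, because it reduces independence of the representative of the left
  factor to that of the right one.\<close>

lemma prod_frag_commute:
  assumes f: "supported f" and g: "supported g"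
  shows "tc (prod_frag f g) = tc (prod_frag g f)"
proof (rule additive_agree[OF T_abelian, where \<Phi> = "\<lambda>f. tc (prod_frag f g)" and \<Psi> = "\<lambda>f. tc (prod_frag g f)"])
  fix s b assume sb: "s \<in> carrier S" "b \<in> carrier B"
  show "tc (prod_frag (frag_of (s, b)) g) = tc (prod_frag g (frag_of (s, b)))"
    by (rule additive_agree[OF T_abelian, where \<Phi> = "\<lambda>g. tc (prod_frag (frag_of (s, b)) g)"
          and \<Psi> = "\<lambda>g. tc (prod_frag g (frag_of (s, b)))"])
      (simp_all add: sb g prod_frag_add_left prod_frag_add_right tc_add prod_frag_of S.m_comm B.m_comm)
qed (simp_all add: f g prod_frag_add_left prod_frag_add_right tc_add)

lemma prod_frag_respects:
  assumes f: "supported f" and g: "supported g" "supported g'" "tc g = tc g'"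
  shows "tc (prod_frag f g) = tc (prod_frag f g')"
proof (rule lift_respects[OF T_abelian, where \<Phi> = "\<lambda>g. tc (prod_frag f g)"])
  fix s s' b assume *: "s \<in> carrier S" "s' \<in> carrier S" "b \<in> carrier B"
  show "tc (prod_frag f (frag_of (s \<oplus>\<^bsub>S\<^esub> s', b))) =
      tc (prod_frag f (frag_of (s, b))) \<oplus>\<^bsub>T\<^esub> tc (prod_frag f (frag_of (s', b)))"
    by (rule additive_agree[OF T_abelian, where \<Phi> = "\<lambda>f. tc (prod_frag f (frag_of (s \<oplus>\<^bsub>S\<^esub> s', b)))"
          and \<Psi> = "\<lambda>f. tc (prod_frag f (frag_of (s, b))) \<oplus>\<^bsub>T\<^esub> tc (prod_frag f (frag_of (s', b)))"])
      (simp_all add: * f prod_frag_add_left tc_add prod_frag_of T.a_ac S.r_distr pure_add_left)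
next
  fix s b b' assume *: "s \<in> carrier S" "b \<in> carrier B" "b' \<in> carrier B"
  show "tc (prod_frag f (frag_of (s, b \<oplus>\<^bsub>B\<^esub> b'))) =
      tc (prod_frag f (frag_of (s, b))) \<oplus>\<^bsub>T\<^esub> tc (prod_frag f (frag_of (s, b')))"
    by (rule additive_agree[OF T_abelian, where \<Phi> = "\<lambda>f. tc (prod_frag f (frag_of (s, b \<oplus>\<^bsub>B\<^esub> b')))"
          and \<Psi> = "\<lambda>f. tc (prod_frag f (frag_of (s, b))) \<oplus>\<^bsub>T\<^esub> tc (prod_frag f (frag_of (s, b')))"])
      (simp_all add: * f prod_frag_add_left tc_add prod_frag_of T.a_ac B.r_distr pure_add_right)
next
  fix k s b assume *: "k \<in> carrier K" "s \<in> carrier S" "b \<in> carrier B"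
  have scale: "s' \<otimes>\<^bsub>S\<^esub> (k \<odot>\<^bsub>S\<^esub> s) = k \<odot>\<^bsub>S\<^esub> (s' \<otimes>\<^bsub>S\<^esub> s)" "b' \<otimes>\<^bsub>B\<^esub> (k \<odot>\<^bsub>B\<^esub> b) = k \<odot>\<^bsub>B\<^esub> (b' \<otimes>\<^bsub>B\<^esub> b)"
    if "s' \<in> carrier S" "b' \<in> carrier B" for s' b'
    using that * S.m_comm S.smult_assoc2[of k s s'] S.smult_closed B.m_comm B.smult_assoc2[of k b b'] B.smult_closed
    by simp_all
  show "tc (prod_frag f (frag_of (k \<odot>\<^bsub>S\<^esub> s, b))) = tc (prod_frag f (frag_of (s, k \<odot>\<^bsub>B\<^esub> b)))"
    by (rule additive_agree[OF T_abelian, where \<Phi> = "\<lambda>f. tc (prod_frag f (frag_of (k \<odot>\<^bsub>S\<^esub> s, b)))"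
          and \<Psi> = "\<lambda>f. tc (prod_frag f (frag_of (s, k \<odot>\<^bsub>B\<^esub> b)))"])
      (simp_all add: * f prod_frag_add_left tc_add prod_frag_of scale pure_balanced)
qed (simp_all add: f g prod_frag_add_right tc_add)

lemma tc_mult:
  assumes f: "supported f" and g: "supported g"
  shows "tc f \<otimes>\<^bsub>T\<^esub> tc g = tc (prod_frag f g)"
proof -
  have "(\<Union>g'\<in>tc g. tc (prod_frag f' g')) = tc (prod_frag f' g)" if f': "supported f'" for f'
    by (rule union_class[OF g, where \<Phi> = "\<lambda>g. tc (prod_frag f' g)"]) (rule prod_frag_respects[OF f' _ g])
  then have "(\<Union>f'\<in>tc f. \<Union>g'\<in>tc g. tc (prod_frag f' g')) = (\<Union>f'\<in>tc f. tc (prod_frag f' g))"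
    using tc_mem_supported[OF _ f] by (intro SUP_cong[OF refl]) blast
  also have "\<dots> = tc (prod_frag f g)"
  proof (rule union_class[OF f, where \<Phi> = "\<lambda>f. tc (prod_frag f g)"])
    fix f' assume f': "supported f'" "tc f' = tc f"
    show "tc (prod_frag f' g) = tc (prod_frag f g)"
      unfolding prod_frag_commute[OF f'(1) g] prod_frag_commute[OF f g]
      by (rule prod_frag_respects[OF g f'(1) f f'(2)])
  qed
  finally show ?thesis by (simp add: tensor_def Let_def prod_frag_def)
qed

lemma T_one: "\<one>\<^bsub>T\<^esub> = pure \<one>\<^bsub>S\<^esub> \<one>\<^bsub>B\<^esub>"
  by (simp add: tensor_def Let_def)

lemma T_mult_pure:
  assumes "s \<in> carrier S" "s' \<in> carrier S" "b \<in> carrier B" "b' \<in> carrier B"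
  shows "pure s b \<otimes>\<^bsub>T\<^esub> pure s' b' = pure (s \<otimes>\<^bsub>S\<^esub> s') (b \<otimes>\<^bsub>B\<^esub> b')"
  using assms by (simp add: tc_mult prod_frag_of)

lemma T_mult_closed: "v \<in> carrier T \<Longrightarrow> w \<in> carrier T \<Longrightarrow> v \<otimes>\<^bsub>T\<^esub> w \<in> carrier T"
  by (erule T_cases, erule T_cases) (simp add: tc_mult)

lemma T_mult_comm: "v \<in> carrier T \<Longrightarrow> w \<in> carrier T \<Longrightarrow> v \<otimes>\<^bsub>T\<^esub> w = w \<otimes>\<^bsub>T\<^esub> v"
  by (erule T_cases, erule T_cases) (simp add: tc_mult prod_frag_commute)

lemma T_mult_add_left:
  assumes u: "u \<in> carrier T" and v: "v \<in> carrier T" and w: "w \<in> carrier T"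
  shows "(u \<oplus>\<^bsub>T\<^esub> v) \<otimes>\<^bsub>T\<^esub> w = u \<otimes>\<^bsub>T\<^esub> w \<oplus>\<^bsub>T\<^esub> v \<otimes>\<^bsub>T\<^esub> w"
proof -
  obtain f g h where *: "supported f" "u = tc f" "supported g" "v = tc g" "supported h" "w = tc h"
    using T_cases[OF u] T_cases[OF v] T_cases[OF w] by metis
  then show ?thesis by (simp add: tc_mult prod_frag_add_left flip: tc_add)
qed

lemma T_mult_add_right:
  "\<lbrakk>u \<in> carrier T; v \<in> carrier T; w \<in> carrier T\<rbrakk> \<Longrightarrow>
   w \<otimes>\<^bsub>T\<^esub> (u \<oplus>\<^bsub>T\<^esub> v) = w \<otimes>\<^bsub>T\<^esub> u \<oplus>\<^bsub>T\<^esub> w \<otimes>\<^bsub>T\<^esub> v"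
  by (simp add: T_mult_comm[of w] T_mult_add_left)

lemma T_mult_assoc:
  assumes u: "u \<in> carrier T" and v: "v \<in> carrier T" and w: "w \<in> carrier T"
  shows "(u \<otimes>\<^bsub>T\<^esub> v) \<otimes>\<^bsub>T\<^esub> w = u \<otimes>\<^bsub>T\<^esub> (v \<otimes>\<^bsub>T\<^esub> w)"
  using u
proof (induction u rule: T_induct)
  case (pure s b)
  note sb = this
  from v show ?case
  proof (induction v rule: T_induct)
    case (pure s' b')
    from w show ?case
      by (induction w rule: T_induct)
        (simp_all add: sb pure T_mult_pure S.m_assoc B.m_assoc T_mult_add_right T_mult_closed)
  qed (simp add: sb w T_mult_add_left T_mult_add_right T_mult_closed)
qed (simp add: v w T_mult_add_left T_mult_closed)

theorem tensor_cring: "cring T"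
proof (rule cringI[OF T_abelian])
  show "comm_monoid T"
  proof (rule comm_monoidI)
    fix w assume "w \<in> carrier T"
    then show "\<one>\<^bsub>T\<^esub> \<otimes>\<^bsub>T\<^esub> w = w"
      unfolding T_one
      by (induction w rule: T_induct) (simp_all add: T_mult_pure T_mult_add_right)
  qed (fact T_mult_closed T_mult_comm T_mult_assoc | simp add: T_one)+
qed (simp add: T_mult_add_left)

theorem tensor_algebra: "algebra S T"
proof -
  interpret T: module S T by (rule tensor_module)
  have assoc: "(a \<odot>\<^bsub>T\<^esub> v) \<otimes>\<^bsub>T\<^esub> w = a \<odot>\<^bsub>T\<^esub> (v \<otimes>\<^bsub>T\<^esub> w)"
    if a: "a \<in> carrier S" and v: "v \<in> carrier T" and w: "w \<in> carrier T" for a v w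
    using v
  proof (induction v rule: T_induct)
    case (pure s b)
    from w show ?case
      by (induction w rule: T_induct)
        (simp_all add: a pure T_mult_pure T_smult_pure S.m_assoc T_mult_add_right T_smult_add T_mult_closed)
  qed (simp add: a w T_mult_add_left T_smult_add T_mult_closed T_smult_closed)
  show ?thesis
    by (rule algebraI[OF S.M_cring tensor_cring])
      (fact T.smult_closed T.smult_l_distr T.smult_r_distr T.smult_assoc1 T.smult_one assoc)+
qed

lemma tensor_map_ring_hom:
  assumes C: "algebra K C" and h: "h \<in> algebra_hom K S S" and k: "k \<in> algebra_hom K B C"
  shows "tensor_map K S B C h k \<in> ring_hom T (tensor K S C)"
proof -
  interpret C: tensor_algebras K S C
    by (intro tensor_algebras.intro tensor_modules.intro tensor_algebras_axioms.intro
        S_algebra C algebra.module[OF C])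
  have h': "h \<in> LinearCombinations.module_hom K S S" "h \<in> ring_hom S S"
    and k': "k \<in> LinearCombinations.module_hom K B C" "k \<in> ring_hom B C"
    using h k by (auto simp: algebra_hom_def)
  note facts = tensor_map_facts[OF C.B_module h'(1) k'(1)]
  note hk = ring_hom_closed[OF h'(2)] ring_hom_closed[OF k'(2)]
  show ?thesis
  proof (rule ring_hom_memI)
    fix v w assume v: "v \<in> carrier T" and w: "w \<in> carrier T"
    show "tensor_map K S B C h k (v \<otimes>\<^bsub>T\<^esub> w)
        = tensor_map K S B C h k v \<otimes>\<^bsub>C.T\<^esub> tensor_map K S B C h k w"
      using v
    proof (induction v rule: T_induct)
      case (pure s b)
      from w show ?case
        by (induction w rule: T_induct)
          (simp_all add: pure facts hk T_mult_pure C.T_mult_pure T_mult_add_right C.T_mult_add_right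
            T_mult_closed ring_hom_mult[OF h'(2)] ring_hom_mult[OF k'(2)])
    qed (simp add: w facts T_mult_add_left C.T_mult_add_left T_mult_closed)
  next
    show "tensor_map K S B C h k \<one>\<^bsub>T\<^esub> = \<one>\<^bsub>C.T\<^esub>"
      by (simp add: T_one C.T_one facts ring_hom_one[OF h'(2)] ring_hom_one[OF k'(2)])
  qed (simp_all add: facts)
qed

end

section \<open>The grading of a tensor product\<close>

locale tensor_graded = tensor_algebras K S B
  for K :: "('k, 'x) ring_scheme" and S :: "('k, 's, 'y) module_scheme"
    and B :: "('k, 'b, 'z) module_scheme" +
  fixes gr :: "nat \<Rightarrow> 'b set" and \<pi> :: "nat \<Rightarrow> 'b \<Rightarrow> 'b"
  assumes gr_submodule: "\<And>d. Module.submodule (gr d) K B"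
    and \<pi>_hom: "\<And>d. \<pi> d \<in> LinearCombinations.module_hom K B B"
    and \<pi>_gr: "\<And>d b. b \<in> carrier B \<Longrightarrow> \<pi> d b \<in> gr d"
    and \<pi>_own: "\<And>d e b. b \<in> gr d \<Longrightarrow> \<pi> e b = (if e = d then b else \<zero>\<^bsub>B\<^esub>)"
    and \<pi>_sum: "\<And>b. b \<in> carrier B \<Longrightarrow> \<exists>n. \<forall>N\<ge>n. b = (\<Oplus>\<^bsub>B\<^esub>d\<in>{..<N}. \<pi> d b)"
    and gr_one: "\<one>\<^bsub>B\<^esub> \<in> gr 0"
    and gr_mult: "\<And>d e b c. b \<in> gr d \<Longrightarrow> c \<in> gr e \<Longrightarrow> b \<otimes>\<^bsub>B\<^esub> c \<in> gr (d + e)"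

context tensor_modules
begin

lemma id_hom: "(\<lambda>s. s) \<in> LinearCombinations.module_hom K S S"
  unfolding LinearCombinations.module_hom_def by simp

lemma pure_finsum:
  assumes "s \<in> carrier S" "finite I" "c \<in> I \<rightarrow> carrier B"
  shows "pure s (\<Oplus>\<^bsub>B\<^esub>i\<in>I. c i) = (\<Oplus>\<^bsub>T\<^esub>i\<in>I. pure s (c i))"
  using assms(2,3)
proof (induction I rule: finite_induct)
  case empty
  then show ?case using assms(1) by (simp add: pure_zero_right)
next
  case (insert i I)
  have "c \<in> I \<rightarrow> carrier B" "c i \<in> carrier B" using insert by auto
  moreover from this have "(\<lambda>i. pure s (c i)) \<in> I \<rightarrow> carrier T" using assms(1) by auto
  ultimately show ?case using insert assms(1) by (simp add: pure_add_right)
qed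

end

context tensor_graded
begin

abbreviation "proj d \<equiv> tensor_map K S B B (\<lambda>s. s) (\<pi> d)"
abbreviation "tgr d \<equiv> tensor_grade K S B gr d"

lemmas proj_facts = tensor_map_facts[OF B_module id_hom \<pi>_hom]

lemma gr_carrier: "b \<in> gr d \<Longrightarrow> b \<in> carrier B"
  using B.submoduleE(1)[OF gr_submodule] by blast

lemma \<pi>_closed [simp]: "b \<in> carrier B \<Longrightarrow> \<pi> d b \<in> carrier B"
  by (rule gr_carrier[OF \<pi>_gr])

text \<open>This trades representatives supported on \<open>S \<times> gr d\<close> for the fixed elements of an additive map, which
  are easily seen to be closed under the operations.\<close>

lemma tgr_iff: "w \<in> tgr d \<longleftrightarrow> w \<in> carrier T \<and> proj d w = w"
proof
  assume "w \<in> tgr d"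
  then obtain f where f: "Poly_Mapping.keys f \<subseteq> carrier S \<times> gr d" "w = tc f"
    unfolding tensor_grade_def by auto
  have "carrier S \<times> gr d \<subseteq> carrier S \<times> carrier B" using gr_carrier[of _ d] by auto
  with f(1) have supp: "supported f" unfolding supported_def by (rule subset_trans)
  have "frag_extend (\<lambda>(s, b). frag_of (s, \<pi> d b)) f = frag_extend frag_of f"
    using f(1) by (intro frag_extend_eq) (auto simp: \<pi>_own)
  then have "frag_extend (\<lambda>(s, b). frag_of (s, \<pi> d b)) f = f" using frag_expansion[of f] by simp
  with supp f(2) show "w \<in> carrier T \<and> proj d w = w" by (simp add: proj_facts)
next
  assume w: "w \<in> carrier T \<and> proj d w = w"
  then obtain f where f: "supported f" "w = tc f" using T_cases by blast
  have "proj d w = tc (frag_extend (\<lambda>(s, b). frag_of (s, \<pi> d b)) f)"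
    using f by (simp add: proj_facts)
  moreover have "Poly_Mapping.keys (frag_extend (\<lambda>(s, b). frag_of (s, \<pi> d b)) f) \<subseteq> carrier S \<times> gr d"
    by (rule supported_extend[OF f(1)]) (auto simp: \<pi>_gr)
  ultimately show "w \<in> tgr d" using w unfolding tensor_grade_def by auto
qed

lemma proj_zero: "proj d \<zero>\<^bsub>T\<^esub> = \<zero>\<^bsub>T\<^esub>"
  using proj_facts(2)[of "\<zero>\<^bsub>T\<^esub>" "\<zero>\<^bsub>T\<^esub>" d] proj_facts(1)[of "\<zero>\<^bsub>T\<^esub>" d] by simp

lemma proj_proj: "w \<in> carrier T \<Longrightarrow> proj e (proj d w) = (if e = d then proj d w else \<zero>\<^bsub>T\<^esub>)"
proof (induction w rule: T_induct)
  case (pure s b)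
  then show ?case by (simp add: proj_facts \<pi>_own[OF \<pi>_gr] pure_zero_right)
qed (simp add: proj_facts)

lemma proj_own: "w \<in> tgr d \<Longrightarrow> proj e w = (if e = d then w else \<zero>\<^bsub>T\<^esub>)"
  using proj_proj[of w e d] by (simp add: tgr_iff)

lemma proj_smult:
  assumes "t \<in> carrier S" "w \<in> carrier T"
  shows "proj d (t \<odot>\<^bsub>T\<^esub> w) = t \<odot>\<^bsub>T\<^esub> proj d w"
  using tensor_map_semilinear[OF B_module id_hom \<pi>_hom, where h' = "\<lambda>s. s"] assms by simp

lemma proj_sum:
  assumes "w \<in> carrier T"
  shows "\<exists>n. \<forall>N\<ge>n. w = (\<Oplus>\<^bsub>T\<^esub>d\<in>{..<N}. proj d w)"
  using assms
proof (induction w rule: T_induct)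
  case (pure s b)
  obtain n where n: "\<forall>N\<ge>n. b = (\<Oplus>\<^bsub>B\<^esub>d\<in>{..<N}. \<pi> d b)" using \<pi>_sum[OF pure(2)] by blast
  have "pure s b = (\<Oplus>\<^bsub>T\<^esub>d\<in>{..<N}. proj d (pure s b))" if "N \<ge> n" for N
  proof -
    have "pure s b = pure s (\<Oplus>\<^bsub>B\<^esub>d\<in>{..<N}. \<pi> d b)"
      using n that by (intro arg_cong[of b _ "pure s"]) blast
    also have "\<dots> = (\<Oplus>\<^bsub>T\<^esub>d\<in>{..<N}. pure s (\<pi> d b))"
      using pure by (intro pure_finsum) auto
    also have "\<dots> = (\<Oplus>\<^bsub>T\<^esub>d\<in>{..<N}. proj d (pure s b))" using pure by (simp add: proj_facts)
    finally show ?thesis .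
  qed
  then show ?case by blast
next
  case (add v w)
  then obtain m n where m: "\<forall>N\<ge>m. v = (\<Oplus>\<^bsub>T\<^esub>d\<in>{..<N}. proj d v)"
    and n: "\<forall>N\<ge>n. w = (\<Oplus>\<^bsub>T\<^esub>d\<in>{..<N}. proj d w)" by blast
  have "v \<oplus>\<^bsub>T\<^esub> w = (\<Oplus>\<^bsub>T\<^esub>d\<in>{..<N}. proj d (v \<oplus>\<^bsub>T\<^esub> w))" if "N \<ge> max m n" for N
  proof -
    have "(\<Oplus>\<^bsub>T\<^esub>d\<in>{..<N}. proj d (v \<oplus>\<^bsub>T\<^esub> w))
        = (\<Oplus>\<^bsub>T\<^esub>d\<in>{..<N}. proj d v \<oplus>\<^bsub>T\<^esub> proj d w)"
      using add by (simp add: proj_facts)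
    also have "\<dots> = (\<Oplus>\<^bsub>T\<^esub>d\<in>{..<N}. proj d v) \<oplus>\<^bsub>T\<^esub> (\<Oplus>\<^bsub>T\<^esub>d\<in>{..<N}. proj d w)"
      using add by (intro T.finsum_addf) (auto simp: proj_facts)
    also have "\<dots> = v \<oplus>\<^bsub>T\<^esub> w" using m[rule_format, of N] n[rule_format, of N] that by simp
    finally show ?thesis by (rule sym)
  qed
  then show ?case by blast
qed

lemma tgr_one: "\<one>\<^bsub>T\<^esub> \<in> tgr 0"
  by (simp add: tgr_iff T_one proj_facts \<pi>_own[OF gr_one])

lemma tgr_mult:
  assumes v: "v \<in> tgr d" and w: "w \<in> tgr e"
  shows "v \<otimes>\<^bsub>T\<^esub> w \<in> tgr (d + e)"
proof -
  \<comment> \<open>Stated for projections of arbitrary tensors, so that induction over pure tensors applies.\<close>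
  have "proj (d + e) (proj d v \<otimes>\<^bsub>T\<^esub> proj e w) = proj d v \<otimes>\<^bsub>T\<^esub> proj e w"
    if v: "v \<in> carrier T" and w: "w \<in> carrier T" for v w
    using v
  proof (induction v rule: T_induct)
    case (pure s b)
    note sb = this
    from w show ?case
    proof (induction w rule: T_induct)
      case (pure s' b')
      have "\<pi> (d + e) (\<pi> d b \<otimes>\<^bsub>B\<^esub> \<pi> e b') = \<pi> d b \<otimes>\<^bsub>B\<^esub> \<pi> e b'"
        using \<pi>_own[OF gr_mult[OF \<pi>_gr \<pi>_gr]] sb pure by simp
      then show ?case using sb pure by (simp add: proj_facts T_mult_pure)
    qed (simp add: sb proj_facts T_mult_add_right T_mult_closed)
  qed (simp add: w proj_facts T_mult_add_left T_mult_closed)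
  from this[of v w] v w show ?thesis by (simp add: tgr_iff T_mult_closed)
qed

end

section \<open>Fixed elements\<close>

lemma fixed_part_simps [simp]:
  "carrier (fixed_part G A \<phi>) = fixed_set G (carrier A) \<phi>"
  "\<zero>\<^bsub>fixed_part G A \<phi>\<^esub> = \<zero>\<^bsub>A\<^esub>" "\<one>\<^bsub>fixed_part G A \<phi>\<^esub> = \<one>\<^bsub>A\<^esub>"
  "x \<oplus>\<^bsub>fixed_part G A \<phi>\<^esub> y = x \<oplus>\<^bsub>A\<^esub> y" "x \<otimes>\<^bsub>fixed_part G A \<phi>\<^esub> y = x \<otimes>\<^bsub>A\<^esub> y"
  "r \<odot>\<^bsub>fixed_part G A \<phi>\<^esub> x = r \<odot>\<^bsub>A\<^esub> x"
  by (simp_all add: fixed_part_def)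

lemma fixed_part_abelian_group:
  assumes "abelian_group A"
    and closed: "\<And>g x. g \<in> carrier G \<Longrightarrow> x \<in> carrier A \<Longrightarrow> \<phi> g x \<in> carrier A"
    and add: "\<And>g x y. g \<in> carrier G \<Longrightarrow> x \<in> carrier A \<Longrightarrow> y \<in> carrier A \<Longrightarrow>
      \<phi> g (x \<oplus>\<^bsub>A\<^esub> y) = \<phi> g x \<oplus>\<^bsub>A\<^esub> \<phi> g y"
  shows "abelian_group (fixed_part G A \<phi>)"
proof -
  interpret A: abelian_group A by fact
  have zero: "\<phi> g \<zero>\<^bsub>A\<^esub> = \<zero>\<^bsub>A\<^esub>" if "g \<in> carrier G" for g
    using add[OF that, of "\<zero>\<^bsub>A\<^esub>" "\<zero>\<^bsub>A\<^esub>"] closed[OF that, of "\<zero>\<^bsub>A\<^esub>"] by simp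
  have uminus: "\<phi> g (\<ominus>\<^bsub>A\<^esub> x) = \<ominus>\<^bsub>A\<^esub> \<phi> g x" if g: "g \<in> carrier G" and x: "x \<in> carrier A" for g x
  proof -
    have "\<phi> g (\<ominus>\<^bsub>A\<^esub> x) \<oplus>\<^bsub>A\<^esub> \<phi> g x = \<zero>\<^bsub>A\<^esub>"
      using add[OF g, of "\<ominus>\<^bsub>A\<^esub> x" x] x by (simp add: A.l_neg zero g)
    then show ?thesis using A.minus_equality closed g x by simp
  qed
  show ?thesis
  proof (rule abelian_groupI)
    fix x assume "x \<in> carrier (fixed_part G A \<phi>)"
    then show "\<exists>y\<in>carrier (fixed_part G A \<phi>). y \<oplus>\<^bsub>fixed_part G A \<phi>\<^esub> x = \<zero>\<^bsub>fixed_part G A \<phi>\<^esub>"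
      by (intro bexI[of _ "\<ominus>\<^bsub>A\<^esub> x"]) (auto simp: fixed_set_def uminus A.l_neg)
  next
    fix x y assume "x \<in> carrier (fixed_part G A \<phi>)" "y \<in> carrier (fixed_part G A \<phi>)"
    then show "x \<oplus>\<^bsub>fixed_part G A \<phi>\<^esub> y = y \<oplus>\<^bsub>fixed_part G A \<phi>\<^esub> x"
      by (simp add: fixed_set_def A.a_comm)
  qed (auto simp: fixed_set_def zero add A.a_assoc)
qed

lemma fixed_part_cring:
  assumes "cring A" and hom: "\<And>g. g \<in> carrier G \<Longrightarrow> \<phi> g \<in> ring_hom A A"
  shows "cring (fixed_part G A \<phi>)"
proof -
  interpret A: cring A by fact
  note h = ring_hom_closed[OF hom] ring_hom_add[OF hom] ring_hom_mult[OF hom] ring_hom_one[OF hom]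
  show ?thesis
  proof (rule cringI)
    show "abelian_group (fixed_part G A \<phi>)"
      by (rule fixed_part_abelian_group) (simp_all add: A.is_abelian_group h)
    show "comm_monoid (fixed_part G A \<phi>)"
    proof (rule comm_monoidI)
      fix x y assume "x \<in> carrier (fixed_part G A \<phi>)" "y \<in> carrier (fixed_part G A \<phi>)"
      then show "x \<otimes>\<^bsub>fixed_part G A \<phi>\<^esub> y = y \<otimes>\<^bsub>fixed_part G A \<phi>\<^esub> x"
        by (simp add: fixed_set_def A.m_comm)
    qed (auto simp: fixed_set_def h A.m_assoc)
  qed (auto simp: fixed_set_def A.l_distr)
qed

text \<open>The action is only semilinear over \<open>S\<close>; it becomes linear over the scalars fixed by \<open>\<beta>\<close>, which
  therefore preserve the fixed elements.\<close>

lemma fixed_part_module: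
  assumes T: "module S T" and \<beta>: "\<And>g. g \<in> carrier G \<Longrightarrow> \<beta> g \<in> ring_hom S S"
    and closed: "\<And>g x. g \<in> carrier G \<Longrightarrow> x \<in> carrier T \<Longrightarrow> \<phi> g x \<in> carrier T"
    and add: "\<And>g x y. g \<in> carrier G \<Longrightarrow> x \<in> carrier T \<Longrightarrow> y \<in> carrier T \<Longrightarrow>
      \<phi> g (x \<oplus>\<^bsub>T\<^esub> y) = \<phi> g x \<oplus>\<^bsub>T\<^esub> \<phi> g y"
    and smult: "\<And>g s x. g \<in> carrier G \<Longrightarrow> s \<in> carrier S \<Longrightarrow> x \<in> carrier T \<Longrightarrow>
      \<phi> g (s \<odot>\<^bsub>T\<^esub> x) = \<beta> g s \<odot>\<^bsub>T\<^esub> \<phi> g x"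
  shows "module (fixed_part G S \<beta>) (fixed_part G T \<phi>)"
proof -
  interpret T: module S T by fact
  show ?thesis
  proof (rule moduleI)
    show "cring (fixed_part G S \<beta>)" by (rule fixed_part_cring[OF T.is_cring \<beta>])
    show "abelian_group (fixed_part G T \<phi>)"
      by (rule fixed_part_abelian_group[OF T.M.abelian_group_axioms closed add])
  qed (auto simp: fixed_set_def smult T.smult_l_distr T.smult_r_distr T.smult_assoc1)
qed

section \<open>The canonical homomorphism\<close>

locale equivariant_data =
  fixes K :: "('k, 'x) ring_scheme"
    and G :: "('g, 'w) monoid_scheme"
    and S :: "('k, 's, 'y) module_scheme"
    and V :: "('k, 'v, 'z) module_scheme"
    and \<beta> :: "'g \<Rightarrow> 's \<Rightarrow> 's"
    and \<rho> :: "'g \<Rightarrow> 'v \<Rightarrow> 'v"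
  assumes S: "algebra K S" and V: "module K V"
    and \<beta>: "\<And>g. g \<in> carrier G \<Longrightarrow> \<beta> g \<in> algebra_hom K S S"
    and \<rho>: "\<And>g. g \<in> carrier G \<Longrightarrow> \<rho> g \<in> LinearCombinations.module_hom K V V"

sublocale equivariant_data \<subseteq> V: module K V by (rule V)
sublocale equivariant_data \<subseteq> SV: tensor_modules K S V by (rule tensor_modules.intro[OF S V])
sublocale equivariant_data \<subseteq> SQ: tensor_graded K S "Sym K V" "sym_grade K V" V.sym_part
proof (intro tensor_graded.intro tensor_algebras.intro tensor_modules.intro tensor_algebras_axioms.intro
    tensor_graded_axioms.intro)
  show "algebra K S" by (rule S)
  show "algebra K V.SymM" by (rule V.Sym_algebra)
  then show "module K V.SymM" by (rule algebra.module)
qed (fact V.sym_grade_submodule V.sym_part_hom V.sym_part_grade V.sym_part_own V.sym_part_sum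
    V.sym_one_grade V.sym_grade_mult)+

context equivariant_data
begin

text \<open>The algebra \<open>K[V]\<close> is \<open>Q\<close>. The maps \<open>actV\<close> and \<open>actQ\<close> are the actions on
  \<open>S \<otimes> V\<close> and \<open>S \<otimes> K[V]\<close>; \<open>incl\<close> extends the inclusion of \<open>V\<close> into \<open>K[V]\<close>, and \<open>retr\<close> its
  retraction to the linear part.\<close>

abbreviation "Q \<equiv> Sym K V"
abbreviation "SV \<equiv> tensor K S V"
abbreviation "SQ \<equiv> tensor K S Q"
abbreviation "actV g \<equiv> tensor_map K S V V (\<beta> g) (\<rho> g)"
abbreviation "actQ g \<equiv> tensor_map K S Q Q (\<beta> g) (sym_map K V V (\<rho> g))"
abbreviation "incl \<equiv> tensor_map K S V Q (\<lambda>s. s) (sym_incl K V)"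
abbreviation "retr \<equiv> tensor_map K S Q V (\<lambda>s. s) V.sym_linear"
abbreviation "R \<equiv> fixed_part G S \<beta>"
abbreviation "M \<equiv> covariants K G S \<beta> V \<rho>"
abbreviation "B \<equiv> poly_invariants K G S \<beta> V \<rho>"
abbreviation "Bgr d \<equiv> poly_invariants_grade K G S \<beta> V \<rho> d"

lemmas Q_module = SQ.B_module

lemma \<beta>_homs:
  assumes "g \<in> carrier G"
  shows "\<beta> g \<in> ring_hom S S" "\<beta> g \<in> LinearCombinations.module_hom K S S"
  using \<beta>[OF assms] by (simp_all add: algebra_hom_def)

lemma \<beta>_closed: "g \<in> carrier G \<Longrightarrow> s \<in> carrier S \<Longrightarrow> \<beta> g s \<in> carrier S"
  by (rule ring_hom_closed[OF \<beta>_homs(1)])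

lemma \<rho>_closed: "g \<in> carrier G \<Longrightarrow> v \<in> carrier V \<Longrightarrow> \<rho> g v \<in> carrier V"
  using module_hom_closed[OF \<rho>] by auto

lemma sym_map_homs:
  assumes "g \<in> carrier G"
  shows "sym_map K V V (\<rho> g) \<in> algebra_hom K Q Q"
    "sym_map K V V (\<rho> g) \<in> LinearCombinations.module_hom K Q Q"
    "sym_map K V V (\<rho> g) \<in> ring_hom Q Q"
proof -
  note h = V.sym_map_ring_hom[OF V \<rho>[OF assms]]
  show "sym_map K V V (\<rho> g) \<in> ring_hom Q Q" by (rule h)
  show m: "sym_map K V V (\<rho> g) \<in> LinearCombinations.module_hom K Q Q"
    unfolding LinearCombinations.module_hom_def
    by (simp add: Pi_iff ring_hom_closed[OF h] ring_hom_add[OF h] V.sym_map_smult[OF V \<rho>[OF assms]])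
  from h m show "sym_map K V V (\<rho> g) \<in> algebra_hom K Q Q" by (simp add: algebra_hom_def)
qed

lemmas actV_facts = SV.tensor_map_facts[OF V \<beta>_homs(2) \<rho>]
lemmas actQ_facts = SQ.tensor_map_facts[OF Q_module \<beta>_homs(2) sym_map_homs(2)]
lemmas incl_facts = SV.tensor_map_facts[OF Q_module SV.id_hom V.sym_incl_hom]
lemmas retr_facts = SQ.tensor_map_facts[OF V SV.id_hom V.sym_linear_hom]

lemma actV_smult:
  assumes "g \<in> carrier G" "s \<in> carrier S" "w \<in> carrier SV"
  shows "actV g (s \<odot>\<^bsub>SV\<^esub> w) = \<beta> g s \<odot>\<^bsub>SV\<^esub> actV g w"
  using assms
  by (intro SV.tensor_map_semilinear[OF V \<beta>_homs(2) \<rho>]) (auto simp: ring_hom_mult[OF \<beta>_homs(1)] \<beta>_closed)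

lemma actQ_smult:
  assumes "g \<in> carrier G" "s \<in> carrier S" "w \<in> carrier SQ"
  shows "actQ g (s \<odot>\<^bsub>SQ\<^esub> w) = \<beta> g s \<odot>\<^bsub>SQ\<^esub> actQ g w"
  using assms
  by (intro SQ.tensor_map_semilinear[OF Q_module \<beta>_homs(2) sym_map_homs(2)])
    (auto simp: ring_hom_mult[OF \<beta>_homs(1)] \<beta>_closed)

lemma actQ_ring_hom: "g \<in> carrier G \<Longrightarrow> actQ g \<in> ring_hom SQ SQ"
  by (rule SQ.tensor_map_ring_hom[OF V.Sym_algebra \<beta> sym_map_homs(1)])

lemma M_eq: "M = fixed_part G SV actV" by (simp add: covariants_def)
lemma B_eq: "B = fixed_part G SQ actQ" by (simp add: poly_invariants_def)

lemma R_cring: "cring R"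
  by (rule fixed_part_cring[OF SV.S.M_cring \<beta>_homs(1)])

lemma M_module: "module R M"
  unfolding M_eq
  by (rule fixed_part_module[OF SV.tensor_module \<beta>_homs(1)])
    (simp_all add: actV_facts actV_smult)

lemma B_cring: "cring B"
  unfolding B_eq by (rule fixed_part_cring[OF SQ.tensor_cring actQ_ring_hom])

lemma B_algebra: "algebra R B"
proof -
  interpret T: algebra S SQ by (rule SQ.tensor_algebra)
  interpret B: module R B
    unfolding B_eq by (rule fixed_part_module[OF SQ.tensor_module \<beta>_homs(1)])
      (simp_all add: actQ_facts actQ_smult)
  have "(a \<odot>\<^bsub>B\<^esub> x) \<otimes>\<^bsub>B\<^esub> y = a \<odot>\<^bsub>B\<^esub> (x \<otimes>\<^bsub>B\<^esub> y)"
    if "a \<in> carrier R" "x \<in> carrier B" "y \<in> carrier B" for a x y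
    using that by (simp add: B_eq fixed_set_def T.smult_assoc2)
  then show ?thesis
    by (intro algebra.intro algebra_axioms.intro B.module_axioms B_cring)
qed

lemma M_mem: "w \<in> carrier M \<longleftrightarrow> w \<in> carrier SV \<and> (\<forall>g\<in>carrier G. actV g w = w)"
  by (simp add: M_eq fixed_set_def)

lemma B_mem: "w \<in> carrier B \<longleftrightarrow> w \<in> carrier SQ \<and> (\<forall>g\<in>carrier G. actQ g w = w)"
  by (simp add: B_eq fixed_set_def)

lemma Bgr_mem: "w \<in> Bgr d \<longleftrightarrow> w \<in> carrier B \<and> SQ.proj d w = w"
  using SQ.tgr_iff[of w d] B_mem[of w] by (auto simp: poly_invariants_grade_def)

lemma B_ops [simp]:
  "\<zero>\<^bsub>B\<^esub> = \<zero>\<^bsub>SQ\<^esub>" "\<one>\<^bsub>B\<^esub> = \<one>\<^bsub>SQ\<^esub>" "x \<oplus>\<^bsub>B\<^esub> y = x \<oplus>\<^bsub>SQ\<^esub> y" "x \<otimes>\<^bsub>B\<^esub> y = x \<otimes>\<^bsub>SQ\<^esub> y"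
  "r \<odot>\<^bsub>B\<^esub> x = r \<odot>\<^bsub>SQ\<^esub> x"
  by (simp_all add: B_eq)

lemma M_ops [simp]:
  "x \<oplus>\<^bsub>M\<^esub> y = x \<oplus>\<^bsub>SV\<^esub> y" "r \<odot>\<^bsub>M\<^esub> x = r \<odot>\<^bsub>SV\<^esub> x"
  by (simp_all add: M_eq)

text \<open>Substitutions preserve degrees. Hence the homogeneous components of an invariant are invariant.\<close>

lemma proj_actQ:
  assumes g: "g \<in> carrier G" and w: "w \<in> carrier SQ"
  shows "SQ.proj d (actQ g w) = actQ g (SQ.proj d w)"
  using w
proof (induction w rule: SQ.T_induct)
  case (pure s b)
  then show ?case
    using g by (simp add: actQ_facts SQ.proj_facts \<beta>_closed ring_hom_closed[OF sym_map_homs(3)]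
      V.sym_map_part[OF V \<rho>])
qed (use g in \<open>simp add: actQ_facts SQ.proj_facts\<close>)

lemma proj_B: "w \<in> carrier B \<Longrightarrow> SQ.proj d w \<in> carrier B"
  by (auto simp: B_mem SQ.proj_facts simp flip: proj_actQ)

theorem B_graded: "graded_algebra R B Bgr"
proof (rule graded_algebraI[where \<pi> = SQ.proj, OF B_algebra])
  interpret B: algebra R B by (rule B_algebra)
  fix d
  show "Module.submodule (Bgr d) R B"
  proof (rule B.submoduleI)
    show "Bgr d \<subseteq> carrier B" by (auto simp: Bgr_mem)
    show zero: "\<zero>\<^bsub>B\<^esub> \<in> Bgr d" using B.zero_closed by (simp add: Bgr_mem SQ.proj_zero)
    show add: "x \<oplus>\<^bsub>B\<^esub> y \<in> Bgr d" if "x \<in> Bgr d" "y \<in> Bgr d" for x y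
      using that B.a_closed[of x y] by (simp add: Bgr_mem B_mem[of x] B_mem[of y] SQ.proj_facts)
    show smult: "r \<odot>\<^bsub>B\<^esub> x \<in> Bgr d" if "r \<in> carrier R" "x \<in> Bgr d" for r x
      using that B.smult_closed[of r x] by (simp add: Bgr_mem B_mem[of x] fixed_set_def SQ.proj_smult)
    show "\<ominus>\<^bsub>B\<^esub> x \<in> Bgr d" if "x \<in> Bgr d" for x
    proof -
      have "\<ominus>\<^bsub>B\<^esub> x = (\<ominus>\<^bsub>R\<^esub> \<one>\<^bsub>R\<^esub>) \<odot>\<^bsub>B\<^esub> x"
        using that by (simp add: Bgr_mem B.smult_l_minus del: fixed_part_simps B_ops)
      then show ?thesis using smult[of "\<ominus>\<^bsub>R\<^esub> \<one>\<^bsub>R\<^esub>" x] that by (simp del: fixed_part_simps B_ops)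
    qed
  qed
  show "SQ.proj d x \<in> Bgr d" if "x \<in> carrier B" for x
    using that proj_B[OF that, of d] by (simp add: Bgr_mem B_mem[of x] SQ.proj_proj)
  show "SQ.proj d (x \<oplus>\<^bsub>B\<^esub> y) = SQ.proj d x \<oplus>\<^bsub>B\<^esub> SQ.proj d y" if "x \<in> carrier B" "y \<in> carrier B" for x y
    using that by (simp add: B_mem SQ.proj_facts)
  show "SQ.proj e x = (if e = d then x else \<zero>\<^bsub>B\<^esub>)" if "x \<in> Bgr d" for e x
    using that SQ.proj_own[of x d e] by (simp add: poly_invariants_grade_def)
  show "\<exists>n. \<forall>N\<ge>n. x = (\<Oplus>\<^bsub>B\<^esub>d\<in>{..<N}. SQ.proj d x)" if x: "x \<in> carrier B" for x
  proof -
    have "(\<Oplus>\<^bsub>B\<^esub>d\<in>{..<N}. SQ.proj d x) = (\<Oplus>\<^bsub>SQ\<^esub>d\<in>{..<N}. SQ.proj d x)" for N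
    proof -
      have B: "B = SQ\<lparr>carrier := carrier B\<rparr>" by (simp add: B_eq fixed_part_def)
      show ?thesis
        by (subst B, rule finsum_carrier_update)
          (use B proj_B[OF x] B.abelian_monoid_axioms SQ.T.abelian_monoid_axioms in \<open>auto simp: B_mem\<close>)
    qed
    then show ?thesis using SQ.proj_sum[of x] x by (simp add: B_mem)
  qed
  show "\<one>\<^bsub>B\<^esub> \<in> Bgr 0"
    using B.one_closed SQ.tgr_one by (simp add: poly_invariants_grade_def)
  show "x \<otimes>\<^bsub>B\<^esub> y \<in> Bgr (d + e)" if "x \<in> Bgr d" "y \<in> Bgr e" for e x y
    using that SQ.tgr_mult[of x d y e] B.m_closed[of x y] by (simp add: poly_invariants_grade_def)
qed

lemma incl_act:
  assumes g: "g \<in> carrier G" and w: "w \<in> carrier SV"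
  shows "actQ g (incl w) = incl (actV g w)"
  using w
proof (induction w rule: SV.T_induct)
  case (pure s v)
  then show ?case
    using g by (simp add: actQ_facts actV_facts incl_facts \<beta>_closed \<rho>_closed V.sym_map_incl[OF V \<rho>])
qed (use g in \<open>simp add: actQ_facts actV_facts incl_facts\<close>)

lemma retr_incl: "w \<in> carrier SV \<Longrightarrow> retr (incl w) = w"
proof (induction w rule: SV.T_induct)
  case (pure s v)
  then show ?case by (simp add: incl_facts retr_facts V.sym_linear_incl)
qed (simp add: incl_facts retr_facts)

lemma incl_M: "w \<in> carrier M \<Longrightarrow> incl w \<in> carrier B"
  by (auto simp: M_mem B_mem incl_facts incl_act)

lemma incl_hom: "incl \<in> LinearCombinations.module_hom R M B"
proof -
  have "incl (s \<odot>\<^bsub>SV\<^esub> w) = s \<odot>\<^bsub>SQ\<^esub> incl w" if "s \<in> carrier S" "w \<in> carrier SV" for s w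
    using SV.tensor_map_semilinear[OF Q_module SV.id_hom V.sym_incl_hom, where h' = "\<lambda>s. s"] that by simp
  then show ?thesis unfolding LinearCombinations.module_hom_def
    by (simp add: Pi_iff incl_M M_mem fixed_set_def incl_facts)
qed

lemma proj_1_range:
  "w \<in> carrier SQ \<Longrightarrow> \<exists>u\<in>carrier SV. SQ.proj 1 w = incl u"
proof (induction w rule: SQ.T_induct)
  case (pure s b)
  have "V.sym_part 1 b \<in> sym_incl K V ` carrier V"
    using V.sym_part_grade[OF pure(2)] unfolding V.sym_grade_1[symmetric] .
  then obtain v where v: "v \<in> carrier V" "V.sym_part 1 b = sym_incl K V v" by blast
  with pure show ?case
    by (intro bexI[of _ "SV.pure s v"]) (simp_all add: SQ.proj_facts incl_facts)
next
  case (add v w)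
  then obtain u u' where "u \<in> carrier SV" "SQ.proj 1 v = incl u" "u' \<in> carrier SV" "SQ.proj 1 w = incl u'"
    by blast
  with add show ?case
    by (intro bexI[of _ "u \<oplus>\<^bsub>SV\<^esub> u'"]) (simp_all add: SQ.proj_facts incl_facts)
qed

lemma incl_grade_1: "w \<in> carrier SV \<Longrightarrow> SQ.proj 1 (incl w) = incl w"
proof (induction w rule: SV.T_induct)
  case (pure s v)
  have "sym_incl K V v \<in> sym_grade K V 1" unfolding V.sym_grade_1 using pure by (intro imageI)
  then have "V.sym_part 1 (sym_incl K V v) = sym_incl K V v" by (subst V.sym_part_own) auto
  with pure show ?case by (simp add: incl_facts SQ.proj_facts)
qed (simp add: incl_facts SQ.proj_facts)

lemma proj_0_range:
  "w \<in> carrier SQ \<Longrightarrow> \<exists>s\<in>carrier S. SQ.proj 0 w = SQ.pure s \<one>\<^bsub>Q\<^esub>"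
proof (induction w rule: SQ.T_induct)
  case (pure s b)
  obtain k where k: "k \<in> carrier K" "V.sym_part 0 b = k \<odot>\<^bsub>Q\<^esub> \<one>\<^bsub>Q\<^esub>"
    using V.sym_part_grade[OF pure(2), of 0] unfolding V.sym_grade_0 by blast
  then have "SQ.proj 0 (SQ.pure s b) = SQ.pure (k \<odot>\<^bsub>S\<^esub> s) \<one>\<^bsub>Q\<^esub>"
    using pure by (simp add: SQ.proj_facts SQ.pure_balanced)
  with pure k show ?case by (intro bexI[of _ "k \<odot>\<^bsub>S\<^esub> s"]) simp_all
next
  case (add v w)
  then obtain s t where "s \<in> carrier S" "SQ.proj 0 v = SQ.pure s \<one>\<^bsub>Q\<^esub>"
    "t \<in> carrier S" "SQ.proj 0 w = SQ.pure t \<one>\<^bsub>Q\<^esub>" by blast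
  with add show ?case
    by (intro bexI[of _ "s \<oplus>\<^bsub>S\<^esub> t"]) (simp_all add: SQ.proj_facts SQ.pure_add_left)
qed

text \<open>The map \<open>s \<otimes> b \<mapsto> b\<^sub>0 s\<close>, with \<open>b\<^sub>0\<close> the constant coefficient of \<open>b\<close>, recovers \<open>s\<close> from \<open>s \<otimes> 1\<close>.\<close>

lemma pure_one_inject:
  assumes "s \<in> carrier S" "t \<in> carrier S" and eq: "SQ.pure s \<one>\<^bsub>Q\<^esub> = SQ.pure t \<one>\<^bsub>Q\<^esub>"
  shows "s = t"
proof -
  obtain e where e: "\<And>s b. s \<in> carrier S \<Longrightarrow> b \<in> carrier Q \<Longrightarrow> e (SQ.pure s b) = V.sym_coeff0 b \<odot>\<^bsub>S\<^esub> s"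
  proof (rule SQ.tensor_universal[of S "\<lambda>s b. V.sym_coeff0 b \<odot>\<^bsub>S\<^esub> s"])
    fix k s b assume *: "k \<in> carrier K" "s \<in> carrier S" "b \<in> carrier Q"
    note c = V.sym_coeff0_closed[OF *(3)]
    have "V.sym_coeff0 b \<odot>\<^bsub>S\<^esub> (k \<odot>\<^bsub>S\<^esub> s) = (k \<otimes>\<^bsub>K\<^esub> V.sym_coeff0 b) \<odot>\<^bsub>S\<^esub> s"
      using * c by (simp add: V.m_comm[of k] flip: SV.S.smult_assoc1)
    with * show "V.sym_coeff0 b \<odot>\<^bsub>S\<^esub> (k \<odot>\<^bsub>S\<^esub> s) = V.sym_coeff0 (k \<odot>\<^bsub>Q\<^esub> b) \<odot>\<^bsub>S\<^esub> s"
      by (simp add: V.sym_coeff0_smult)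
  next
    fix h assume "\<And>s b. s \<in> carrier S \<Longrightarrow> b \<in> carrier Q \<Longrightarrow> h (SQ.pure s b) = V.sym_coeff0 b \<odot>\<^bsub>S\<^esub> s"
    then show thesis by (rule that)
  qed (simp_all add: SV.S.is_abelian_group V.sym_coeff0_closed V.sym_coeff0_add SV.S.smult_l_distr
      SV.S.smult_r_distr)
  have "s = e (SQ.pure s \<one>\<^bsub>Q\<^esub>)" "t = e (SQ.pure t \<one>\<^bsub>Q\<^esub>)"
    using assms(1,2) by (simp_all add: e V.sym_coeff0_one)
  with eq show ?thesis by simp
qed

lemma incl_Bgr_1: "m \<in> carrier M \<Longrightarrow> incl m \<in> Bgr 1"
  using incl_M[of m] incl_grade_1[of m] by (simp add: Bgr_mem M_mem)

interpretation RM: module R M by (rule M_module)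

text \<open>Elements of \<open>M\<close> are sent to degree 1, and a monomial of degree \<open>d\<close> is a product of \<open>d\<close> of them.\<close>

lemma hom_grade:
  assumes \<phi>: "\<phi> \<in> algebra_hom R (Sym R M) B"
    and \<phi>_incl: "\<And>m. m \<in> carrier M \<Longrightarrow> \<phi> (sym_incl R M m) = incl m"
  shows "\<phi> ` sym_grade R M d \<subseteq> Bgr d"
proof -
  interpret B: algebra R B by (rule B_algebra)
  have hom: "\<phi> \<in> ring_hom (Sym R M) B" using \<phi> by (simp add: algebra_hom_def)
  have sub: "Module.submodule (Bgr d) R B" for d
    using B_graded by (simp add: graded_algebra_def)
  have mult: "x \<otimes>\<^bsub>B\<^esub> y \<in> Bgr (d + e)" if "x \<in> Bgr d" "y \<in> Bgr e" for x y d e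
    using B_graded that by (simp add: graded_algebra_def)
  have zero: "\<phi> (RM.cls (RM.indexed_const \<zero>\<^bsub>R\<^esub>)) \<in> Bgr d" for d
  proof -
    have "\<phi> (RM.cls (RM.indexed_const \<zero>\<^bsub>R\<^esub>)) = \<zero>\<^bsub>R\<^esub> \<odot>\<^bsub>B\<^esub> \<one>\<^bsub>B\<^esub>"
      using R_cring by (intro RM.algebra_hom_const[OF B_algebra \<phi>] cring.cring_simprules(2))
    also have "\<dots> = \<zero>\<^bsub>B\<^esub>" by (rule B.smult_l_null[OF B.one_closed])
    also have "\<dots> \<in> Bgr d" using subgroup.one_closed[OF submodule.axioms(1)[OF sub]] by simp
    finally show ?thesis .
  qed
  have "\<phi> (RM.cls (RM.hom_part d p)) \<in> Bgr d" if "p \<in> carrier RM.PM" for p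
    using that
  proof (induction p arbitrary: d rule: RM.polys_induct)
    case (const k)
    have "\<phi> (RM.cls (RM.indexed_const k)) = k \<odot>\<^bsub>B\<^esub> \<one>\<^bsub>B\<^esub>"
      by (rule RM.algebra_hom_const[OF B_algebra \<phi> const])
    moreover have "\<one>\<^bsub>B\<^esub> \<in> Bgr 0" using B_graded by (simp add: graded_algebra_def)
    ultimately have "\<phi> (RM.cls (RM.indexed_const k)) \<in> Bgr 0"
      using B.submoduleE(4)[OF sub const] by metis
    then show ?case using zero by (simp add: RM.hom_part_const)
  next
    case (add p q)
    have "\<phi> (RM.cls (RM.hom_part d (p \<oplus>\<^bsub>RM.PM\<^esub> q)))
        = \<phi> (RM.cls (RM.hom_part d p)) \<oplus>\<^bsub>B\<^esub> \<phi> (RM.cls (RM.hom_part d q))"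
      using add(1,2) by (simp only: RM.hom_part_add RM.cls_add RM.hom_part_in_polys
          ring_hom_add[OF hom] RM.cls_closed)
    then show ?case using B.submoduleE(5)[OF sub add(3,4)] by metis
  next
    case (pmult p m)
    show ?case
    proof (cases d)
      case 0
      then show ?thesis using zero by (simp only: RM.hom_part_pmult_0)
    next
      case (Suc e)
      have "\<phi> (RM.cls (RM.hom_part d (RM.indexed_pmult p m)))
          = incl m \<otimes>\<^bsub>B\<^esub> \<phi> (RM.cls (RM.hom_part e p))"
        using pmult(1,2) by (simp only: Suc RM.hom_part_pmult_Suc RM.cls_pmult RM.hom_part_in_polys
          ring_hom_mult[OF hom] RM.cls_closed RM.sym_incl_closed \<phi>_incl)
      then show ?thesis using mult[OF incl_Bgr_1[OF pmult(2)] pmult(3)[of e]] Suc by simp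
    qed
  qed
  then show ?thesis unfolding RM.sym_grade_eq by blast
qed

text \<open>An element of degree 0 is \<open>s \<otimes> 1\<close> for exactly one \<open>s\<close>. Since \<open>g\<close> sends it to \<open>(\<beta> g s) \<otimes> 1\<close>, it is
  invariant exactly when \<open>s\<close> is.\<close>

lemma hom_bij_grade_0:
  assumes \<phi>: "\<phi> \<in> algebra_hom R (Sym R M) B"
  shows "bij_betw \<phi> (sym_grade R M 0) (Bgr 0)"
proof -
  have \<phi>_one: "\<phi> (r \<odot>\<^bsub>Sym R M\<^esub> \<one>\<^bsub>Sym R M\<^esub>) = SQ.pure r \<one>\<^bsub>Q\<^esub>" if r: "r \<in> carrier R" for r
  proof -
    interpret A: algebra R "Sym R M" by (rule RM.Sym_algebra)
    have rS: "r \<in> carrier S" using r by (simp add: fixed_set_def)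
    have "r \<odot>\<^bsub>Sym R M\<^esub> \<one>\<^bsub>Sym R M\<^esub> = RM.cls (RM.indexed_const r)"
      using r RM.Sym_smult A.r_one RM.cls_closed RM.const_in_polys by metis
    then have "\<phi> (r \<odot>\<^bsub>Sym R M\<^esub> \<one>\<^bsub>Sym R M\<^esub>) = r \<odot>\<^bsub>B\<^esub> \<one>\<^bsub>B\<^esub>"
      using RM.algebra_hom_const[OF B_algebra \<phi> r] by simp
    also have "\<dots> = SQ.pure r \<one>\<^bsub>Q\<^esub>" using rS by (simp add: SQ.T_one SQ.T_smult_pure)
    finally show ?thesis .
  qed
  have RS: "r \<in> carrier S" if "r \<in> carrier R" for r using that by (simp add: fixed_set_def)
  show ?thesis
  proof (rule bij_betw_imageI)
    show "inj_on \<phi> (sym_grade R M 0)"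
    proof (rule inj_onI)
      fix v w assume "v \<in> sym_grade R M 0" "w \<in> sym_grade R M 0" and eq: "\<phi> v = \<phi> w"
      then obtain r t where r: "r \<in> carrier R" "v = r \<odot>\<^bsub>Sym R M\<^esub> \<one>\<^bsub>Sym R M\<^esub>"
        and t: "t \<in> carrier R" "w = t \<odot>\<^bsub>Sym R M\<^esub> \<one>\<^bsub>Sym R M\<^esub>"
        unfolding RM.sym_grade_0 by blast
      have "SQ.pure r \<one>\<^bsub>Q\<^esub> = SQ.pure t \<one>\<^bsub>Q\<^esub>"
        using eq unfolding r(2) t(2) \<phi>_one[OF r(1)] \<phi>_one[OF t(1)] .
      then show "v = w" using pure_one_inject[OF RS[OF r(1)] RS[OF t(1)]] r t by simp
    qed
    show "\<phi> ` sym_grade R M 0 = Bgr 0"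
    proof (intro equalityI subsetI)
      fix w assume w: "w \<in> \<phi> ` sym_grade R M 0"
      then obtain r where r: "r \<in> carrier R" "w = SQ.pure r \<one>\<^bsub>Q\<^esub>"
        unfolding RM.sym_grade_0 using \<phi>_one by blast
      have "w \<in> carrier B"
        using r RS[OF r(1)] by (simp add: B_mem actQ_facts ring_hom_one[OF sym_map_homs(3)] fixed_set_def)
      moreover have "SQ.proj 0 w = w"
        using r RS[OF r(1)] by (simp add: SQ.proj_facts V.sym_part_own[OF V.sym_one_grade])
      ultimately show "w \<in> Bgr 0" by (simp add: Bgr_mem)
    next
      fix w assume w: "w \<in> Bgr 0"
      then have wQ: "w \<in> carrier SQ" and act: "\<And>g. g \<in> carrier G \<Longrightarrow> actQ g w = w"
        by (auto simp: Bgr_mem B_mem)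
      obtain s where s: "s \<in> carrier S" "w = SQ.pure s \<one>\<^bsub>Q\<^esub>"
        using proj_0_range[OF wQ] w by (auto simp: Bgr_mem)
      have "\<beta> g s = s" if g: "g \<in> carrier G" for g
      proof (rule pure_one_inject)
        show "SQ.pure (\<beta> g s) \<one>\<^bsub>Q\<^esub> = SQ.pure s \<one>\<^bsub>Q\<^esub>"
          using act[OF g] s g by (simp add: actQ_facts ring_hom_one[OF sym_map_homs(3)])
      qed (use s g \<beta>_closed in auto)
      then have "s \<in> carrier R" using s by (simp add: fixed_set_def)
      then show "w \<in> \<phi> ` sym_grade R M 0"
        unfolding RM.sym_grade_0 s(2) \<phi>_one[OF \<open>s \<in> carrier R\<close>, symmetric] by blast
    qed
  qed
qed

text \<open>An element of degree 1 is \<open>incl u\<close> for exactly one \<open>u\<close>, and by equivariance it is invariant exactly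
  when \<open>u\<close> is.\<close>

lemma hom_bij_grade_1:
  assumes \<phi>_incl: "\<And>m. m \<in> carrier M \<Longrightarrow> \<phi> (sym_incl R M m) = incl m"
  shows "bij_betw \<phi> (sym_grade R M 1) (Bgr 1)"
proof (rule bij_betw_imageI)
  show "inj_on \<phi> (sym_grade R M 1)"
    unfolding RM.sym_grade_1
  proof (rule inj_onI, elim imageE)
    fix v w m n assume "\<phi> v = \<phi> w" and v: "v = sym_incl R M m" "m \<in> carrier M"
      and w: "w = sym_incl R M n" "n \<in> carrier M"
    then have "incl m = incl n" by (simp add: \<phi>_incl)
    then have "retr (incl m) = retr (incl n)" by (rule arg_cong)
    with v w show "v = w" by (simp add: retr_incl M_mem)
  qed
  show "\<phi> ` sym_grade R M 1 = Bgr 1"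
  proof (intro equalityI subsetI)
    fix w assume "w \<in> \<phi> ` sym_grade R M 1"
    then obtain m where "m \<in> carrier M" "w = incl m" unfolding RM.sym_grade_1 using \<phi>_incl by auto
    then show "w \<in> Bgr 1" by (simp add: incl_Bgr_1 del: One_nat_def)
  next
    fix w assume w: "w \<in> Bgr 1"
    then have wQ: "w \<in> carrier SQ" and act: "\<And>g. g \<in> carrier G \<Longrightarrow> actQ g w = w" and pr: "SQ.proj 1 w = w"
      by (auto simp: Bgr_mem B_mem)
    obtain u where u: "u \<in> carrier SV" "w = incl u"
      using proj_1_range[OF wQ] pr by auto
    have "actV g u = u" if g: "g \<in> carrier G" for g
    proof -
      have "incl (actV g u) = incl u" using incl_act[OF g u(1)] act[OF g] u(2) by simp
      then have "retr (incl (actV g u)) = retr (incl u)" by (rule arg_cong)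
      then show ?thesis using u(1) g by (simp add: retr_incl actV_facts)
    qed
    with u(1) have "u \<in> carrier M" by (simp add: M_mem)
    then show "w \<in> \<phi> ` sym_grade R M 1"
      unfolding RM.sym_grade_1 u(2) \<phi>_incl[OF \<open>u \<in> carrier M\<close>, symmetric] by blast
  qed
qed

theorem canonical_hom:
  "\<exists>\<phi> \<in> algebra_hom R (Sym R M) B.
      (\<forall>m\<in>carrier M. \<phi> (sym_incl R M m) = incl m) \<and>
      (\<forall>\<psi> \<in> algebra_hom R (Sym R M) B. (\<forall>m\<in>carrier M. \<psi> (sym_incl R M m) = incl m) \<longrightarrow>
          (\<forall>x\<in>carrier (Sym R M). \<psi> x = \<phi> x)) \<and>
      (\<forall>d. \<phi> ` sym_grade R M d \<subseteq> Bgr d) \<and>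
      bij_betw \<phi> (sym_grade R M 0) (Bgr 0) \<and>
      bij_betw \<phi> (sym_grade R M 1) (Bgr 1)"
proof -
  obtain \<phi> where \<phi>: "\<phi> \<in> algebra_hom R (Sym R M) B"
    and \<phi>_incl: "\<And>m. m \<in> carrier M \<Longrightarrow> \<phi> (sym_incl R M m) = incl m"
    using RM.Sym_universal[OF B_algebra incl_hom] by blast
  have "\<psi> x = \<phi> x" if "\<psi> \<in> algebra_hom R (Sym R M) B" "\<forall>m\<in>carrier M. \<psi> (sym_incl R M m) = incl m"
    "x \<in> carrier (Sym R M)" for \<psi> x
    using that(2) \<phi>_incl by (intro RM.Sym_hom_eqI[OF B_algebra \<phi> that(1) _ that(3)]) simp
  then show ?thesis
    using hom_grade[OF \<phi> \<phi>_incl] hom_bij_grade_0[OF \<phi>] hom_bij_grade_1[OF \<phi>_incl] \<phi>_incl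
    by (intro bexI[OF _ \<phi>] conjI allI ballI impI) auto
qed

lemmas Sym_M_graded = RM.Sym_graded

end

theorem lemma5p3:
  fixes K :: "('k, 'x) ring_scheme"
    and G :: "('g, 'w) monoid_scheme"
    and S :: "('k, 's, 'y) module_scheme"
    and V :: "('k, 'v, 'z) module_scheme"
    and \<beta> :: "'g \<Rightarrow> 's \<Rightarrow> 's"
    and \<rho> :: "'g \<Rightarrow> 'v \<Rightarrow> 'v"
  assumes "field K"
    and "group G" and "finite (carrier G)"
    and "algebra K S"
    and "right_action G (carrier S) \<beta>"
    and "\<And>g. g \<in> carrier G \<Longrightarrow> \<beta> g \<in> algebra_hom K S S"
    and "faithful_on G (carrier S) \<beta>"
    and "vectorspace K V" and "vectorspace.fin_dim K V"
    and "right_action G (carrier V) \<rho>"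
    and "\<And>g. g \<in> carrier G \<Longrightarrow> \<rho> g \<in> LinearCombinations.module_hom K V V"
    and R: "R = fixed_part G S \<beta>"
    and M: "M = covariants K G S \<beta> V \<rho>"
    and B: "B = poly_invariants K G S \<beta> V \<rho>"
    and B_grade: "B_grade = poly_invariants_grade K G S \<beta> V \<rho>"
    and j: "j = tensor_map K S V (Sym K V) id (sym_incl K V)"
  shows "module R M \<and>
    graded_algebra R (Sym R M) (sym_grade R M) \<and>
    graded_algebra R B B_grade \<and>
    j \<in> LinearCombinations.module_hom R M B \<and>
    (\<exists>\<phi> \<in> algebra_hom R (Sym R M) B.
      (\<forall>m\<in>carrier M. \<phi> (sym_incl R M m) = j m) \<and>
      (\<forall>\<psi> \<in> algebra_hom R (Sym R M) B. (\<forall>m\<in>carrier M. \<psi> (sym_incl R M m) = j m) \<longrightarrow>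
          (\<forall>x\<in>carrier (Sym R M). \<psi> x = \<phi> x)) \<and>
      (\<forall>d. \<phi> ` sym_grade R M d \<subseteq> B_grade d) \<and>
      bij_betw \<phi> (sym_grade R M 0) (B_grade 0) \<and>
      bij_betw \<phi> (sym_grade R M 1) (B_grade 1))"
proof -
  interpret vectorspace K V by fact
  interpret equivariant_data K G S V \<beta> \<rho>
    by (rule equivariant_data.intro) (fact assms | rule module_axioms)+
  have j': "j = tensor_map K S V (Sym K V) (\<lambda>s. s) (sym_incl K V)" unfolding j id_def ..
  show ?thesis
    unfolding R M B B_grade j'
    using M_module Sym_M_graded B_graded incl_hom canonical_hom by blast
qed

end
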